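(* Let $N\ge3$, $\beta<N-2$, $m>0$, $b\ge0$, and let $d\mu=\frac{1}{|x|^\beta}\rho(x)\,dx$ on $\mathbb{R}^N$ with $\rho(x)=e^{-b|x|^m}$. Then there exists a constant $C\ge0$ such that for all $u\in H^1_\mu$ $$\left(\frac{N-\beta-2}{2}\right)^2\int_{\mathbb{R}^N}\frac{u^2}{|x|^2}\,d\mu\le\int_{\mathbb{R}^N}|\nabla u|^2\,d\mu+C\int_{\mathbb{R}^N}u^2\,d\mu,$$ and $\left(\frac{N-\beta-2}{2}\right)^2$ is the best constant.
   Context: $L^2_\mu:=L^2(\mathbb{R}^N,d\mu)$, and $H^1_\mu$ is the Sobolev space of functions in $L^2_\mu$ whose weak first derivatives belong to $L^2_\mu$; functions are real-valued. "Best constant" means that for every larger $c$ in place of $\left(\frac{N-\beta-2}{2}\right)^2$ there is no constant $C$ for which the inequality holds for all $u\in H^1_\mu$. *)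

theory Defs
  imports "HOL-Analysis.Analysis"
begin

definition partial_deriv :: "'n::finite \<Rightarrow> (real^'n \<Rightarrow> real) \<Rightarrow> real^'n \<Rightarrow> real" where
  "partial_deriv i f x = frechet_derivative f (at x) (axis i 1)"

fun C_k :: "nat \<Rightarrow> (real^'n::finite \<Rightarrow> real) \<Rightarrow> bool" where
  "C_k 0 f \<longleftrightarrow> continuous_on UNIV f"
| "C_k (Suc k) f \<longleftrightarrow> (\<forall>x. f differentiable (at x)) \<and> (\<forall>i. C_k k (partial_deriv i f))"

definition test_function :: "(real^'n::finite \<Rightarrow> real) \<Rightarrow> bool" where
  "test_function \<phi> \<longleftrightarrow> (\<forall>k. C_k k \<phi>) \<and> compact (closure {x. \<phi> x \<noteq> 0})"

definition locally_integrable :: "(real^'n::finite \<Rightarrow> real) \<Rightarrow> bool" where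
  "locally_integrable f \<longleftrightarrow> (\<forall>K. compact K \<longrightarrow> f absolutely_integrable_on K)"

definition has_weak_partial_deriv ::
    "'n::finite \<Rightarrow> (real^'n \<Rightarrow> real) \<Rightarrow> (real^'n \<Rightarrow> real) \<Rightarrow> bool" where
  "has_weak_partial_deriv i u v \<longleftrightarrow>
     locally_integrable u \<and> locally_integrable v \<and>
     (\<forall>\<phi>. test_function \<phi> \<longrightarrow>
        (\<integral>x. u x * partial_deriv i \<phi> x \<partial>lebesgue) = - (\<integral>x. v x * \<phi> x \<partial>lebesgue))"

(* Weak derivatives are unique up to null sets; the choice picks a representative. *)
definition weak_gradient :: "(real^'n::finite \<Rightarrow> real) \<Rightarrow> real^'n \<Rightarrow> real^'n" where
  "weak_gradient u x = (\<chi> i. (SOME v. has_weak_partial_deriv i u v) x)"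

(* Functions rather than almost-everywhere classes. *)
definition L2 :: "'a measure \<Rightarrow> ('a \<Rightarrow> real) set" where
  "L2 M = {u \<in> borel_measurable M. integrable M (\<lambda>x. (u x)\<^sup>2)}"

(* Differentiation is with respect to Lebesgue measure on the whole space; only the
   integrability of the function and of its derivatives refers to M. *)
definition H1 :: "(real^'n::finite) measure \<Rightarrow> (real^'n \<Rightarrow> real) set" where
  "H1 M = {u \<in> L2 M. \<forall>i. \<exists>v \<in> L2 M. has_weak_partial_deriv i u v}"

(* The value of the density at the origin is irrelevant, as the origin is a null set. *)
definition weighted_measure :: "real \<Rightarrow> real \<Rightarrow> real \<Rightarrow> (real^'n::finite) measure" where
  "weighted_measure \<beta> b m =
     density lebesgue (\<lambda>x. ennreal (1 / norm x powr \<beta> * exp (- b * norm x powr m)))"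

end

theory Submission
  imports Defs
begin

text \<open>Write \<open>W(r) = r^(-\<beta>) exp(- b r^m)\<close> and \<open>\<alpha> = (N - \<beta> - 2) / 2\<close>. For a vector field \<open>F\<close>, expanding
  \<open>0 \<le> \<integral> |\<nabla>u - u F|^2 W\<close> and integrating \<open>2 u \<nabla>u = \<nabla>(u^2)\<close> by parts gives
  \<open>\<integral> |\<nabla>u|^2 W \<ge> - \<integral> u^2 (div (W F) + |F|^2 W)\<close>. We take \<open>F = - P(r) x / r^2\<close> with \<open>P = \<alpha> + A r^m\<close> near the
  origin, cut off near \<open>0\<close> and for large \<open>r\<close>; the integrand on the right is then at least
  \<open>\<alpha>^2 u^2 W / r^2 - C u^2 W\<close> wherever the cut-off near \<open>0\<close> equals one, and Fatou's lemma removes that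
  cut-off. As \<open>F\<close> is supported in an annulus, where \<open>W\<close> is bounded above and below, the integration by
  parts only needs the product rule for \<open>u^2\<close> with \<open>u\<close> and \<open>\<nabla>u\<close> locally square integrable.

  For the optimality, \<open>r^(-\<alpha>)\<close> cut off to \<open>exp(-4 n) \<le> r \<le> exp(-n)\<close> has energy at most
  \<open>(1 + d) \<alpha>^2\<close> times its potential energy plus \<open>O(1 / n)\<close>, while the potential energy grows like \<open>n\<close>.\<close>

section \<open>Functions of class \<open>C_k\<close>\<close>

text \<open>Near the origin \<open>F\<close> is the logarithmic gradient of r^(-\<alpha>) exp(-A r^m
  / m). The power r^(-\<alpha>) is the virtual ground state of the Hardy operator, which is why the
  same power saturates the inequality. The exponential is a correction of lower order:
  differentiating the weight produces a term of order r^(m-2), which no multiple of u^2 absorbs when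
  m < 2. The obstacle is the origin, where the weight may blow up or vanish according to the sign of
  \<beta>. So u is never approximated by smooth functions in the weighted norm. Integration by parts
  takes place in an annulus with respect to Lebesgue measure, where difference quotients of u
  converge in L2. The cut-off sits in the field and not in u, so that its derivative enters with a
  definite sign. For the optimality the shells move towards the origin as n grows: there exp(-b r^m)
  is bounded below, and u^2 is at most n^(-2) times u^2 / r^2. The growth of the potential energy is
  never computed. Shells of equal logarithmic length have equal mass by dilation invariance, and
  this common mass cancels from the final estimate.\<close>

lemma partial_deriv_eqI:
  assumes "(f has_derivative f') (at x)"
  shows "partial_deriv i f x = f' (axis i 1)"
  using frechet_derivative_at[OF assms] by (simp add: partial_deriv_def)

lemma partial_deriv_eq_0:
  assumes "open S" "x \<in> S" "\<And>y. y \<in> S \<Longrightarrow> f y = c"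
  shows "partial_deriv i f x = 0"
proof -
  have "(f has_derivative (\<lambda>_. 0)) (at x)"
    by (rule has_derivative_transform_within_open[OF has_derivative_const[of c] assms(1,2)])
       (use assms(3) in auto)
  then show ?thesis by (simp add: partial_deriv_eqI)
qed

text \<open>The recursion asks for differentiability and for \<open>C_k k\<close> partial
  derivatives only. The nesting of the classes comes from the base case, where differentiability
  gives continuity.\<close>

lemma C_k_Suc_imp: "C_k (Suc k) f \<Longrightarrow> C_k k f"
proof (induction k arbitrary: f)
  case 0
  then show ?case
    by (auto simp: continuous_on_eq_continuous_at differentiable_imp_continuous_within)
next
  case (Suc k)
  then have "C_k k (partial_deriv i f)" for i by (metis C_k.simps(2))
  with Suc.prems show ?case by simp
qed

lemma C_k_continuous: "C_k k f \<Longrightarrow> continuous_on UNIV f"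
proof (induction k)
  case (Suc k)
  from Suc.IH[OF C_k_Suc_imp[OF Suc.prems]] show ?case .
qed simp

lemma C_k_const [simp]: "C_k k (\<lambda>x. c)"
proof (induction k arbitrary: c)
  case (Suc k)
  have "partial_deriv i (\<lambda>x. c) = (\<lambda>x. 0)" for i :: 'a
    by (rule ext, rule partial_deriv_eqI[OF has_derivative_const])
  with Suc show ?case by simp
qed auto

lemma partial_deriv_add:
  assumes "f differentiable (at x)" "g differentiable (at x)"
  shows "partial_deriv i (\<lambda>x. f x + g x) x = partial_deriv i f x + partial_deriv i g x"
proof -
  obtain f' g' where *: "(f has_derivative f') (at x)" "(g has_derivative g') (at x)"
    using assms unfolding differentiable_def by auto
  then show ?thesis
    using partial_deriv_eqI[OF has_derivative_add[OF *]] by (simp add: partial_deriv_eqI)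
qed

lemma partial_deriv_mult:
  assumes "f differentiable (at x)" "g differentiable (at x)"
  shows "partial_deriv i (\<lambda>x. f x * g x) x = f x * partial_deriv i g x + partial_deriv i f x * g x"
proof -
  obtain f' g' where *: "(f has_derivative f') (at x)" "(g has_derivative g') (at x)"
    using assms unfolding differentiable_def by auto
  then show ?thesis
    using partial_deriv_eqI[OF has_derivative_mult[OF *]] by (simp add: partial_deriv_eqI)
qed

lemma partial_deriv_compose_real:
  assumes "(h has_real_derivative h') (at (q x))" "q differentiable (at x)"
  shows "partial_deriv i (\<lambda>x. h (q x)) x = h' * partial_deriv i q x"
proof -
  obtain q' where *: "(q has_derivative q') (at x)"
    using assms unfolding differentiable_def by auto
  have "((\<lambda>x. h (q x)) has_derivative (\<lambda>v. h' * q' v)) (at x)"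
    using diff_chain_at[OF * assms(1)[unfolded has_field_derivative_def]] by (simp add: o_def)
  with * show ?thesis by (simp add: partial_deriv_eqI)
qed

lemma differentiable_compose_real:
  fixes q :: "real^'n::finite \<Rightarrow> real"
  assumes "(h has_real_derivative h') (at (q x))" "q differentiable (at x)"
  shows "(\<lambda>x. h (q x)) differentiable (at x)"
proof -
  have "h differentiable (at (q x))"
    using assms(1) by (auto simp: real_differentiable_def)
  then show ?thesis using differentiable_chain_at[OF assms(2), of h] by (simp add: o_def)
qed

lemma C_k_add: "C_k k f \<Longrightarrow> C_k k g \<Longrightarrow> C_k k (\<lambda>x. f x + g x)"
proof (induction k arbitrary: f g)
  case (Suc k)
  then have "partial_deriv i (\<lambda>x. f x + g x) = (\<lambda>x. partial_deriv i f x + partial_deriv i g x)" for i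
    by (intro ext partial_deriv_add) auto
  with Suc show ?case by (auto intro!: derivative_intros)
qed (auto intro: continuous_intros)

lemma C_k_mult: "C_k k f \<Longrightarrow> C_k k g \<Longrightarrow> C_k k (\<lambda>x. f x * g x)"
proof (induction k arbitrary: f g)
  case (Suc k)
  have "partial_deriv i (\<lambda>x. f x * g x) = (\<lambda>x. f x * partial_deriv i g x + partial_deriv i f x * g x)" for i
    using Suc.prems by (intro ext partial_deriv_mult) auto
  moreover have "C_k k (\<lambda>x. f x * partial_deriv i g x + partial_deriv i f x * g x)" for i
    using Suc.prems by (intro C_k_add Suc.IH C_k_Suc_imp[OF Suc.prems(1)] C_k_Suc_imp[OF Suc.prems(2)]) auto
  ultimately show ?case using Suc.prems by (auto intro!: derivative_intros)
qed (auto intro: continuous_intros)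

lemma C_k_cmult: "C_k k f \<Longrightarrow> C_k k (\<lambda>x. c * f x)"
  by (intro C_k_mult) auto

lemma C_k_uminus: "C_k k f \<Longrightarrow> C_k k (\<lambda>x. - f x)"
  using C_k_cmult[of k f "-1"] by simp

lemma C_k_bounded_linear: "bounded_linear f \<Longrightarrow> C_k k f"
proof (cases k)
  case 0
  assume "bounded_linear f" then show ?thesis
    using 0 by (simp add: linear_continuous_on)
next
  case (Suc j)
  assume f: "bounded_linear f"
  then have d: "(f has_derivative f) (at x)" for x
    by (simp add: bounded_linear_imp_has_derivative)
  then have "partial_deriv i f = (\<lambda>x. f (axis i 1))" for i
    by (intro ext partial_deriv_eqI)
  with Suc d show ?thesis by (auto simp: differentiable_def)
qed

lemma C_k_polynomial: "real_polynomial_function p \<Longrightarrow> C_k k p"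
  by (induction rule: real_polynomial_function.induct)
     (auto intro: C_k_add C_k_mult C_k_bounded_linear)

text \<open>The norm is not differentiable at 0, but its square is a polynomial; the smooth plateau
  functions are therefore built from |x|^2.\<close>

lemma C_k_norm_square: "C_k k (\<lambda>x::real^'n::finite. (norm x)\<^sup>2)"
proof -
  have "(norm x)\<^sup>2 = (\<Sum>i\<in>UNIV. x $ i * x $ i)" for x :: "real^'n"
    unfolding power2_norm_eq_inner by (simp add: inner_vec_def)
  moreover have "real_polynomial_function (\<lambda>x::real^'n. \<Sum>i\<in>UNIV. x $ i * x $ i)"
    by (intro real_polynomial_function_sum) (auto intro!: bounded_linear_vec_nth)
  ultimately show ?thesis using C_k_polynomial by simp
qed

text \<open>The derivative of 1/f is -(1/f)^2 f', again a product of 1/f and partial derivatives of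
  f, so the induction closes with the product rule.\<close>

lemma C_k_inverse:
  assumes "\<And>x. f x \<noteq> 0" shows "C_k k f \<Longrightarrow> C_k k (\<lambda>x. inverse (f x))"
proof (induction k)
  case (Suc k)
  have "((inverse::real\<Rightarrow>real) has_real_derivative - (inverse (f x) * inverse (f x))) (at (f x))" for x
    using DERIV_inverse[of "f x"] assms[of x] by (simp add: power2_eq_square)
  note d = partial_deriv_compose_real[OF this] differentiable_compose_real[OF this]
  have "partial_deriv i (\<lambda>x. inverse (f x)) =
      (\<lambda>x. - (inverse (f x) * inverse (f x)) * partial_deriv i f x)" for i
    using Suc.prems by (intro ext d(1)) auto
  moreover have "C_k k (\<lambda>x. - (inverse (f x) * inverse (f x)) * partial_deriv i f x)" for i
    using Suc.prems by (intro C_k_mult C_k_uminus Suc.IH C_k_Suc_imp[OF Suc.prems]) auto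
  moreover have "(\<lambda>x. inverse (f x)) differentiable (at x)" for x
    using Suc.prems by (intro d(2)) auto
  ultimately show ?case by simp
qed (auto intro!: continuous_intros simp: assms)

text \<open>The outer function comes with the whole tower \<open>D\<close> of its derivatives: the
  chain rule sends \<open>D j\<close> to \<open>D (Suc j)\<close>, and the induction on k is general
  in j. This replaces a separate notion of smoothness for functions of one variable.\<close>

lemma C_k_compose_real:
  assumes D: "\<And>k t. (D k has_real_derivative D (Suc k) t) (at t)" and q: "\<And>k. C_k k q"
  shows "C_k k (\<lambda>x. D j (q x))"
proof (induction k arbitrary: j)
  case 0
  have "continuous_on UNIV (D j)"
    using D by (auto simp: continuous_on_eq_continuous_at intro: DERIV_isCont)
  then show ?case using C_k_continuous[OF q] by (auto intro: continuous_on_compose2)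
next
  case (Suc k)
  have q': "q differentiable (at x)" "C_k k (partial_deriv i q)" for x i
    using q[of "Suc k"] by auto
  have "partial_deriv i (\<lambda>x. D j (q x)) = (\<lambda>x. D (Suc j) (q x) * partial_deriv i q x)" for i
    by (intro ext partial_deriv_compose_real D q')
  moreover have "C_k k (\<lambda>x. D (Suc j) (q x) * partial_deriv i q x)" for i
    by (intro C_k_mult Suc q')
  ultimately show ?case using differentiable_compose_real[OF D q'(1)] by auto
qed

lemma has_derivative_translate:
  fixes f :: "'a::real_normed_vector \<Rightarrow> 'b::real_normed_vector"
  assumes "(f has_derivative f') (at (x + c))"
  shows "((\<lambda>x. f (x + c)) has_derivative f') (at x)"
proof -
  have "((\<lambda>x. x + c) has_derivative (\<lambda>x. x)) (at x)"
    by (auto intro!: derivative_eq_intros)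
  from diff_chain_at[OF this assms] show ?thesis by (simp add: o_def)
qed

lemma partial_deriv_translate:
  assumes "f differentiable (at (x + c))"
  shows "partial_deriv i (\<lambda>x. f (x + c)) x = partial_deriv i f (x + c)"
proof -
  obtain f' where f': "(f has_derivative f') (at (x + c))"
    using assms unfolding differentiable_def by auto
  then show ?thesis using has_derivative_translate[OF f'] by (simp add: partial_deriv_eqI)
qed

lemma C_k_translate: "C_k k f \<Longrightarrow> C_k k (\<lambda>x. f (x + c))"
proof (induction k arbitrary: f)
  case 0
  then show ?case by (auto intro!: continuous_on_compose2[of UNIV f] continuous_intros)
next
  case (Suc k)
  have "partial_deriv i (\<lambda>x. f (x + c)) = (\<lambda>x. partial_deriv i f (x + c))" for i
    using Suc.prems by (intro ext partial_deriv_translate) auto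
  moreover have "(\<lambda>x. f (x + c)) differentiable (at x)" for x
    using Suc.prems has_derivative_translate unfolding C_k.simps differentiable_def by blast
  ultimately show ?case using Suc by auto
qed

section \<open>Smooth cut-off functions\<close>

text \<open>The \<open>k\<close>-th derivative of \<open>exp (- 1 / t)\<close> is \<open>p (1 / t) * exp (- 1 / t)\<close> for the polynomial
  \<open>p = flat_deriv k\<close>; differentiating replaces \<open>p\<close> by \<open>X^2 (p - p')\<close>.\<close>

definition flat_deriv :: "nat \<Rightarrow> real poly" where
  "flat_deriv k = ((\<lambda>p. [:0, 0, 1:] * (p - pderiv p)) ^^ k) 1"

text \<open>With s = 1/t this is the decay of p(s) exp(-s) at infinity. It makes the function
  exp(-1/t) flat at 0 to every order.\<close>

lemma tendsto_poly_inverse_exp_0: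
  fixes p :: "real poly"
  shows "((\<lambda>t. poly p (1 / t) * exp (- (1 / t))) \<longlongrightarrow> 0) (at_right 0)"
proof -
  have "((\<lambda>t. \<Sum>i\<le>degree p. coeff p i * (t ^ i / exp t)) \<longlongrightarrow> (\<Sum>i\<le>degree p. coeff p i * 0)) at_top"
    by (intro tendsto_intros tendsto_power_div_exp_0)
  then have "((\<lambda>t. poly p t * exp (- t)) \<longlongrightarrow> 0) at_top"
    by (simp add: poly_altdef sum_divide_distrib exp_minus divide_inverse[symmetric])
  from filterlim_compose[OF this filterlim_inverse_at_top_right] show ?thesis
    by (simp add: inverse_eq_divide)
qed

definition flat :: "nat \<Rightarrow> real \<Rightarrow> real" where
  "flat k t = (if t > 0 then poly (flat_deriv k) (1 / t) * exp (- (1 / t)) else 0)"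

lemma flat_0: "flat 0 t = (if t > 0 then exp (- (1 / t)) else 0)"
  by (simp add: flat_def flat_deriv_def)

lemma flat_1: "flat (Suc 0) t = (if t > 0 then (1 / t)\<^sup>2 * exp (- (1 / t)) else 0)"
  by (simp add: flat_def flat_deriv_def power2_eq_square)

lemma flat_nonneg: "flat 0 t \<ge> 0" and flat_pos_iff: "flat 0 t > 0 \<longleftrightarrow> t > 0"
  and flat_le_0: "t \<le> 0 \<Longrightarrow> flat k t = 0" and flat_1_nonneg: "flat (Suc 0) t \<ge> 0"
  by (auto simp: flat_0 flat_1) (auto simp: flat_def)

lemma flat_has_derivative: "(flat k has_real_derivative flat (Suc k) t) (at t)"
proof -
  let ?p = "flat_deriv k"
  have S: "flat_deriv (Suc k) = [:0, 0, 1:] * (?p - pderiv ?p)"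
    by (simp add: flat_deriv_def)
  consider "t > 0" | "t < 0" | "t = 0" by linarith
  then show ?thesis
  proof cases
    case 1
    have "((\<lambda>t. poly ?p (1 / t) * exp (- (1 / t))) has_real_derivative flat (Suc k) t) (at t)"
      using 1 by (auto intro!: derivative_eq_intros simp: flat_def S)
                 (simp add: field_simps power2_eq_square)
    then show ?thesis
      by (rule has_field_derivative_transform_within_open[where S="{0<..}"])
         (use 1 in \<open>auto simp: flat_def\<close>)
  next
    case 2
    have "((\<lambda>t. 0) has_real_derivative flat (Suc k) t) (at t)"
      using 2 by (auto simp: flat_def)
    then show ?thesis
      by (rule has_field_derivative_transform_within_open[where S="{..<0}"])
         (use 2 in \<open>auto simp: flat_def\<close>)
  next
    case 3
    \<comment> \<open>Dividing by h multiplies the polynomial in 1/h by X, so the difference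
      quotient at 0 is again a polynomial in 1/h times exp(-1/h).\<close>
    have "((\<lambda>h. poly ([:0,1:] * ?p) (1 / h) * exp (- (1 / h))) \<longlongrightarrow> 0) (at_right 0)"
      by (rule tendsto_poly_inverse_exp_0)
    then have r: "((\<lambda>h. flat k h / h) \<longlongrightarrow> 0) (at_right 0)"
      by (rule Lim_transform_eventually)
         (auto simp: flat_def eventually_at_filter)
    have l: "((\<lambda>h. flat k h / h) \<longlongrightarrow> 0) (at_left 0)"
      by (rule Lim_transform_eventually[OF tendsto_const])
         (auto simp: flat_def eventually_at_filter)
    from l r have "((\<lambda>h. flat k h / h) \<longlongrightarrow> 0) (at 0)"
      by (simp add: filterlim_at_split)
    then show ?thesis using 3 by (simp add: DERIV_def flat_def)
  qed
qed

text \<open>The standard smooth transition from 0 on t \<le> 0 to 1 on t \<ge> 1. The denominator is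
  positive because t and 1 - t are never both nonpositive.\<close>

definition step :: "real \<Rightarrow> real" where
  "step t = flat 0 t / (flat 0 t + flat 0 (1 - t))"

text \<open>The derivative of \<open>step\<close> after cancellation in the quotient rule. In this
  form every factor is nonnegative, so monotonicity of the transition can be read off; the Hardy
  inequality depends on that sign.\<close>

definition step' :: "real \<Rightarrow> real" where
  "step' t = (flat 1 t * flat 0 (1 - t) + flat 0 t * flat 1 (1 - t)) / (flat 0 t + flat 0 (1 - t))\<^sup>2"

lemma step_denominator: "flat 0 t + flat 0 (1 - t) > 0"
  using flat_pos_iff[of t] flat_pos_iff[of "1 - t"] flat_nonneg[of t] flat_nonneg[of "1 - t"]
  by (cases "t > 0") (auto intro: add_pos_nonneg add_nonneg_pos)

lemma step_eq_0: "t \<le> 0 \<Longrightarrow> step t = 0" and step_eq_1: "t \<ge> 1 \<Longrightarrow> step t = 1"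
  and step_nonneg: "step t \<ge> 0" and step_le_1: "step t \<le> 1"
  and step'_nonneg: "step' t \<ge> 0"
  and step'_eq_0: "t \<le> 0 \<or> t \<ge> 1 \<Longrightarrow> step' t = 0"
  using step_denominator[of t] flat_nonneg[of t] flat_nonneg[of "1 - t"]
        flat_1_nonneg[of t] flat_1_nonneg[of "1 - t"]
  by (auto simp: step_def step'_def flat_le_0 divide_le_eq_1)

lemma step_has_derivative: "(step has_real_derivative step' t) (at t)"
proof -
  have 1: "((\<lambda>t. flat 0 (1 - t)) has_real_derivative - flat 1 (1 - t)) (at t)"
  proof -
    have "((\<lambda>t. 1 - t) has_real_derivative - 1) (at t)"
      by (auto intro!: derivative_eq_intros)
    from DERIV_chain2[of "flat 0" _ "\<lambda>t. 1 - t", OF flat_has_derivative this]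
    show ?thesis by simp
  qed
  show ?thesis unfolding step_def[abs_def] step'_def
    using step_denominator[of t]
    by (auto intro!: derivative_eq_intros flat_has_derivative 1)
       (simp add: field_simps power2_eq_square)
qed

lemma continuous_flat: "continuous_on S (flat k)"
  by (rule continuous_at_imp_continuous_on) (auto intro: DERIV_isCont flat_has_derivative)

lemma continuous_step': "continuous_on S step'"
proof -
  have f: "continuous_on S (\<lambda>t. flat k (1 - t))" for k
    by (rule continuous_on_compose2[OF continuous_flat[of UNIV k]]) (auto intro!: continuous_intros)
  show ?thesis
    unfolding step'_def[abs_def]
    by (intro continuous_on_divide continuous_on_add continuous_on_mult continuous_on_power
              continuous_flat f ballI)
       (simp add: less_imp_neq[OF step_denominator, THEN not_sym])
qed

lemma continuous_step: "continuous_on S step"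
  by (rule continuous_at_imp_continuous_on) (auto intro: DERIV_isCont step_has_derivative)

lemma step'_bounded: obtains H where "H > 0" "\<And>t. step' t \<le> H"
proof -
  have "compact (step' ` {0..1})"
    by (rule compact_continuous_image[OF continuous_step' compact_Icc])
  then have "bounded (step' ` {0..1})" by (rule compact_imp_bounded)
  then obtain H where H: "\<forall>y\<in>step' ` {0..1}. \<bar>y\<bar> \<le> H" unfolding bounded_real by blast
  have "step' t \<le> max H 1" for t
  proof (cases "t \<in> {0..1}")
    case True
    then have "\<bar>step' t\<bar> \<le> H" using H by blast
    then show ?thesis by linarith
  next
    case False
    then show ?thesis using step'_eq_0[of t] by auto
  qed
  then show ?thesis by (rule that[rotated]) simp
qed

lemma C_k_step:
  assumes q: "\<And>k. C_k k q" shows "C_k k (\<lambda>x. step (q x))"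
proof -
  have "C_k k (\<lambda>x. 1 + - q x)" for k by (intro C_k_add C_k_uminus q) auto
  then have q': "C_k k (\<lambda>x. 1 - q x)" for k by simp
  have f: "C_k k (\<lambda>x. flat 0 (q x))" "C_k k (\<lambda>x. flat 0 (1 - q x))"
    by (rule C_k_compose_real[of flat, OF flat_has_derivative], rule q q')+
  show ?thesis unfolding step_def divide_inverse
    by (intro C_k_mult C_k_inverse C_k_add f) (simp add: less_imp_neq[OF step_denominator, THEN not_sym])
qed

lemma test_functionI:
  assumes "\<And>k. C_k k f" "\<And>x. norm x > R \<Longrightarrow> f x = 0"
  shows "test_function f"
proof -
  have "{x. f x \<noteq> 0} \<subseteq> cball 0 R" using assms(2) by (auto simp flip: not_less)
  then have "bounded {x. f x \<noteq> 0}" by (rule bounded_subset[OF bounded_cball])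
  with assms(1) show ?thesis by (simp add: test_function_def compact_closure)
qed

lemma test_function_bound:
  assumes "test_function f" obtains R where "R > 0" "\<And>x. norm x > R \<Longrightarrow> f x = 0"
proof -
  have "bounded {x. f x \<noteq> 0}" using assms by (simp add: test_function_def compact_closure)
  then obtain R where "R > 0" "\<forall>x\<in>{x. f x \<noteq> 0}. norm x \<le> R" by (auto simp: bounded_pos)
  then have "f x = 0" if "norm x > R" for x using that by fastforce
  with \<open>R > 0\<close> show ?thesis by (rule that)
qed

lemma C_k_test: "test_function f \<Longrightarrow> C_k k f"
  by (simp add: test_function_def)

lemma test_function_mult:
  assumes "test_function f" "\<And>k. C_k k g" shows "test_function (\<lambda>x. f x * g x)"
proof -
  obtain R where "\<And>x. norm x > R \<Longrightarrow> f x = 0" using test_function_bound[OF assms(1)] by blast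
  then show ?thesis
    by (intro test_functionI[where R=R] C_k_mult[OF C_k_test[OF assms(1)] assms(2)]) simp
qed

lemma test_function_translate:
  assumes "test_function f" shows "test_function (\<lambda>x. f (x + c))"
proof -
  obtain R where R: "\<And>x. norm x > R \<Longrightarrow> f x = 0" using test_function_bound[OF assms(1)] by blast
  have "f (x + c) = 0" if "norm x > R + norm c" for x
    using R[of "x + c"] norm_triangle_ineq2[of x "-c"] that by simp
  then show ?thesis
    by (rule test_functionI[OF C_k_translate[OF C_k_test[OF assms]]])
qed

lemma ball_plateau:
  assumes "R > 0"
  obtains \<zeta> :: "real^'n::finite \<Rightarrow> real" where "\<And>k. C_k k \<zeta>" "\<And>x. 0 \<le> \<zeta> x" "\<And>x. \<zeta> x \<le> 1"
    "\<And>x. norm x \<le> R \<Longrightarrow> \<zeta> x = 1" "\<And>x. norm x \<ge> R + 1 \<Longrightarrow> \<zeta> x = 0"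
proof -
  \<comment> \<open>The argument of \<open>step\<close> is at least (R + 1)^2 - R^2 = 2 R + 1 on the
    ball of radius R, and nonpositive from radius R + 1 on.\<close>
  define \<zeta> :: "real^'n \<Rightarrow> real" where "\<zeta> = (\<lambda>x. step ((R + 1)\<^sup>2 + - (norm x)\<^sup>2))"
  have q: "C_k k (\<lambda>x::real^'n. (R + 1)\<^sup>2 + - (norm x)\<^sup>2)" for k
    by (rule C_k_add[OF C_k_const C_k_uminus[OF C_k_norm_square]])
  have 1: "C_k k \<zeta>" for k
    unfolding \<zeta>_def by (rule C_k_step[OF q])
  have e: "(R + 1)\<^sup>2 = R\<^sup>2 + 2 * R + 1" by (simp add: power2_eq_square algebra_simps)
  have 2: "\<zeta> x = 1" if "norm x \<le> R" for x
  proof -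
    have "(norm x)\<^sup>2 \<le> R\<^sup>2" using that by (simp add: power_mono)
    then have "1 \<le> (R + 1)\<^sup>2 + - (norm x)\<^sup>2" using e assms by linarith
    then show ?thesis unfolding \<zeta>_def by (rule step_eq_1)
  qed
  have 3: "\<zeta> x = 0" if "norm x \<ge> R + 1" for x
  proof -
    have "(R + 1)\<^sup>2 \<le> (norm x)\<^sup>2" by (rule power_mono[OF that]) (use assms in simp)
    then have "(R + 1)\<^sup>2 + - (norm x)\<^sup>2 \<le> 0" by simp
    then show ?thesis unfolding \<zeta>_def by (rule step_eq_0)
  qed
  have 4: "0 \<le> \<zeta> x" "\<zeta> x \<le> 1" for x
    by (simp_all add: \<zeta>_def step_nonneg step_le_1)
  show thesis by (rule that[OF 1 4 2 3])
qed

lemma annulus_plateau: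
  assumes "0 < a" "a < R"
  obtains \<zeta> :: "real^'n::finite \<Rightarrow> real" where "test_function \<zeta>" "\<And>x. 0 \<le> \<zeta> x" "\<And>x. \<zeta> x \<le> 1"
    "\<And>x. a \<le> norm x \<Longrightarrow> norm x \<le> R \<Longrightarrow> \<zeta> x = 1"
    "\<And>x. norm x \<le> a / 2 \<or> norm x \<ge> R + 1 \<Longrightarrow> \<zeta> x = 0"
proof -
  have "R > 0" using assms by simp
  obtain \<zeta> :: "real^'n \<Rightarrow> real" where \<zeta>: "\<And>k. C_k k \<zeta>" "\<And>x. 0 \<le> \<zeta> x" "\<And>x. \<zeta> x \<le> 1"
    "\<And>x. norm x \<le> R \<Longrightarrow> \<zeta> x = 1" "\<And>x. norm x \<ge> R + 1 \<Longrightarrow> \<zeta> x = 0"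
    using ball_plateau[OF \<open>R > 0\<close>, where ?'n='n] by metis
  \<comment> \<open>The affine function of |x|^2 that equals 0 at radius a / 2 and 1 at radius
    a.\<close>
  define s where "s = (\<lambda>x::real^'n. step (4 / (3 * a\<^sup>2) * (norm x)\<^sup>2 + - (1 / 3)))"
  have q: "C_k k (\<lambda>x::real^'n. 4 / (3 * a\<^sup>2) * (norm x)\<^sup>2 + - (1 / 3))" for k
    by (rule C_k_add[OF C_k_cmult[OF C_k_norm_square] C_k_const])
  have s: "C_k k s" for k
    unfolding s_def by (rule C_k_step[OF q])
  have s01: "0 \<le> s x" "s x \<le> 1" for x
    by (simp_all add: s_def step_nonneg step_le_1)
  have 1: "test_function (\<lambda>x. \<zeta> x * s x)"
  proof (rule test_functionI[of _ "R + 1"])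
    show "C_k k (\<lambda>x. \<zeta> x * s x)" for k by (rule C_k_mult[OF \<zeta>(1) s])
  qed (simp add: \<zeta>(5))
  have 2: "\<zeta> x * s x = 1" if "a \<le> norm x" "norm x \<le> R" for x
  proof -
    have "a\<^sup>2 \<le> (norm x)\<^sup>2" by (rule power_mono) (use that assms in auto)
    then have "1 \<le> 4 / (3 * a\<^sup>2) * (norm x)\<^sup>2 + - (1 / 3)"
      using assms by (simp add: field_simps)
    then have "s x = 1" unfolding s_def by (rule step_eq_1)
    then show ?thesis using \<zeta>(4) that by simp
  qed
  have 3: "\<zeta> x * s x = 0" if *: "norm x \<le> a / 2 \<or> norm x \<ge> R + 1" for x
  proof (cases "norm x \<le> a / 2")
    case True
    then have "(norm x)\<^sup>2 \<le> (a / 2)\<^sup>2" by (rule power_mono) simp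
    then have "4 / (3 * a\<^sup>2) * (norm x)\<^sup>2 + - (1 / 3) \<le> 0"
      using assms by (simp add: field_simps)
    then have "s x = 0" unfolding s_def by (rule step_eq_0)
    then show ?thesis by simp
  next
    case False
    then show ?thesis using that \<zeta>(5) by simp
  qed
  have 4: "0 \<le> \<zeta> x * s x" "\<zeta> x * s x \<le> 1" for x
    by (simp_all add: \<zeta> s01 mult_le_one)
  show thesis by (rule that[OF 1 4 2 3])
qed

section \<open>Square-integrable functions and density of test functions\<close>

lemma measurable_C_k: "C_k k f \<Longrightarrow> f \<in> borel_measurable lebesgue"
  by (intro measurable_completion) (simp add: C_k_continuous borel_measurable_continuous_onI)

lemma L2_iff: "f \<in> L2 M \<longleftrightarrow> f \<in> borel_measurable M \<and> integrable M (\<lambda>x. (f x)\<^sup>2)"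
  by (simp add: L2_def)

lemma L2_measurable: "f \<in> L2 M \<Longrightarrow> f \<in> borel_measurable M"
  and L2_integrable_square: "f \<in> L2 M \<Longrightarrow> integrable M (\<lambda>x. (f x)\<^sup>2)"
  by (simp_all add: L2_iff)

lemma abs_mult_le_squares: "\<bar>a * b\<bar> \<le> a\<^sup>2 + (b::real)\<^sup>2"
proof -
  have "2 * \<bar>a\<bar> * \<bar>b\<bar> \<le> \<bar>a\<bar>\<^sup>2 + \<bar>b\<bar>\<^sup>2" by (rule sum_squares_bound)
  moreover have "0 \<le> \<bar>a\<bar> * \<bar>b\<bar>" by simp
  ultimately show ?thesis unfolding abs_mult power2_abs by linarith
qed

lemma L2_integrable_mult:
  assumes f: "f \<in> L2 M" and g: "g \<in> L2 M" shows "integrable M (\<lambda>x. f x * g x)"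
proof (rule Bochner_Integration.integrable_bound)
  show "integrable M (\<lambda>x. (f x)\<^sup>2 + (g x)\<^sup>2)"
    using f g by (intro Bochner_Integration.integrable_add L2_integrable_square)
  show "(\<lambda>x. f x * g x) \<in> borel_measurable M"
    by (intro borel_measurable_times L2_measurable f g)
qed (use abs_mult_le_squares in auto)

lemma L2_add:
  assumes f: "f \<in> L2 M" and g: "g \<in> L2 M" shows "(\<lambda>x. f x + g x) \<in> L2 M"
proof -
  have "integrable M (\<lambda>x. (f x)\<^sup>2 + (g x)\<^sup>2 + 2 * (f x * g x))"
    by (intro Bochner_Integration.integrable_add integrable_mult_right L2_integrable_mult L2_integrable_square f g)
  then show ?thesis
    using L2_measurable[OF f] L2_measurable[OF g] by (simp add: L2_iff power2_sum mult.assoc)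
qed

lemma L2_cmult: "f \<in> L2 M \<Longrightarrow> (\<lambda>x. c * f x) \<in> L2 M"
  unfolding L2_iff power_mult_distrib by (intro conjI borel_measurable_times integrable_mult_right) auto

lemma L2_diff: "f \<in> L2 M \<Longrightarrow> g \<in> L2 M \<Longrightarrow> (\<lambda>x. f x - g x) \<in> L2 M"
  using L2_add[of f M "\<lambda>x. (-1) * g x"] L2_cmult[of g M "-1"] by simp

lemma L2_bounded_mult:
  assumes f: "f \<in> L2 M" and g: "g \<in> borel_measurable M" and b: "\<And>x. \<bar>g x\<bar> \<le> K"
  shows "(\<lambda>x. f x * g x) \<in> L2 M"
proof -
  have "integrable M (\<lambda>x. (f x * g x)\<^sup>2)"
  proof (rule Bochner_Integration.integrable_bound)
    show "integrable M (\<lambda>x. K\<^sup>2 * (f x)\<^sup>2)"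
      by (intro integrable_mult_right L2_integrable_square f)
    show "(\<lambda>x. (f x * g x)\<^sup>2) \<in> borel_measurable M"
      using L2_measurable[OF f] g by measurable
    have "(g x)\<^sup>2 \<le> K\<^sup>2" for x using b[of x] by (metis abs_ge_zero power2_abs power_mono)
    then show "AE x in M. norm ((f x * g x)\<^sup>2) \<le> norm (K\<^sup>2 * (f x)\<^sup>2)"
      by (auto simp: power_mult_distrib mult.commute[of "K\<^sup>2"] intro!: mult_left_mono AE_I2)
  qed
  then show ?thesis using L2_measurable[OF f] g by (simp add: L2_iff)
qed

section \<open>Translations and square integrability\<close>

lemma lebesgue_distr_translate:
  "distr lebesgue lebesgue (\<lambda>x. x + c) = (lebesgue :: 'a::euclidean_space measure)"
  and measurable_translate: "(\<lambda>x::'a. x + c) \<in> lebesgue \<rightarrow>\<^sub>M lebesgue"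
proof -
  have T: "(\<lambda>x::'a. c + (\<Sum>j\<in>Basis. (1 * (x \<bullet> j)) *\<^sub>R j)) = (\<lambda>x. x + c)"
    by (simp add: euclidean_representation add.commute)
  show "distr lebesgue lebesgue (\<lambda>x. x + c) = (lebesgue :: 'a measure)"
    using lebesgue_affine_euclidean[of "\<lambda>_. 1" c] unfolding T by (simp add: density_1)
  show "(\<lambda>x::'a. x + c) \<in> lebesgue \<rightarrow>\<^sub>M lebesgue"
    using lebesgue_affine_measurable[of "\<lambda>_. 1" c] unfolding T by simp
qed

lemma
  fixes f :: "'a::euclidean_space \<Rightarrow> real"
  assumes f: "f \<in> borel_measurable lebesgue"
  shows measurable_comp_translate: "(\<lambda>x. f (x + c)) \<in> borel_measurable lebesgue"
    and integrable_translate_iff: "integrable lebesgue (\<lambda>x. f (x + c)) \<longleftrightarrow> integrable lebesgue f"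
    and integral_translate: "(\<integral>x. f (x + c) \<partial>lebesgue) = (\<integral>x. f x \<partial>lebesgue)"
proof -
  show "(\<lambda>x. f (x + c)) \<in> borel_measurable lebesgue"
    by (rule measurable_compose[OF measurable_translate f])
  show "integrable lebesgue (\<lambda>x. f (x + c)) \<longleftrightarrow> integrable lebesgue f"
    using integrable_distr_eq[OF measurable_translate f, of c] by (simp add: lebesgue_distr_translate)
  show "(\<integral>x. f (x + c) \<partial>lebesgue) = (\<integral>x. f x \<partial>lebesgue)"
    using integral_distr[OF measurable_translate f, of c] by (simp add: lebesgue_distr_translate)
qed

lemma L2_translate:
  fixes f :: "'a::euclidean_space \<Rightarrow> real"
  assumes "f \<in> L2 lebesgue"
  shows "(\<lambda>x. f (x + c)) \<in> L2 lebesgue"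
    and "(\<integral>x. (f (x + c))\<^sup>2 \<partial>lebesgue) = (\<integral>x. (f x)\<^sup>2 \<partial>lebesgue)"
  using assms measurable_comp_translate[of f c]
    integrable_translate_iff[of "\<lambda>x. (f x)\<^sup>2" c] integral_translate[of "\<lambda>x. (f x)\<^sup>2" c]
  by (auto simp: L2_iff)

lemma integrable_bounded_support:
  fixes f :: "'a::euclidean_space \<Rightarrow> real"
  assumes "f \<in> borel_measurable lebesgue" "\<And>x. norm x \<le> R \<Longrightarrow> \<bar>f x\<bar> \<le> K" "\<And>x. norm x > R \<Longrightarrow> f x = 0"
  shows "integrable lebesgue f"
proof (rule Bochner_Integration.integrable_bound)
  show "integrable lebesgue (\<lambda>x::'a. K * indicator (cball 0 R) x :: real)"
    by (intro integrable_mult_right integrable_real_indicator)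
       (use emeasure_bounded_finite[OF bounded_cball[of "0::'a" R]] in auto)
  show "AE x in lebesgue. norm (f x) \<le> norm (K * indicator (cball 0 R) x :: real)"
  proof (rule AE_I2)
    fix x :: 'a
    show "norm (f x) \<le> norm (K * indicator (cball 0 R) x :: real)"
      using assms(2)[of x] assms(3)[of x] by (cases "norm x \<le> R") (auto simp: indicator_def)
  qed
qed fact

lemma C_k_bounded:
  assumes "C_k k f" "\<And>x. norm x > R \<Longrightarrow> f x = 0"
  obtains K where "K > 0" "\<And>x. \<bar>f x\<bar> \<le> K"
proof -
  have "compact (f ` cball 0 R)"
    by (rule compact_continuous_image)
       (auto intro: continuous_on_subset[OF C_k_continuous[OF assms(1)]])
  then have "bounded (f ` cball 0 R)" by (rule compact_imp_bounded)
  then obtain K where K: "K > 0" "\<And>y. y \<in> f ` cball 0 R \<Longrightarrow> \<bar>y\<bar> \<le> K"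
    unfolding bounded_pos by auto
  have "\<bar>f x\<bar> \<le> K" for x
    using K(2)[of "f x"] assms(2)[of x] K(1) by (cases "norm x \<le> R") auto
  with K(1) show ?thesis by (rule that)
qed

lemma C_k_integrable_L2:
  assumes "C_k k f" "\<And>x. norm x > R \<Longrightarrow> f x = 0"
  shows "integrable lebesgue f" "f \<in> L2 lebesgue"
proof -
  obtain K where K: "K > 0" "\<And>x. \<bar>f x\<bar> \<le> K" using C_k_bounded[OF assms] by blast
  note m = measurable_C_k[OF assms(1)]
  show "integrable lebesgue f"
    using m K(2) assms(2) by (rule integrable_bounded_support)
  have "integrable lebesgue (\<lambda>x. (f x)\<^sup>2)"
  proof (rule integrable_bounded_support[where R=R and K="K\<^sup>2"])
    show "\<bar>(f x)\<^sup>2\<bar> \<le> K\<^sup>2" for x using K(2)[of x] by (metis abs_ge_zero abs_power2 power2_abs power_mono)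
  qed (use m assms(2) in auto)
  then show "f \<in> L2 lebesgue" using m by (simp add: L2_iff)
qed

lemma tendsto_clip:
  assumes "X \<longlonglongrightarrow> (l::real)" shows "(\<lambda>k. max (- M) (min M (X k))) \<longlonglongrightarrow> max (- M) (min M l)"
  by (intro tendsto_intros assms)

text \<open>Almost everywhere approximation by continuous functions is the definition of HOL Light
  measurability; Stone-Weierstrass turns continuous functions into polynomials, and a plateau
  function turns polynomials into test functions. No mollification is needed.\<close>

lemma bounded_test_function_approx:
  fixes f :: "real^'n::finite \<Rightarrow> real"
  assumes f: "f \<in> borel_measurable lebesgue" and M: "\<And>x. \<bar>f x\<bar> \<le> M"
    and R: "R > 0" "\<And>x. norm x > R \<Longrightarrow> f x = 0"
  obtains \<phi> where "\<And>k::nat. test_function (\<phi> k)"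
    "\<And>k x. \<bar>\<phi> k x\<bar> \<le> (M + 1) * indicator (cball 0 (R + 1)) x"
    "AE x in lebesgue. (\<lambda>k. \<phi> k x) \<longlonglongrightarrow> f x"
proof -
  have "M \<ge> 0" using M[of 0] by simp
  have "f measurable_on UNIV"
    by (rule lebesgue_measurable_imp_measurable_on[OF f]) simp
  then obtain N g where N: "negligible N" and g: "\<And>n::nat. continuous_on UNIV (g n)"
    and lim: "\<And>x. x \<notin> N \<Longrightarrow> (\<lambda>n. g n x) \<longlonglongrightarrow> f x"
    by (auto simp: measurable_on_def)
  \<comment> \<open>Clipping at height M leaves the limit \<open>f\<close> unchanged, because |f|
    \<le> M, and makes the approximants uniformly bounded.\<close>
  define c where "c n x = max (- M) (min M (g n x))" for n x
  have c: "continuous_on (cball 0 (R + 1)) (c n)" for n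
    unfolding c_def by (intro continuous_intros continuous_on_subset[OF g]) auto
  have "\<exists>p. real_polynomial_function p \<and> (\<forall>x\<in>cball 0 (R + 1). \<bar>c n x - p x\<bar> < inverse (real (Suc n)))" for n
    using Stone_Weierstrass_real_polynomial_function[OF compact_cball c[of n], of "inverse (real (Suc n))"]
    by (metis inverse_positive_iff_positive of_nat_0_less_iff zero_less_Suc)
  then obtain p where p: "\<And>n. real_polynomial_function (p n)"
    "\<And>n x. norm x \<le> R + 1 \<Longrightarrow> \<bar>c n x - p n x\<bar> < inverse (real (Suc n))"
    by (metis mem_cball_0)
  obtain \<zeta> :: "real^'n \<Rightarrow> real" where \<zeta>: "\<And>k. C_k k \<zeta>" "\<And>x. 0 \<le> \<zeta> x" "\<And>x. \<zeta> x \<le> 1"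
    "\<And>x. norm x \<le> R \<Longrightarrow> \<zeta> x = 1" "\<And>x. norm x \<ge> R + 1 \<Longrightarrow> \<zeta> x = 0"
    using ball_plateau[OF R(1), where ?'n='n] by metis
  define \<phi> where "\<phi> n x = \<zeta> x * p n x" for n x
  have 1: "test_function (\<phi> n)" for n
  proof (rule test_functionI[of _ "R + 1"])
    show "C_k k (\<phi> n)" for k
      unfolding \<phi>_def by (rule C_k_mult[OF \<zeta>(1) C_k_polynomial[OF p(1)]])
  qed (simp add: \<phi>_def \<zeta>(5))
  have 2: "\<bar>\<phi> n x\<bar> \<le> (M + 1) * indicator (cball 0 (R + 1)) x" for n x
  proof (cases "norm x \<le> R + 1")
    case True
    have "\<bar>c n x\<bar> \<le> M" using \<open>M \<ge> 0\<close> by (auto simp: c_def)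
    \<comment> \<open>The approximation error is at most 1; this is the extra 1 in the bound
      \<open>M + 1\<close>.\<close>
    moreover have "inverse (real (Suc n)) \<le> 1" by (simp add: inverse_le_1_iff)
    ultimately have "\<bar>p n x\<bar> \<le> M + 1" using p(2)[OF True, of n] by linarith
    then have "\<zeta> x * \<bar>p n x\<bar> \<le> 1 * (M + 1)" using \<zeta>(2,3) by (intro mult_mono) auto
    then show ?thesis using True \<zeta>(2) by (simp add: \<phi>_def abs_mult)
  qed (simp add: \<phi>_def \<zeta>(5))
  have 3: "(\<lambda>n. \<phi> n x) \<longlonglongrightarrow> f x" if "x \<notin> N" for x
  proof (cases "norm x \<le> R + 1")
    case True
    have "(\<lambda>n. c n x) \<longlonglongrightarrow> max (- M) (min M (f x))"
      unfolding c_def by (rule tendsto_clip[OF lim[OF that]])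
    moreover have "max (- M) (min M (f x)) = f x" using M[of x] by auto
    ultimately have c: "(\<lambda>n. c n x) \<longlonglongrightarrow> f x" by simp
    have "(\<lambda>n. c n x - p n x) \<longlonglongrightarrow> 0"
      by (rule Lim_null_comparison[OF _ LIMSEQ_inverse_real_of_nat])
         (use p(2)[OF True] in \<open>auto intro!: always_eventually less_imp_le\<close>)
    from tendsto_diff[OF c this] have "(\<lambda>n. p n x) \<longlonglongrightarrow> f x" by simp
    then have "(\<lambda>n. \<phi> n x) \<longlonglongrightarrow> \<zeta> x * f x" unfolding \<phi>_def by (intro tendsto_intros)
    \<comment> \<open>Between the radii R and R + 1 the plateau function may differ from 1, but
      \<open>f\<close> vanishes there.\<close>
    moreover have "\<zeta> x * f x = f x" using R(2)[of x] \<zeta>(4)[of x] by (cases "norm x \<le> R") auto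
    ultimately show ?thesis by simp
  next
    case False
    then show ?thesis using \<zeta>(5)[of x] R(2)[of x] by (simp add: \<phi>_def)
  qed
  have "AE x in lebesgue. (\<lambda>n. \<phi> n x) \<longlonglongrightarrow> f x"
    using N 3 unfolding eventually_ae_filter_negligible by blast
  with 1 2 show ?thesis by (rule that)
qed

text \<open>Truncating f at a large height and approximating the bounded truncation each cost less
  than e/4 in squared norm; (a + b)^2 \<le> 2 a^2 + 2 b^2 then gives a total below e. Both limits
  are taken by dominated convergence.\<close>

lemma L2_test_function_dense:
  fixes f :: "real^'n::finite \<Rightarrow> real"
  assumes f: "f \<in> L2 lebesgue" and R: "R > 0" "\<And>x. norm x > R \<Longrightarrow> f x = 0" and e: "e > 0"
  obtains \<psi> where "test_function \<psi>" "\<psi> \<in> L2 lebesgue" "(\<integral>x. (f x - \<psi> x)\<^sup>2 \<partial>lebesgue) < e"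
proof -
  note fm[measurable] = L2_measurable[OF f]
  define c where "c n x = max (- real n) (min (real n) (f x))" for n x
  have cm[measurable]: "c n \<in> borel_measurable lebesgue" for n unfolding c_def by measurable
  have "(\<lambda>n. \<integral>x. (f x - c n x)\<^sup>2 \<partial>lebesgue) \<longlonglongrightarrow> integral\<^sup>L (lebesgue :: (real^'n) measure) (\<lambda>x. 0)"
  proof (rule integral_dominated_convergence[OF _ _ L2_integrable_square[OF f]])
    show "AE x in lebesgue. (\<lambda>n. (f x - c n x)\<^sup>2) \<longlonglongrightarrow> 0"
    proof (rule AE_I2)
      fix x :: "real^'n"
      have "\<forall>\<^sub>F n in sequentially. (f x - c n x)\<^sup>2 = 0"
        using eventually_ge_at_top[of "nat \<lceil>\<bar>f x\<bar>\<rceil>"]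
      proof eventually_elim
        case (elim n)
        then have "\<bar>f x\<bar> \<le> real n" by linarith
        then show ?case by (auto simp: c_def)
      qed
      then show "(\<lambda>n. (f x - c n x)\<^sup>2) \<longlonglongrightarrow> 0" by (rule tendsto_eventually)
    qed
    show "AE x in lebesgue. norm ((f x - c n x)\<^sup>2) \<le> (f x)\<^sup>2" for n
    proof (rule AE_I2)
      fix x :: "real^'n"
      have "\<bar>f x - c n x\<bar> \<le> \<bar>f x\<bar>" by (auto simp: c_def)
      then show "norm ((f x - c n x)\<^sup>2) \<le> (f x)\<^sup>2" by (simp add: abs_le_square_iff)
    qed
  qed measurable
  then have "\<forall>\<^sub>F n in sequentially. (\<integral>x. (f x - c n x)\<^sup>2 \<partial>lebesgue) < e / 4"
    by (rule order_tendstoD) (use e in simp)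
  then obtain n where n: "(\<integral>x. (f x - c n x)\<^sup>2 \<partial>lebesgue) < e / 4"
    by (auto simp: eventually_sequentially)
  have cb: "\<bar>c n x\<bar> \<le> real n" for x by (auto simp: c_def)
  have cR: "c n x = 0" if "norm x > R" for x using R(2)[OF that] by (simp add: c_def)
  obtain \<phi> where \<phi>: "\<And>k::nat. test_function (\<phi> k)"
    "\<And>k x. \<bar>\<phi> k x\<bar> \<le> (real n + 1) * indicator (cball 0 (R + 1)) x"
    "AE x in lebesgue. (\<lambda>k. \<phi> k x) \<longlonglongrightarrow> c n x"
    using bounded_test_function_approx[OF cm cb R(1) cR] by blast
  have \<phi>m[measurable]: "\<phi> k \<in> borel_measurable lebesgue" for k
    using measurable_C_k[OF C_k_test[OF \<phi>(1)]] .
  have cL: "c n \<in> L2 lebesgue" unfolding L2_iff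
  proof
    show "integrable lebesgue (\<lambda>x. (c n x)\<^sup>2)"
    proof (rule Bochner_Integration.integrable_bound[OF L2_integrable_square[OF f]])
      show "AE x in lebesgue. norm ((c n x)\<^sup>2) \<le> norm ((f x)\<^sup>2)"
      proof (rule AE_I2)
        fix x :: "real^'n"
        have "\<bar>c n x\<bar> \<le> \<bar>f x\<bar>" by (auto simp: c_def)
        then show "norm ((c n x)\<^sup>2) \<le> norm ((f x)\<^sup>2)"
          by (simp only: abs_le_square_iff real_norm_def abs_power2)
      qed
    qed simp
  qed simp
  have "(\<lambda>k. \<integral>x. (c n x - \<phi> k x)\<^sup>2 \<partial>lebesgue) \<longlonglongrightarrow> integral\<^sup>L (lebesgue :: (real^'n) measure) (\<lambda>x. 0)"
  proof (rule integral_dominated_convergence)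
    \<comment> \<open>The majorant adds the bound n of the truncated function and the bound n + 1 of
      its approximants.\<close>
    show "integrable lebesgue (\<lambda>x::real^'n. ((2 * real n + 1) * indicator (cball 0 (R + 1)) x)\<^sup>2)"
    proof (rule integrable_bounded_support[where R="R + 1" and K="(2 * real n + 1)\<^sup>2"])
      show "(\<lambda>x::real^'n. ((2 * real n + 1) * indicator (cball 0 (R + 1)) x)\<^sup>2) \<in> borel_measurable lebesgue"
        by (intro borel_measurable_power borel_measurable_times borel_measurable_const
              borel_measurable_indicator) simp
    qed (auto simp: indicator_def)
    show "AE x in lebesgue. (\<lambda>k. (c n x - \<phi> k x)\<^sup>2) \<longlonglongrightarrow> 0"
      using \<phi>(3)
    proof eventually_elim
      case (elim x)
      from tendsto_power[OF tendsto_diff[OF tendsto_const elim], of "c n x" 2] show ?case by simp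
    qed
    show "AE x in lebesgue. norm ((c n x - \<phi> k x)\<^sup>2) \<le> ((2 * real n + 1) * indicator (cball 0 (R + 1)) x)\<^sup>2" for k
    proof (rule AE_I2)
      fix x :: "real^'n"
      have "\<bar>c n x - \<phi> k x\<bar> \<le> \<bar>(2 * real n + 1) * indicator (cball 0 (R + 1)) x\<bar>"
        using cb[of x] cR[of x] \<phi>(2)[of k x] R(1) by (cases "norm x \<le> R + 1") (auto simp: indicator_def)
      then show "norm ((c n x - \<phi> k x)\<^sup>2) \<le> ((2 * real n + 1) * indicator (cball 0 (R + 1)) x)\<^sup>2"
        by (simp only: abs_le_square_iff real_norm_def abs_power2)
    qed
  qed simp_all
  then have "\<forall>\<^sub>F k in sequentially. (\<integral>x. (c n x - \<phi> k x)\<^sup>2 \<partial>lebesgue) < e / 4"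
    by (rule order_tendstoD) (use e in simp)
  then obtain k where k: "(\<integral>x. (c n x - \<phi> k x)\<^sup>2 \<partial>lebesgue) < e / 4"
    by (auto simp: eventually_sequentially)
  obtain R' where "\<And>x. norm x > R' \<Longrightarrow> \<phi> k x = 0" using test_function_bound[OF \<phi>(1)] by blast
  then have \<phi>L: "\<phi> k \<in> L2 lebesgue" by (rule C_k_integrable_L2(2)[OF C_k_test[OF \<phi>(1)]])
  note i = L2_integrable_square[OF L2_diff[OF f cL]] L2_integrable_square[OF L2_diff[OF cL \<phi>L]]
     L2_integrable_square[OF L2_diff[OF f \<phi>L]]
  have "(\<integral>x. (f x - \<phi> k x)\<^sup>2 \<partial>lebesgue) \<le> (\<integral>x. 2 * (f x - c n x)\<^sup>2 + 2 * (c n x - \<phi> k x)\<^sup>2 \<partial>lebesgue)"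
  proof (rule integral_mono)
    fix x :: "real^'n"
    have "(a + b)\<^sup>2 \<le> 2 * a\<^sup>2 + 2 * b\<^sup>2" for a b :: real
      using sum_squares_bound[of a b] by (simp add: power2_sum)
    from this[of "f x - c n x" "c n x - \<phi> k x"]
    show "(f x - \<phi> k x)\<^sup>2 \<le> 2 * (f x - c n x)\<^sup>2 + 2 * (c n x - \<phi> k x)\<^sup>2" by simp
  qed (use i in auto)
  also have "\<dots> = 2 * (\<integral>x. (f x - c n x)\<^sup>2 \<partial>lebesgue) + 2 * (\<integral>x. (c n x - \<phi> k x)\<^sup>2 \<partial>lebesgue)"
    using i by simp
  also have "\<dots> < e" using n k by simp
  finally show ?thesis using that \<phi>(1) \<phi>L by blast
qed

section \<open>Local integrability and the fundamental lemma of the calculus of variations\<close>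

lemma locally_integrable_ball:
  "locally_integrable w \<Longrightarrow> integrable lebesgue (\<lambda>x. indicator (cball 0 R) x * w x)"
  by (simp add: locally_integrable_def set_integrable_def)

lemma locally_integrable_measurable:
  fixes w :: "real^'n::finite \<Rightarrow> real"
  assumes "locally_integrable w" shows "w \<in> borel_measurable lebesgue"
proof (rule borel_measurable_LIMSEQ_real)
  fix x :: "real^'n"
  have "\<forall>\<^sub>F k in sequentially. indicator (cball 0 (real k)) x * w x = w x"
    using eventually_ge_at_top[of "nat \<lceil>norm x\<rceil>"]
    by eventually_elim (auto simp: indicator_def)
  then show "(\<lambda>k. indicator (cball 0 (real k)) x * w x) \<longlonglongrightarrow> w x" by (rule tendsto_eventually)
qed (rule borel_measurable_integrable[OF locally_integrable_ball[OF assms]])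

lemma locally_integrable_diff:
  "locally_integrable f \<Longrightarrow> locally_integrable g \<Longrightarrow> locally_integrable (\<lambda>x. f x - g x)"
  by (auto simp: locally_integrable_def set_integral_diff)

lemma locally_integrable_mult_bounded:
  assumes w: "locally_integrable w" and g: "g \<in> borel_measurable lebesgue" "\<And>x. \<bar>g x\<bar> \<le> K"
    "\<And>x. norm x > R \<Longrightarrow> g x = 0"
  shows "integrable lebesgue (\<lambda>x. w x * g x)"
proof (rule Bochner_Integration.integrable_bound)
  show "integrable lebesgue (\<lambda>x. K * (indicator (cball 0 R) x * w x))"
    by (intro integrable_mult_right locally_integrable_ball w)
  show "(\<lambda>x. w x * g x) \<in> borel_measurable lebesgue"
    using locally_integrable_measurable[OF w] g(1) by measurable
  have "\<bar>w x\<bar> * \<bar>g x\<bar> \<le> \<bar>K\<bar> * \<bar>w x\<bar>" for x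
    using g(2)[of x] by (subst mult.commute, intro mult_right_mono) auto
  then show "AE x in lebesgue. norm (w x * g x) \<le> norm (K * (indicator (cball 0 R) x * w x))"
    using g(3) by (auto simp: indicator_def abs_mult intro!: AE_I2)
qed

text \<open>Testing with the sign of w on a ball would yield the integral of |w| there. This sign is
  bounded, hence an almost everywhere limit of uniformly bounded test functions, and dominated
  convergence carries the orthogonality over. The balls of radius \<open>Suc R\<close>, which is
  positive, exhaust the space.\<close>

lemma AE_eq_0_if_orthogonal:
  fixes w :: "real^'n::finite \<Rightarrow> real"
  assumes w: "locally_integrable w" and 0: "\<And>\<phi>. test_function \<phi> \<Longrightarrow> (\<integral>x. w x * \<phi> x \<partial>lebesgue) = 0"
  shows "AE x in lebesgue. w x = 0"
proof -
  note wm[measurable] = locally_integrable_measurable[OF w]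
  have "AE x in lebesgue. norm x \<le> real (Suc R) \<longrightarrow> w x = 0" for R
  proof -
    define f where "f x = sgn (w x) * indicator (cball 0 (real (Suc R))) x" for x
    have f1: "f \<in> borel_measurable lebesgue"
      unfolding f_def by (intro borel_measurable_times measurable_compose[OF wm borel_measurable_sgn]
              borel_measurable_indicator fmeasurableD[OF lmeasurable_cball])
    have f2: "\<bar>f x\<bar> \<le> 1" for x by (simp add: f_def indicator_def sgn_if)
    have f3: "f x = 0" if "norm x > real (Suc R)" for x using that by (simp add: f_def)
    have pos: "0 < real (Suc R)" by simp
    obtain \<phi> where \<phi>: "\<And>k::nat. test_function (\<phi> k)"
      "\<And>k x. \<bar>\<phi> k x\<bar> \<le> (1 + 1) * indicator (cball 0 (real (Suc R) + 1)) x"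
      "AE x in lebesgue. (\<lambda>k. \<phi> k x) \<longlonglongrightarrow> f x"
      using bounded_test_function_approx[OF f1 f2 pos f3] by blast
    have "(\<lambda>k. \<integral>x. w x * \<phi> k x \<partial>lebesgue) \<longlonglongrightarrow> (\<integral>x. w x * f x \<partial>lebesgue)"
    proof (rule integral_dominated_convergence)
      show "(\<lambda>x. w x * f x) \<in> borel_measurable lebesgue" using f1 by measurable
      show "(\<lambda>x. w x * \<phi> k x) \<in> borel_measurable lebesgue" for k
        using measurable_C_k[OF C_k_test[OF \<phi>(1)]] by measurable
      show "integrable lebesgue (\<lambda>x. 2 * \<bar>indicator (cball 0 (real (Suc R) + 1)) x * w x\<bar>)"
        by (intro integrable_mult_right integrable_abs locally_integrable_ball w)
      show "AE x in lebesgue. (\<lambda>k. w x * \<phi> k x) \<longlonglongrightarrow> w x * f x"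
        using \<phi>(3) by eventually_elim (intro tendsto_intros)
      have "\<bar>w x\<bar> * \<bar>\<phi> k x\<bar> \<le> \<bar>w x\<bar> * (2 * indicator (cball 0 (real (Suc R) + 1)) x)" for x k
        using \<phi>(2)[of k x] by (intro mult_left_mono) auto
      then show "AE x in lebesgue. norm (w x * \<phi> k x) \<le> 2 * \<bar>indicator (cball 0 (real (Suc R) + 1)) x * w x\<bar>" for k
        by (auto simp: abs_mult mult_ac intro!: AE_I2)
    qed
    then have "(\<integral>x. w x * f x \<partial>lebesgue) = 0"
      using 0[OF \<phi>(1)] by (simp add: LIMSEQ_const_iff)
    moreover have "w x * f x = \<bar>indicator (cball 0 (real (Suc R))) x * w x\<bar>" for x
      by (auto simp: f_def indicator_def abs_sgn)
    ultimately have "(\<integral>x. \<bar>indicator (cball 0 (real (Suc R))) x * w x\<bar> \<partial>lebesgue) = 0" by simp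
    then have "AE x in lebesgue. \<bar>indicator (cball 0 (real (Suc R))) x * w x\<bar> = 0"
      by (subst (asm) integral_nonneg_eq_0_iff_AE) (auto intro!: integrable_abs locally_integrable_ball w)
    then show ?thesis by eventually_elim (auto simp: indicator_def)
  qed
  then have "AE x in lebesgue. \<forall>R. norm x \<le> real (Suc R) \<longrightarrow> w x = 0"
    unfolding AE_all_countable by blast
  then show ?thesis
  proof eventually_elim
    case (elim x)
    have "norm x \<le> real (Suc (nat \<lceil>norm x\<rceil>))" by linarith
    then show ?case using elim by blast
  qed
qed

text \<open>\<open>weak_gradient\<close> picks its components by choice; uniqueness lets them be
  replaced by any weak derivatives at hand.\<close>

lemma has_weak_partial_deriv_unique:
  assumes "has_weak_partial_deriv i u v" "has_weak_partial_deriv i u v'"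
  shows "AE x in lebesgue. v x = v' x"
proof -
  have l: "locally_integrable v" "locally_integrable v'"
    using assms by (auto simp: has_weak_partial_deriv_def)
  have "AE x in lebesgue. v x - v' x = 0"
  proof (rule AE_eq_0_if_orthogonal[OF locally_integrable_diff[OF l]])
    fix \<phi> :: "real^'a \<Rightarrow> real" assume \<phi>: "test_function \<phi>"
    obtain R where R: "\<And>x. norm x > R \<Longrightarrow> \<phi> x = 0" using test_function_bound[OF \<phi>] by blast
    obtain K where K: "\<And>x. \<bar>\<phi> x\<bar> \<le> K" using C_k_bounded[OF C_k_test[OF \<phi>] R] by blast
    note i = locally_integrable_mult_bounded[OF _ measurable_C_k[OF C_k_test[OF \<phi>]] K R]
    have "(\<integral>x. (v x - v' x) * \<phi> x \<partial>lebesgue) = (\<integral>x. v x * \<phi> x \<partial>lebesgue) - (\<integral>x. v' x * \<phi> x \<partial>lebesgue)"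
      using i[OF l(1)] i[OF l(2)] by (simp add: left_diff_distrib)
    also have "\<dots> = 0"
      using assms \<phi> by (simp add: has_weak_partial_deriv_def)
    finally show "(\<integral>x. (v x - v' x) * \<phi> x \<partial>lebesgue) = 0" .
  qed
  then show ?thesis by simp
qed

section \<open>Difference quotients of weakly differentiable functions\<close>

lemma integrable_mult_bounded:
  fixes f g :: "'a \<Rightarrow> real"
  assumes f: "integrable M f" and g: "g \<in> borel_measurable M" "\<And>x. \<bar>g x\<bar> \<le> K"
  shows "integrable M (\<lambda>x. f x * g x)"
proof (rule Bochner_Integration.integrable_bound)
  show "integrable M (\<lambda>x. K * f x)" by (intro integrable_mult_right f)
  have "\<bar>f x\<bar> * \<bar>g x\<bar> \<le> \<bar>K\<bar> * \<bar>f x\<bar>" for x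
    using g(2)[of x] by (subst mult.commute, intro mult_right_mono) auto
  then show "AE x in M. norm (f x * g x) \<le> norm (K * f x)"
    by (auto simp: abs_mult intro!: AE_I2)
qed (intro borel_measurable_times borel_measurable_integrable f g)

lemma C1_differentiable: "C_k (Suc 0) \<phi> \<Longrightarrow> \<phi> differentiable (at x)"
  and C1_partial_deriv: "C_k (Suc 0) \<phi> \<Longrightarrow> C_k 0 (partial_deriv i \<phi>)"
  by auto

lemma partial_deriv_outside_support:
  assumes "\<And>x. norm x > R \<Longrightarrow> \<phi> x = 0" "norm x > R"
  shows "partial_deriv i \<phi> x = 0"
proof (rule partial_deriv_eq_0)
  show "open {x::real^'a. norm x > R}" by (intro open_Collect_less continuous_intros)
qed (use assms in auto)

lemma integrable_indicator_cball:
  "integrable lebesgue (\<lambda>x::'a::euclidean_space. indicator (cball 0 R) x :: real)"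
  by (intro integrable_real_indicator)
     (use emeasure_bounded_finite[OF bounded_cball[of "0::'a" R]] in auto)

lemma has_derivative_along_axis:
  assumes "\<And>x. \<phi> differentiable (at x)"
  shows "((\<lambda>h. \<phi> (x - h *\<^sub>R axis i 1)) has_real_derivative - partial_deriv i \<phi> (x - h *\<^sub>R axis i 1)) (at h)"
proof -
  obtain \<phi>' where \<phi>': "(\<phi> has_derivative \<phi>') (at (x - h *\<^sub>R axis i 1))"
    using assms unfolding differentiable_def by auto
  have lin: "\<phi>' (h *\<^sub>R axis i 1) = h * \<phi>' (axis i 1)" for h
    using linear_cmul[OF bounded_linear.linear[OF has_derivative_bounded_linear[OF \<phi>']]] by simp
  have "((\<lambda>h. x - h *\<^sub>R axis i 1) has_derivative (\<lambda>h. (- h) *\<^sub>R axis i 1)) (at h)"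
    by (auto intro!: derivative_eq_intros)
  from diff_chain_at[OF this \<phi>']
  have "((\<lambda>h. \<phi> (x - h *\<^sub>R axis i 1)) has_derivative (\<lambda>h. (- \<phi>' (axis i 1)) * h)) (at h)"
    by (simp only: o_def lin minus_mult_commute mult.commute)
  then show ?thesis
    unfolding has_field_derivative_def partial_deriv_eqI[OF \<phi>'] .
qed

lemma C1_Lipschitz_along_axis:
  assumes "C_k (Suc 0) \<phi>" "\<And>x. norm x > R \<Longrightarrow> \<phi> x = 0"
  obtains L where "L > 0" "\<And>x h. \<bar>\<phi> (x - h *\<^sub>R axis i 1) - \<phi> x\<bar> \<le> L * \<bar>h\<bar>"
    "\<And>x. \<bar>partial_deriv i \<phi> x\<bar> \<le> L"
proof -
  obtain L where L: "L > 0" "\<And>x. \<bar>partial_deriv i \<phi> x\<bar> \<le> L"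
    by (rule C_k_bounded[OF C1_partial_deriv[OF assms(1), of i]])
       (rule partial_deriv_outside_support[OF assms(2)], assumption, assumption, blast)
  have "\<bar>\<phi> (x - h *\<^sub>R axis i 1) - \<phi> x\<bar> \<le> L * \<bar>h\<bar>" for x h
  proof -
    have "norm (\<phi> (x - h *\<^sub>R axis i 1) - \<phi> (x - 0 *\<^sub>R axis i 1)) \<le> L * norm (h - 0)"
      by (rule field_differentiable_bound[where S=UNIV and f="\<lambda>h. \<phi> (x - h *\<^sub>R axis i 1)"
            and f'="\<lambda>h. - partial_deriv i \<phi> (x - h *\<^sub>R axis i 1)"])
         (use L(2) has_derivative_along_axis[OF C1_differentiable[OF assms(1)]] in auto)
    then show ?thesis by simp
  qed
  then show ?thesis by (rule that[OF L(1) _ L(2)])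
qed

text \<open>Dominated convergence with majorant L |f|, where L is a Lipschitz constant of \<phi>
  along the axis. The shift goes backwards, which accounts for the minus sign in the limit.\<close>

lemma integral_difference_quotient:
  fixes f :: "real^'n::finite \<Rightarrow> real"
  assumes f: "integrable lebesgue f" and \<phi>: "C_k (Suc 0) \<phi>" "\<And>x. norm x > R \<Longrightarrow> \<phi> x = 0"
  shows "((\<lambda>h. \<integral>x. f x * ((\<phi> (x - h *\<^sub>R axis i 1) - \<phi> x) / h) \<partial>lebesgue) \<longlongrightarrow>
           - (\<integral>x. f x * partial_deriv i \<phi> x \<partial>lebesgue)) (at 0)"
  unfolding tendsto_at_iff_sequentially o_def
proof (intro allI impI)
  fix X :: "nat \<Rightarrow> real" assume X: "\<forall>n. X n \<in> UNIV - {0}" "X \<longlonglongrightarrow> 0"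
  obtain L where L: "L > 0" "\<And>x h. \<bar>\<phi> (x - h *\<^sub>R axis i 1) - \<phi> x\<bar> \<le> L * \<bar>h\<bar>"
    "\<And>x. \<bar>partial_deriv i \<phi> x\<bar> \<le> L"
    by (rule C1_Lipschitz_along_axis[OF \<phi>(1), of _ i]) (rule \<phi>(2), assumption, blast)
  note \<phi>m = measurable_C_k[OF \<phi>(1)]
  have "(\<lambda>n. \<integral>x. f x * ((\<phi> (x - X n *\<^sub>R axis i 1) - \<phi> x) / X n) \<partial>lebesgue) \<longlonglongrightarrow>
      (\<integral>x. f x * (- partial_deriv i \<phi> x) \<partial>lebesgue)"
  proof (rule integral_dominated_convergence)
    show "(\<lambda>x. f x * (- partial_deriv i \<phi> x)) \<in> borel_measurable lebesgue"
      by (intro borel_measurable_times borel_measurable_uminus borel_measurable_integrable[OF f]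
            measurable_C_k[OF C1_partial_deriv[OF \<phi>(1)]])
    show "(\<lambda>x. f x * ((\<phi> (x - X n *\<^sub>R axis i 1) - \<phi> x) / X n)) \<in> borel_measurable lebesgue" for n
      using measurable_comp_translate[OF \<phi>m, of "- X n *\<^sub>R axis i 1"]
      by (intro borel_measurable_times borel_measurable_divide borel_measurable_diff
            borel_measurable_integrable[OF f] \<phi>m) auto
    show "integrable lebesgue (\<lambda>x. L * \<bar>f x\<bar>)" using f by simp
    show "AE x in lebesgue. (\<lambda>n. f x * ((\<phi> (x - X n *\<^sub>R axis i 1) - \<phi> x) / X n)) \<longlonglongrightarrow> f x * (- partial_deriv i \<phi> x)"
    proof (rule AE_I2)
      fix x :: "real^'n"
      have "((\<lambda>h. (\<phi> (x - h *\<^sub>R axis i 1) - \<phi> x) / h) \<longlongrightarrow> - partial_deriv i \<phi> x) (at 0)"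
        using has_derivative_along_axis[OF C1_differentiable[OF \<phi>(1)], of x i 0]
        by (simp add: DERIV_def)
      then have "(\<lambda>n. (\<phi> (x - X n *\<^sub>R axis i 1) - \<phi> x) / X n) \<longlonglongrightarrow> - partial_deriv i \<phi> x"
        using X unfolding tendsto_at_iff_sequentially o_def by blast
      then show "(\<lambda>n. f x * ((\<phi> (x - X n *\<^sub>R axis i 1) - \<phi> x) / X n)) \<longlonglongrightarrow> f x * (- partial_deriv i \<phi> x)"
        by (intro tendsto_intros)
    qed
    show "AE x in lebesgue. norm (f x * ((\<phi> (x - X n *\<^sub>R axis i 1) - \<phi> x) / X n)) \<le> L * \<bar>f x\<bar>" for n
    proof (rule AE_I2)
      fix x :: "real^'n"
      have "X n \<noteq> 0" using X(1) by auto
      then have "\<bar>(\<phi> (x - X n *\<^sub>R axis i 1) - \<phi> x) / X n\<bar> \<le> L"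
        using L(2)[of x "X n"] by (simp add: abs_divide pos_divide_le_eq)
      then have "\<bar>f x\<bar> * \<bar>(\<phi> (x - X n *\<^sub>R axis i 1) - \<phi> x) / X n\<bar> \<le> \<bar>f x\<bar> * L"
        by (rule mult_left_mono) simp
      then show "norm (f x * ((\<phi> (x - X n *\<^sub>R axis i 1) - \<phi> x) / X n)) \<le> L * \<bar>f x\<bar>"
        by (simp only: real_norm_def abs_mult mult.commute)
    qed
  qed
  then show "(\<lambda>n. \<integral>x. f x * ((\<phi> (x - X n *\<^sub>R axis i 1) - \<phi> x) / X n) \<partial>lebesgue) \<longlonglongrightarrow>
      - (\<integral>x. f x * partial_deriv i \<phi> x \<partial>lebesgue)" by simp
qed

text \<open>Take f to be the indicator of the ball of radius R + 1. For |h| < 1 the integral of the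
  difference quotient against f is zero by translation invariance, and its limit is minus the
  integral of the partial derivative.\<close>

lemma integral_partial_deriv_eq_0:
  assumes \<phi>: "C_k (Suc 0) \<phi>" "\<And>x. norm x > R \<Longrightarrow> \<phi> x = 0"
  shows "(\<integral>x. partial_deriv i \<phi> x \<partial>lebesgue) = 0"
proof -
  define f :: "real^'a \<Rightarrow> real" where "f x = indicator (cball 0 (R + 1)) x" for x
  have f: "integrable lebesgue f"
    unfolding f_def by (rule integrable_indicator_cball)
  have i: "integrable lebesgue \<phi>" by (rule C_k_integrable_L2(1)[OF \<phi>])
  have "(\<integral>x. f x * ((\<phi> (x - h *\<^sub>R axis i 1) - \<phi> x) / h) \<partial>lebesgue) = 0" if "\<bar>h\<bar> < 1" for h
  proof -
    have s: "\<phi> (x - h *\<^sub>R axis i 1) = 0" if "norm x > R + 1" for x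
    proof -
      have "norm (h *\<^sub>R axis i (1::real)) < 1" using \<open>\<bar>h\<bar> < 1\<close> by simp
      then show ?thesis using that norm_triangle_ineq2[of x "h *\<^sub>R axis i 1"] by (intro \<phi>(2)) linarith
    qed
    have "(\<integral>x. f x * ((\<phi> (x - h *\<^sub>R axis i 1) - \<phi> x) / h) \<partial>lebesgue) =
       (\<integral>x. (\<phi> (x + - (h *\<^sub>R axis i 1)) - \<phi> x) / h \<partial>lebesgue)"
    proof (rule Bochner_Integration.integral_cong[OF refl])
      fix x :: "real^'a"
      show "f x * ((\<phi> (x - h *\<^sub>R axis i 1) - \<phi> x) / h) = (\<phi> (x + - (h *\<^sub>R axis i 1)) - \<phi> x) / h"
        using s[of x] \<phi>(2)[of x] by (cases "norm x > R + 1") (auto simp: f_def indicator_def)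
    qed
    also have "\<dots> = 0"
      using i integrable_translate_iff[OF borel_measurable_integrable[OF i]]
        integral_translate[OF borel_measurable_integrable[OF i]]
      by (simp add: Bochner_Integration.integral_diff del: add_uminus_conv_diff)
    finally show ?thesis .
  qed
  then have "\<forall>\<^sub>F h in at 0. (\<integral>x. f x * ((\<phi> (x - h *\<^sub>R axis i 1) - \<phi> x) / h) \<partial>lebesgue) = 0"
    unfolding eventually_at by (intro exI[of _ 1]) auto
  then have "((\<lambda>h. \<integral>x. f x * ((\<phi> (x - h *\<^sub>R axis i 1) - \<phi> x) / h) \<partial>lebesgue) \<longlongrightarrow> 0) (at 0)"
    by (rule tendsto_eventually)
  from tendsto_unique[OF _ this integral_difference_quotient[OF f \<phi>]]
  have "(\<integral>x. f x * partial_deriv i \<phi> x \<partial>lebesgue) = 0" by simp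
  moreover have "f x * partial_deriv i \<phi> x = partial_deriv i \<phi> x" for x
    using partial_deriv_outside_support[of R \<phi> x i, OF \<phi>(2)] by (cases "norm x > R") (auto simp: f_def indicator_def)
  ultimately show ?thesis by simp
qed

text \<open>For a test function \<psi> close to u the Lipschitz bound and the finite volume of a
  ball suffice. The errors u - \<psi>, its translate, and the increment of \<psi> have squared norm
  at most e/9 each, and (a + b + c)^2 \<le> 3 (a^2 + b^2 + c^2) adds them up to e.\<close>

lemma L2_translation_continuous:
  fixes u :: "real^'n::finite \<Rightarrow> real"
  assumes u: "u \<in> L2 lebesgue" and R: "R > 0" "\<And>x. norm x > R \<Longrightarrow> u x = 0" and e: "e > 0"
  obtains d where "d > 0" "\<And>h. 0 \<le> h \<Longrightarrow> h < d \<Longrightarrow>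
    (\<integral>x. (u (x + h *\<^sub>R axis i 1) - u x)\<^sup>2 \<partial>lebesgue) \<le> e"
proof -
  obtain \<psi> where \<psi>: "test_function \<psi>" "\<psi> \<in> L2 lebesgue" "(\<integral>x. (u x - \<psi> x)\<^sup>2 \<partial>lebesgue) < e / 9"
    using L2_test_function_dense[OF u R, of "e / 9"] e by auto
  obtain S where S: "\<And>x. norm x > S \<Longrightarrow> \<psi> x = 0" using test_function_bound[OF \<psi>(1)] by blast
  obtain L where L: "L > 0" "\<And>x h. \<bar>\<psi> (x - h *\<^sub>R axis i 1) - \<psi> x\<bar> \<le> L * \<bar>h\<bar>"
    "\<And>x. \<bar>partial_deriv i \<psi> x\<bar> \<le> L"
    by (rule C1_Lipschitz_along_axis[OF C_k_test[OF \<psi>(1)], of _ i]) (rule S, assumption, blast)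
  define V :: real where "V = (\<integral>x. indicator (cball 0 (S + 1)) x \<partial>(lebesgue :: (real^'n) measure))"
  have V: "V \<ge> 0" unfolding V_def by (intro Bochner_Integration.integral_nonneg) simp
  have Vi: "integrable lebesgue (\<lambda>x::real^'n. indicator (cball 0 (S + 1)) x :: real)"
    by (rule integrable_indicator_cball)
  \<comment> \<open>For h < 1 the increment of \<psi> costs at most
    \<open>L\<^sup>2 * V * h\<^sup>2\<close>, hence at most \<open>(L\<^sup>2 * V + 1) * h\<close>;
    the added 1 keeps the denominator positive. The bound 1 also keeps the shifted support inside
    radius S + 1.\<close>
  define d where "d = min 1 (e / (9 * (L\<^sup>2 * V + 1)))"
  have p: "L\<^sup>2 * V + 1 > 0" using V by (simp add: add_nonneg_pos)
  then have "d > 0" using e by (simp add: d_def)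
  moreover have "(\<integral>x. (u (x + h *\<^sub>R axis i 1) - u x)\<^sup>2 \<partial>lebesgue) \<le> e" if h: "0 \<le> h" "h < d" for h
  proof -
    let ?c = "h *\<^sub>R axis i 1 :: real^'n"
    have h1: "h < 1" using h by (simp add: d_def)
    have *: "(\<integral>x. (\<psi> (x + ?c) - \<psi> x)\<^sup>2 \<partial>lebesgue) \<le> e / 9"
    proof -
      have "(\<integral>x. (\<psi> (x + ?c) - \<psi> x)\<^sup>2 \<partial>lebesgue) \<le>
          integral\<^sup>L lebesgue (\<lambda>x::real^'n. (L * h)\<^sup>2 * indicator (cball 0 (S + 1)) x)"
      proof (rule integral_mono)
        show "integrable lebesgue (\<lambda>x. (\<psi> (x + ?c) - \<psi> x)\<^sup>2)"
          by (intro L2_integrable_square L2_diff L2_translate(1) \<psi>(2))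
        show "integrable lebesgue (\<lambda>x::real^'n. (L * h)\<^sup>2 * indicator (cball 0 (S + 1)) x :: real)"
          by (intro integrable_mult_right Vi)
        fix x :: "real^'n"
        show "(\<psi> (x + ?c) - \<psi> x)\<^sup>2 \<le> (L * h)\<^sup>2 * indicator (cball 0 (S + 1)) x"
        proof (cases "norm x > S + 1")
          case True
          have "norm ?c < 1" using h1 h(1) by simp
          then have "norm (x + ?c) > S" using True norm_triangle_ineq2[of x "- ?c"] by simp
          then show ?thesis using S[of x] S[of "x + ?c"] True by simp
        next
          case False
          have "\<bar>\<psi> (x + ?c) - \<psi> x\<bar> \<le> \<bar>L * h\<bar>"
            using L(2)[of x "- h"] L(1) h(1) by (simp add: abs_mult)
          then show ?thesis using False by (simp add: abs_le_square_iff)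
        qed
      qed
      also have "\<dots> = (L\<^sup>2 * V) * h\<^sup>2" by (simp add: V_def power_mult_distrib)
      also have "\<dots> \<le> (L\<^sup>2 * V + 1) * h"
        using V h h1 by (intro mult_mono) (auto simp: power2_eq_square mult_left_le)
      also have "\<dots> \<le> (L\<^sup>2 * V + 1) * (e / (9 * (L\<^sup>2 * V + 1)))"
        using h p by (intro mult_left_mono) (auto simp: d_def)
      also have "\<dots> = e / 9"
      proof -
        have "c * (e / (9 * c)) = e / 9" if "c \<noteq> 0" for c :: real using that by simp
        then show ?thesis using p by (metis less_irrefl)
      qed
      finally show ?thesis .
    qed
    note i = L2_integrable_square[OF L2_diff[OF L2_translate(1)[OF u] L2_translate(1)[OF \<psi>(2)]]]
       L2_integrable_square[OF L2_diff[OF L2_translate(1)[OF \<psi>(2)] \<psi>(2)]]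
       L2_integrable_square[OF L2_diff[OF u \<psi>(2)]]
       L2_integrable_square[OF L2_diff[OF L2_translate(1)[OF u] u]]
    have "(\<integral>x. (u (x + ?c) - u x)\<^sup>2 \<partial>lebesgue) \<le>
       (\<integral>x. 3 * (u (x + ?c) - \<psi> (x + ?c))\<^sup>2 + 3 * (\<psi> (x + ?c) - \<psi> x)\<^sup>2 + 3 * (u x - \<psi> x)\<^sup>2 \<partial>lebesgue)"
    proof (rule integral_mono)
      fix x :: "real^'n"
      have "(a + b + c)\<^sup>2 \<le> 3 * a\<^sup>2 + 3 * b\<^sup>2 + 3 * c\<^sup>2" for a b c :: real
      proof -
        have "(a + b + c)\<^sup>2 = a\<^sup>2 + b\<^sup>2 + c\<^sup>2 + 2 * a * b + 2 * a * c + 2 * b * c"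
          by (simp add: power2_eq_square algebra_simps)
        then show ?thesis
          using sum_squares_bound[of a b] sum_squares_bound[of a c] sum_squares_bound[of b c] by linarith
      qed
      from this[of "u (x + ?c) - \<psi> (x + ?c)" "\<psi> (x + ?c) - \<psi> x" "- (u x - \<psi> x)"]
      show "(u (x + ?c) - u x)\<^sup>2 \<le> 3 * (u (x + ?c) - \<psi> (x + ?c))\<^sup>2 + 3 * (\<psi> (x + ?c) - \<psi> x)\<^sup>2 + 3 * (u x - \<psi> x)\<^sup>2"
        by (simp only: power2_minus) simp
    qed (use i in auto)
    also have "\<dots> = 3 * (\<integral>x. (u (x + ?c) - \<psi> (x + ?c))\<^sup>2 \<partial>lebesgue) + 3 * (\<integral>x. (\<psi> (x + ?c) - \<psi> x)\<^sup>2 \<partial>lebesgue)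
       + 3 * (\<integral>x. (u x - \<psi> x)\<^sup>2 \<partial>lebesgue)" using i by simp
    also have "\<dots> \<le> e"
      using * \<psi>(3) L2_translate(2)[OF L2_diff[OF u \<psi>(2)], of ?c] by simp
    finally show ?thesis .
  qed
  ultimately show ?thesis by (rule that)
qed

lemma L2_bounded_support_integrable:
  fixes u :: "real^'n::finite \<Rightarrow> real"
  assumes "u \<in> L2 lebesgue" "\<And>x. norm x > R \<Longrightarrow> u x = 0" shows "integrable lebesgue u"
proof -
  have "(\<lambda>x::real^'n. indicator (cball 0 R) x :: real) \<in> L2 lebesgue"
    using integrable_indicator_cball[of R, where ?'a="real^'n"]
    by (simp add: L2_iff power2_eq_square flip: indicator_inter_arith)
  from L2_integrable_mult[OF assms(1) this]
  have "integrable lebesgue (\<lambda>x. u x * indicator (cball 0 R) x)" .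
  moreover have "u x * indicator (cball 0 R) x = u x" for x
    using assms(2)[of x] by (auto simp: indicator_def)
  ultimately show ?thesis by simp
qed

text \<open>The shift acts on the smooth factor, so differentiating in s produces minus the partial
  derivative of a translated test function. The weak identity, applied to that translate, converts
  it into the pairing with v.\<close>

lemma has_derivative_shifted_pairing:
  fixes u v :: "real^'n::finite \<Rightarrow> real"
  assumes u: "integrable lebesgue u"
    and w: "\<And>\<psi>. test_function \<psi> \<Longrightarrow>
        (\<integral>x. u x * partial_deriv i \<psi> x \<partial>lebesgue) = - (\<integral>x. v x * \<psi> x \<partial>lebesgue)"
    and \<psi>: "test_function \<psi>"
  shows "((\<lambda>s. \<integral>x. u x * \<psi> (x - s *\<^sub>R axis i 1) \<partial>lebesgue) has_real_derivative
           (\<integral>x. v x * \<psi> (x - s *\<^sub>R axis i 1) \<partial>lebesgue)) (at s)"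
proof -
  have t: "test_function (\<lambda>x. \<psi> (x - s *\<^sub>R axis i 1))" for s
    using test_function_translate[OF \<psi>, of "- (s *\<^sub>R axis i 1)"] by simp
  have int: "integrable lebesgue (\<lambda>x. u x * \<psi> (x - s *\<^sub>R axis i 1))" for s
  proof -
    obtain R where R: "\<And>x. norm x > R \<Longrightarrow> \<psi> (x - s *\<^sub>R axis i 1) = 0" using test_function_bound[OF t] by blast
    obtain K where K: "K > 0" "\<And>x. \<bar>\<psi> (x - s *\<^sub>R axis i 1)\<bar> \<le> K"
      by (rule C_k_bounded[OF C_k_test[OF t[of s]]]) (rule R, assumption, blast)
    show ?thesis by (rule integrable_mult_bounded[OF u measurable_C_k[OF C_k_test[OF t]] K(2)])
  qed
  obtain R where R: "\<And>x. norm x > R \<Longrightarrow> \<psi> (x - s *\<^sub>R axis i 1) = 0" using test_function_bound[OF t] by blast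
  have "((\<lambda>h. \<integral>x. u x * ((\<psi> (x - h *\<^sub>R axis i 1 - s *\<^sub>R axis i 1) - \<psi> (x - s *\<^sub>R axis i 1)) / h) \<partial>lebesgue) \<longlongrightarrow>
           - (\<integral>x. u x * partial_deriv i (\<lambda>x. \<psi> (x - s *\<^sub>R axis i 1)) x \<partial>lebesgue)) (at 0)"
    by (rule integral_difference_quotient[OF u C_k_test[OF t] R])
  moreover have "(\<integral>x. u x * ((\<psi> (x - h *\<^sub>R axis i 1 - s *\<^sub>R axis i 1) - \<psi> (x - s *\<^sub>R axis i 1)) / h) \<partial>lebesgue)
     = ((\<integral>x. u x * \<psi> (x - (s + h) *\<^sub>R axis i 1) \<partial>lebesgue) - (\<integral>x. u x * \<psi> (x - s *\<^sub>R axis i 1) \<partial>lebesgue)) / h" for h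
  proof -
    have "x - h *\<^sub>R axis i 1 - s *\<^sub>R axis i 1 = x - (s + h) *\<^sub>R axis i 1" for x :: "real^'n"
      by (simp add: algebra_simps)
    then have "(\<lambda>x. u x * ((\<psi> (x - h *\<^sub>R axis i 1 - s *\<^sub>R axis i 1) - \<psi> (x - s *\<^sub>R axis i 1)) / h))
        = (\<lambda>x. (u x * \<psi> (x - (s + h) *\<^sub>R axis i 1) - u x * \<psi> (x - s *\<^sub>R axis i 1)) / h)"
      by (simp only: right_diff_distrib times_divide_eq_right)
    then show ?thesis using int by simp
  qed
  ultimately show ?thesis unfolding DERIV_def w[OF t] minus_minus by (simp only:)
qed

text \<open>With \<open>D\<close> the error of the difference quotient, the mean value theorem for
  \<open>s \<mapsto> \<integral> u(x) \<psi>(x - s e) dx\<close> turns the pairing \<open>\<integral> D \<psi>\<close> into \<open>\<integral> (v(x + s e) - v(x)) \<psi>(x) dx\<close> for some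
  \<open>s\<close> between \<open>0\<close> and \<open>h\<close>, so that \<open>2 \<integral> D \<psi> \<le> e + \<integral> \<psi>^2\<close>; then let \<open>\<psi> \<rightarrow> D\<close>.\<close>

lemma L2_difference_quotient:
  fixes u v :: "real^'n::finite \<Rightarrow> real"
  assumes u: "u \<in> L2 lebesgue" "\<And>x. norm x > R \<Longrightarrow> u x = 0"
    and v: "v \<in> L2 lebesgue" "\<And>x. norm x > R \<Longrightarrow> v x = 0" and R: "R > 0"
    and w: "\<And>\<psi>. test_function \<psi> \<Longrightarrow>
        (\<integral>x. u x * partial_deriv i \<psi> x \<partial>lebesgue) = - (\<integral>x. v x * \<psi> x \<partial>lebesgue)"
    and e: "e > 0"
  obtains d where "d > 0" "\<And>h. 0 < h \<Longrightarrow> h < d \<Longrightarrow>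
    (\<integral>x. ((u (x + h *\<^sub>R axis i 1) - u x) / h - v x)\<^sup>2 \<partial>lebesgue) \<le> e"
proof -
  let ?e = "axis i 1 :: real^'n"
  obtain d where d: "d > 0" "\<And>h. 0 \<le> h \<Longrightarrow> h < d \<Longrightarrow>
    (\<integral>x. (v (x + h *\<^sub>R ?e) - v x)\<^sup>2 \<partial>lebesgue) \<le> e"
    using L2_translation_continuous[OF v(1) R v(2) e] by blast
  have ui: "integrable lebesgue u" by (rule L2_bounded_support_integrable[OF u])
  \<comment> \<open>The bound 1 on h confines the support of the error to radius R + 1, as the
    density of test functions requires.\<close>
  have "(\<integral>x. ((u (x + h *\<^sub>R ?e) - u x) / h - v x)\<^sup>2 \<partial>lebesgue) \<le> e" if h: "0 < h" "h < min 1 d" for h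
  proof -
    define D where "D x = (u (x + h *\<^sub>R ?e) - u x) / h - v x" for x
    have DL: "D \<in> L2 lebesgue"
    proof -
      have "(\<lambda>x. (1 / h) * (u (x + h *\<^sub>R ?e) - u x) - v x) \<in> L2 lebesgue"
        by (intro L2_diff L2_cmult L2_translate u v)
      then show ?thesis by (simp add: D_def[abs_def])
    qed
    have R1: "R + 1 > 0" using R by simp
    have D0: "D x = 0" if "norm x > R + 1" for x
    proof -
      have "norm (h *\<^sub>R ?e) < 1" using h by simp
      then have "norm (x + h *\<^sub>R ?e) > R" using that norm_triangle_ineq2[of x "- (h *\<^sub>R ?e)"] by simp
      then show ?thesis using that u(2) v(2) by (simp add: D_def)
    qed
    have pair: "2 * (\<integral>x. D x * \<psi> x \<partial>lebesgue) \<le> e + (\<integral>x. (\<psi> x)\<^sup>2 \<partial>lebesgue)"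
      if \<psi>: "test_function \<psi>" and \<psi>L: "\<psi> \<in> L2 lebesgue" for \<psi>
    proof -
      define F where "F s = (\<integral>x. u x * \<psi> (x - s *\<^sub>R ?e) \<partial>lebesgue)" for s
      define F' where "F' s = (\<integral>x. v x * \<psi> (x - s *\<^sub>R ?e) \<partial>lebesgue)" for s
      have "(F has_real_derivative F' s) (at s)" for s
        unfolding F_def F'_def by (rule has_derivative_shifted_pairing[OF ui w \<psi>])
      then obtain s where s: "0 < s" "s < h" "F h - F 0 = (h - 0) * F' s"
        using MVT2[of 0 h F F'] h by auto
      \<comment> \<open>Translation invariance moves the shift from the test function to the other
        factor.\<close>
      have tr: "(\<integral>x. f x * \<psi> (x - s *\<^sub>R ?e) \<partial>lebesgue) = (\<integral>x. f (x + s *\<^sub>R ?e) * \<psi> x \<partial>lebesgue)"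
        if "f \<in> L2 lebesgue" for f s
      proof -
        have "(\<lambda>x. \<psi> (x - s *\<^sub>R ?e)) \<in> borel_measurable lebesgue"
          using measurable_comp_translate[OF L2_measurable[OF \<psi>L], of "- (s *\<^sub>R ?e)"] by simp
        then have "(\<lambda>x. f x * \<psi> (x - s *\<^sub>R ?e)) \<in> borel_measurable lebesgue"
          using L2_measurable[OF that] by (intro borel_measurable_times)
        from integral_translate[OF this, of "s *\<^sub>R ?e"] show ?thesis by simp
      qed
      note i = L2_integrable_mult[OF L2_translate(1)[OF u(1)] \<psi>L] L2_integrable_mult[OF u(1) \<psi>L]
        L2_integrable_mult[OF v(1) \<psi>L] L2_integrable_mult[OF L2_translate(1)[OF v(1)] \<psi>L]
      have "(\<integral>x. D x * \<psi> x \<partial>lebesgue) =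
          (\<integral>x. (1 / h) * (u (x + h *\<^sub>R ?e) * \<psi> x - u x * \<psi> x) - v x * \<psi> x \<partial>lebesgue)"
        by (rule Bochner_Integration.integral_cong) (simp_all add: D_def field_simps)
      also have "\<dots> = (1 / h) * ((\<integral>x. u (x + h *\<^sub>R ?e) * \<psi> x \<partial>lebesgue) - (\<integral>x. u x * \<psi> x \<partial>lebesgue))
          - (\<integral>x. v x * \<psi> x \<partial>lebesgue)"
        using i by simp
      also have "\<dots> = (1 / h) * (F h - F 0) - (\<integral>x. v x * \<psi> x \<partial>lebesgue)"
        using tr[OF u(1), of h] by (simp add: F_def)
      also have "\<dots> = F' s - (\<integral>x. v x * \<psi> x \<partial>lebesgue)" using s h by simp
      also have "\<dots> = (\<integral>x. v (x + s *\<^sub>R ?e) * \<psi> x - v x * \<psi> x \<partial>lebesgue)"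
        unfolding F'_def using i tr[OF v(1), of s] by simp
      also have "\<dots> = (\<integral>x. (v (x + s *\<^sub>R ?e) - v x) * \<psi> x \<partial>lebesgue)"
        by (simp add: left_diff_distrib)
      finally have "2 * (\<integral>x. D x * \<psi> x \<partial>lebesgue) = (\<integral>x. 2 * ((v (x + s *\<^sub>R ?e) - v x) * \<psi> x) \<partial>lebesgue)"
        by simp
      also have "\<dots> \<le> (\<integral>x. (v (x + s *\<^sub>R ?e) - v x)\<^sup>2 + (\<psi> x)\<^sup>2 \<partial>lebesgue)"
      proof (rule integral_mono)
        show "integrable lebesgue (\<lambda>x. 2 * ((v (x + s *\<^sub>R ?e) - v x) * \<psi> x))"
          by (intro integrable_mult_right L2_integrable_mult L2_diff L2_translate v \<psi>L)
        show "integrable lebesgue (\<lambda>x. (v (x + s *\<^sub>R ?e) - v x)\<^sup>2 + (\<psi> x)\<^sup>2)"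
          by (intro Bochner_Integration.integrable_add L2_integrable_square L2_diff L2_translate v \<psi>L)
        show "2 * ((v (x + s *\<^sub>R ?e) - v x) * \<psi> x) \<le> (v (x + s *\<^sub>R ?e) - v x)\<^sup>2 + (\<psi> x)\<^sup>2" for x
          using sum_squares_bound[of "v (x + s *\<^sub>R ?e) - v x" "\<psi> x"] by (simp only: mult.assoc)
      qed
      also have "\<dots> = (\<integral>x. (v (x + s *\<^sub>R ?e) - v x)\<^sup>2 \<partial>lebesgue) + (\<integral>x. (\<psi> x)\<^sup>2 \<partial>lebesgue)"
        by (intro Bochner_Integration.integral_add L2_integrable_square L2_diff L2_translate v \<psi>L)
      also have "\<dots> \<le> e + (\<integral>x. (\<psi> x)\<^sup>2 \<partial>lebesgue)" using d(2)[of s] s h by simp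
      finally show ?thesis .
    qed
    \<comment> \<open>Expanding the square of D - \<psi>, whose integral is below \<eta>, and
      inserting \<open>pair\<close> cancels the integral of \<open>\<psi>\<^sup>2\<close> and leaves
      e + \<eta>.\<close>
    have "(\<integral>x. (D x)\<^sup>2 \<partial>lebesgue) \<le> e"
    proof (rule field_le_epsilon)
      fix \<eta> :: real assume "\<eta> > 0"
      then obtain \<psi> where \<psi>: "test_function \<psi>" "\<psi> \<in> L2 lebesgue" "(\<integral>x. (D x - \<psi> x)\<^sup>2 \<partial>lebesgue) < \<eta>"
        using L2_test_function_dense[OF DL R1 D0] by blast
      note i = L2_integrable_square[OF DL] L2_integrable_square[OF \<psi>(2)] L2_integrable_mult[OF DL \<psi>(2)]
      have "(\<integral>x. (D x - \<psi> x)\<^sup>2 \<partial>lebesgue) = (\<integral>x. (D x)\<^sup>2 + (\<psi> x)\<^sup>2 - 2 * (D x * \<psi> x) \<partial>lebesgue)"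
        by (simp add: power2_diff mult.assoc)
      also have "\<dots> = (\<integral>x. (D x)\<^sup>2 \<partial>lebesgue) + (\<integral>x. (\<psi> x)\<^sup>2 \<partial>lebesgue) - 2 * (\<integral>x. D x * \<psi> x \<partial>lebesgue)"
        using i by simp
      finally show "(\<integral>x. (D x)\<^sup>2 \<partial>lebesgue) \<le> e + \<eta>" using \<psi>(3) pair[OF \<psi>(1,2)] by linarith
    qed
    then show ?thesis by (simp add: D_def)
  qed
  then show ?thesis using that[of "min 1 d"] d(1) by simp
qed

text \<open>Let q be the difference quotient of u. Moving the shift from \<phi> to u^2 produces ((u
  + h q)^2 - u^2) / h = 2 u (q - v) + h q^2 + 2 u v. As h tends to 0, q tends to v in L2, so the
  first two terms disappear against the bounded \<phi>.\<close>

lemma weak_deriv_square: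
  fixes u v :: "real^'n::finite \<Rightarrow> real"
  assumes u: "u \<in> L2 lebesgue" "\<And>x. norm x > R \<Longrightarrow> u x = 0"
    and v: "v \<in> L2 lebesgue" "\<And>x. norm x > R \<Longrightarrow> v x = 0" and R: "R > 0"
    and w: "\<And>\<psi>. test_function \<psi> \<Longrightarrow>
        (\<integral>x. u x * partial_deriv i \<psi> x \<partial>lebesgue) = - (\<integral>x. v x * \<psi> x \<partial>lebesgue)"
    and \<phi>: "C_k (Suc 0) \<phi>" "\<And>x. norm x > S \<Longrightarrow> \<phi> x = 0"
  shows "(\<integral>x. (u x)\<^sup>2 * partial_deriv i \<phi> x \<partial>lebesgue) = - 2 * (\<integral>x. u x * v x * \<phi> x \<partial>lebesgue)"
proof -
  let ?e = "axis i 1 :: real^'n"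
  obtain M where M: "M > 0" "\<And>x. \<bar>\<phi> x\<bar> \<le> M" 
    by (rule C_k_bounded[OF \<phi>(1)]) (rule \<phi>(2), assumption, blast)
  note \<phi>m = measurable_C_k[OF \<phi>(1)]
  define A where "A h = (\<integral>x. (u x)\<^sup>2 * ((\<phi> (x - h *\<^sub>R ?e) - \<phi> x) / h) \<partial>lebesgue)" for h
  define B where "B = (\<integral>x. u x * v x * \<phi> x \<partial>lebesgue)"
  define U where "U = (\<integral>x. (u x)\<^sup>2 \<partial>lebesgue)"
  define V where "V = (\<integral>x. (v x)\<^sup>2 \<partial>lebesgue)"
  let ?L = "- (\<integral>x. (u x)\<^sup>2 * partial_deriv i \<phi> x \<partial>lebesgue)"
  have "(A \<longlongrightarrow> ?L) (at 0)"
    unfolding A_def by (rule integral_difference_quotient[OF L2_integrable_square[OF u(1)] \<phi>])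
  then have AL: "(\<lambda>k. A (inverse (real (Suc k)))) \<longlonglongrightarrow> ?L"
    using LIMSEQ_inverse_real_of_nat unfolding tendsto_at_iff_sequentially o_def by auto
  have U0: "U \<ge> 0" unfolding U_def by simp
  \<comment> \<open>Here s is the free parameter in 2 |u| |q - v| \<le> s u^2 + (q - v)^2 / s, and
    q^2 is bounded by 2 v^2 + 2 (q - v)^2. U and V are the squared norms of u and v.\<close>
  have est: "\<bar>A h - 2 * B\<bar> \<le> M * (s * U + I / s) + h * (M * (2 * V + 2 * I))"
    if h: "h > 0" and s: "s > 0" and I: "I = (\<integral>x. ((u (x + h *\<^sub>R ?e) - u x) / h - v x)\<^sup>2 \<partial>lebesgue)" for h s I
  proof -
    define q where "q x = (1 / h) * (u (x + h *\<^sub>R ?e) - u x)" for x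
    have qL: "q \<in> L2 lebesgue"
      unfolding q_def[abs_def] by (intro L2_diff L2_cmult L2_translate u)
    note qvL = L2_diff[OF qL v(1)]
    have I': "I = (\<integral>x. (q x - v x)\<^sup>2 \<partial>lebesgue)" unfolding I q_def by simp
    have u2\<phi>: "integrable lebesgue (\<lambda>x. (u x)\<^sup>2 * \<phi> (x - h *\<^sub>R ?e))"
      using measurable_comp_translate[OF \<phi>m, of "- (h *\<^sub>R ?e)"] M(2)
      by (intro integrable_mult_bounded[OF L2_integrable_square[OF u(1)]]) auto
    have i1: "integrable lebesgue (\<lambda>x. (u x)\<^sup>2 * \<phi> x)"
      "integrable lebesgue (\<lambda>x. (u (x + h *\<^sub>R ?e))\<^sup>2 * \<phi> x)"
      "integrable lebesgue (\<lambda>x. u x * (q x - v x) * \<phi> x)"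
      "integrable lebesgue (\<lambda>x. (q x)\<^sup>2 * \<phi> x)"
      "integrable lebesgue (\<lambda>x. u x * v x * \<phi> x)"
      by (intro integrable_mult_bounded[OF _ \<phi>m M(2)] L2_integrable_square L2_translate(1) u(1) qL v(1)
            L2_integrable_mult qvL)+
    have "A h = (1 / h) * ((\<integral>x. (u x)\<^sup>2 * \<phi> (x - h *\<^sub>R ?e) \<partial>lebesgue) - (\<integral>x. (u x)\<^sup>2 * \<phi> x \<partial>lebesgue))"
      unfolding A_def using u2\<phi> i1(1) by (simp add: right_diff_distrib diff_divide_distrib)
    also have "(\<integral>x. (u x)\<^sup>2 * \<phi> (x - h *\<^sub>R ?e) \<partial>lebesgue) = (\<integral>x. (u (x + h *\<^sub>R ?e))\<^sup>2 * \<phi> x \<partial>lebesgue)"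
      using integral_translate[OF borel_measurable_integrable[OF u2\<phi>], of "h *\<^sub>R ?e"] by simp
    also have "(1 / h) * ((\<integral>x. (u (x + h *\<^sub>R ?e))\<^sup>2 * \<phi> x \<partial>lebesgue) - (\<integral>x. (u x)\<^sup>2 * \<phi> x \<partial>lebesgue))
       = (\<integral>x. (1 / h) * ((u (x + h *\<^sub>R ?e))\<^sup>2 * \<phi> x - (u x)\<^sup>2 * \<phi> x) \<partial>lebesgue)"
      using i1 by simp
    also have "\<dots> = (\<integral>x. 2 * (u x * (q x - v x) * \<phi> x) + h * ((q x)\<^sup>2 * \<phi> x) + 2 * (u x * v x * \<phi> x) \<partial>lebesgue)"
    proof (rule Bochner_Integration.integral_cong[OF refl])
      fix x :: "real^'n"
      have e: "u (x + h *\<^sub>R ?e) = u x + h * q x" using h by (simp add: q_def)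
      show "(1 / h) * ((u (x + h *\<^sub>R ?e))\<^sup>2 * \<phi> x - (u x)\<^sup>2 * \<phi> x)
          = 2 * (u x * (q x - v x) * \<phi> x) + h * ((q x)\<^sup>2 * \<phi> x) + 2 * (u x * v x * \<phi> x)"
        unfolding e using h by (simp add: power2_eq_square field_simps)
    qed
    also have "\<dots> = 2 * (\<integral>x. u x * (q x - v x) * \<phi> x \<partial>lebesgue) + h * (\<integral>x. (q x)\<^sup>2 * \<phi> x \<partial>lebesgue) + 2 * B"
      unfolding B_def using i1 by simp
    finally have eq: "A h - 2 * B = 2 * (\<integral>x. u x * (q x - v x) * \<phi> x \<partial>lebesgue) + h * (\<integral>x. (q x)\<^sup>2 * \<phi> x \<partial>lebesgue)"
      by simp
    have tri: "\<bar>a + h * b\<bar> \<le> \<bar>a\<bar> + h * \<bar>b\<bar>" for a b :: real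
      using abs_triangle_ineq[of a "h * b"] h by (simp add: abs_mult)
    have "\<bar>A h - 2 * B\<bar> \<le> \<bar>2 * (\<integral>x. u x * (q x - v x) * \<phi> x \<partial>lebesgue)\<bar> + h * \<bar>\<integral>x. (q x)\<^sup>2 * \<phi> x \<partial>lebesgue\<bar>"
      unfolding eq by (rule tri)
    moreover have "\<bar>2 * (\<integral>x. u x * (q x - v x) * \<phi> x \<partial>lebesgue)\<bar> \<le> M * (s * U + I / s)"
    proof -
      have "\<bar>\<integral>x. 2 * (u x * (q x - v x) * \<phi> x) \<partial>lebesgue\<bar> \<le> (\<integral>x. M * (s * (u x)\<^sup>2 + (q x - v x)\<^sup>2 / s) \<partial>lebesgue)"
      proof (rule integral_abs_bound_integral)
        show "integrable lebesgue (\<lambda>x. 2 * (u x * (q x - v x) * \<phi> x))" using i1(3) by simp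
        show "integrable lebesgue (\<lambda>x. M * (s * (u x)\<^sup>2 + (q x - v x)\<^sup>2 / s))"
          using L2_integrable_square[OF u(1)] L2_integrable_square[OF qvL] by simp
        fix x :: "real^'n"
        have "2 * (\<bar>u x\<bar> * \<bar>q x - v x\<bar>) \<le> s * (u x)\<^sup>2 + (q x - v x)\<^sup>2 / s"
        proof -
          have "0 \<le> (s * \<bar>u x\<bar> - \<bar>q x - v x\<bar>)\<^sup>2 / s" using s by simp
          also have "\<dots> = s * (u x)\<^sup>2 + (q x - v x)\<^sup>2 / s - 2 * (\<bar>u x\<bar> * \<bar>q x - v x\<bar>)"
            using s by (simp add: power2_diff power_mult_distrib field_simps power2_eq_square)
          finally show ?thesis by simp
        qed
        then have "\<bar>\<phi> x\<bar> * (2 * (\<bar>u x\<bar> * \<bar>q x - v x\<bar>)) \<le> M * (s * (u x)\<^sup>2 + (q x - v x)\<^sup>2 / s)"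
          using M by (intro mult_mono) auto
        then show "\<bar>2 * (u x * (q x - v x) * \<phi> x)\<bar> \<le> M * (s * (u x)\<^sup>2 + (q x - v x)\<^sup>2 / s)"
          by (simp only: abs_mult abs_numeral mult_ac)
      qed
      also have "\<dots> = M * (s * U + I / s)"
        unfolding U_def I' using L2_integrable_square[OF u(1)] L2_integrable_square[OF qvL] by simp
      finally show ?thesis using i1(3) by simp
    qed
    moreover have "\<bar>\<integral>x. (q x)\<^sup>2 * \<phi> x \<partial>lebesgue\<bar> \<le> M * (2 * V + 2 * I)"
    proof -
      have "\<bar>\<integral>x. (q x)\<^sup>2 * \<phi> x \<partial>lebesgue\<bar> \<le> (\<integral>x. M * (2 * (v x)\<^sup>2 + 2 * (q x - v x)\<^sup>2) \<partial>lebesgue)"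
      proof (rule integral_abs_bound_integral[OF i1(4)])
        show "integrable lebesgue (\<lambda>x. M * (2 * (v x)\<^sup>2 + 2 * (q x - v x)\<^sup>2))"
          using L2_integrable_square[OF v(1)] L2_integrable_square[OF qvL] by simp
        fix x :: "real^'n"
        have "(a + b)\<^sup>2 \<le> 2 * a\<^sup>2 + 2 * b\<^sup>2" for a b :: real
          using sum_squares_bound[of a b] by (simp add: power2_sum)
        from this[of "v x" "q x - v x"] have "(q x)\<^sup>2 \<le> 2 * (v x)\<^sup>2 + 2 * (q x - v x)\<^sup>2" by simp
        then have "\<bar>\<phi> x\<bar> * (q x)\<^sup>2 \<le> M * (2 * (v x)\<^sup>2 + 2 * (q x - v x)\<^sup>2)"
          using M by (intro mult_mono) auto
        then show "\<bar>(q x)\<^sup>2 * \<phi> x\<bar> \<le> M * (2 * (v x)\<^sup>2 + 2 * (q x - v x)\<^sup>2)"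
          by (simp add: abs_mult mult_ac)
      qed
      also have "\<dots> = M * (2 * V + 2 * I)"
        unfolding V_def I' using L2_integrable_square[OF v(1)] L2_integrable_square[OF qvL] by simp
      finally show ?thesis .
    qed
    moreover from this have "h * \<bar>\<integral>x. (q x)\<^sup>2 * \<phi> x \<partial>lebesgue\<bar> \<le> h * (M * (2 * V + 2 * I))"
      by (rule mult_left_mono) (use h in simp)
    ultimately show ?thesis by linarith
  qed
  \<comment> \<open>Asking for I \<le> s^2 makes I / s \<le> s, so the first part of
    \<open>est\<close> is of order s; the part with the factor h vanishes along h = 1 / (k +
    1).\<close>
  have key: "\<bar>?L - 2 * B\<bar> \<le> (M * (U + 1)) * s" if s: "s > 0" for s
  proof -
    obtain d where d: "d > 0" "\<And>h. 0 < h \<Longrightarrow> h < d \<Longrightarrow>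
      (\<integral>x. ((u (x + h *\<^sub>R ?e) - u x) / h - v x)\<^sup>2 \<partial>lebesgue) \<le> s\<^sup>2"
      using L2_difference_quotient[OF u v R w, of "s\<^sup>2"] s by auto
    have "\<forall>\<^sub>F k in sequentially. inverse (real (Suc k)) < d"
      by (rule order_tendstoD(2)[OF LIMSEQ_inverse_real_of_nat d(1)])
    then have ev: "\<forall>\<^sub>F k in sequentially. \<bar>A (inverse (real (Suc k))) - 2 * B\<bar>
        \<le> (M * (U + 1)) * s + inverse (real (Suc k)) * (M * (2 * V + 2 * s\<^sup>2))"
    proof eventually_elim
      case (elim k)
      define h where "h = inverse (real (Suc k))"
      have h: "h > 0" "h < d" using elim by (simp_all add: h_def)
      define I where "I = (\<integral>x. ((u (x + h *\<^sub>R ?e) - u x) / h - v x)\<^sup>2 \<partial>lebesgue)"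
      have I: "I \<le> s\<^sup>2" unfolding I_def by (rule d(2)[OF h])
      then have "I / s \<le> s" using s by (simp add: divide_le_eq power2_eq_square)
      then have "M * (s * U + I / s) \<le> M * (s * U + s)" using M by simp
      moreover have "h * (M * (2 * V + 2 * I)) \<le> h * (M * (2 * V + 2 * s\<^sup>2))"
        using h M I by simp
      ultimately show ?case using est[OF h(1) s I_def] unfolding h_def[symmetric]
        by (simp add: algebra_simps)
    qed
    have "(\<lambda>k. (M * (U + 1)) * s + inverse (real (Suc k)) * (M * (2 * V + 2 * s\<^sup>2)))
       \<longlonglongrightarrow> (M * (U + 1)) * s + 0 * (M * (2 * V + 2 * s\<^sup>2))"
      by (intro tendsto_intros LIMSEQ_inverse_real_of_nat)
    then show ?thesis
      using tendsto_le[OF sequentially_bot _ tendsto_rabs[OF tendsto_diff[OF AL tendsto_const[of "2 * B"]]] ev]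
      by simp
  qed
  have "\<bar>?L - 2 * B\<bar> \<le> 0"
  proof (rule field_le_epsilon)
    fix \<eta> :: real assume \<eta>: "\<eta> > 0"
    have p: "M * (U + 1) > 0" using M U0 by simp
    then have "\<bar>?L - 2 * B\<bar> \<le> (M * (U + 1)) * (\<eta> / (M * (U + 1)))"
      using \<eta> by (intro key) simp
    also have "\<dots> = \<eta>" proof -
      have "c * (\<eta> / c) = \<eta>" if "c > 0" for c using that by simp
      from this[OF p] show ?thesis .
    qed
    finally show "\<bar>?L - 2 * B\<bar> \<le> 0 + \<eta>" by simp
  qed
  then show ?thesis by (simp add: B_def)
qed

text \<open>A plateau function \<zeta>, equal to 1 on the support of \<phi>, replaces u by u \<zeta>
  and v by v \<zeta> + u \<zeta>', which lie in the unweighted L2 and vanish outside a ball. The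
  weak identity for this pair comes from testing the one for u with \<zeta> \<psi>. \<phi> is taken
  of class C1 because that is what is established for the radial fields used later.\<close>

lemma weak_deriv_square_annulus:
  fixes u v :: "real^'n::finite \<Rightarrow> real"
  assumes w: "has_weak_partial_deriv i u v" and a: "0 < a" "a < R"
    and u: "(\<lambda>x. indicator {x. a / 2 \<le> norm x \<and> norm x \<le> R + 1} x * u x) \<in> L2 lebesgue"
    and v: "(\<lambda>x. indicator {x. a / 2 \<le> norm x \<and> norm x \<le> R + 1} x * v x) \<in> L2 lebesgue"
    and \<phi>: "C_k (Suc 0) \<phi>" "\<And>x. norm x \<le> a \<or> norm x \<ge> R \<Longrightarrow> \<phi> x = 0"
  shows "(\<integral>x. (u x)\<^sup>2 * partial_deriv i \<phi> x \<partial>lebesgue) = - 2 * (\<integral>x. u x * v x * \<phi> x \<partial>lebesgue)"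
proof -
  let ?A = "{x :: real^'n. a / 2 \<le> norm x \<and> norm x \<le> R + 1}"
  obtain \<zeta> :: "real^'n \<Rightarrow> real" where \<zeta>: "test_function \<zeta>" "\<And>x. 0 \<le> \<zeta> x" "\<And>x. \<zeta> x \<le> 1"
    "\<And>x. a \<le> norm x \<Longrightarrow> norm x \<le> R \<Longrightarrow> \<zeta> x = 1"
    "\<And>x. norm x \<le> a / 2 \<or> norm x \<ge> R + 1 \<Longrightarrow> \<zeta> x = 0"
    using annulus_plateau[OF a, where ?'n='n] by metis
  have lu: "locally_integrable u" and lv: "locally_integrable v"
    and wk: "\<And>\<phi>. test_function \<phi> \<Longrightarrow> (\<integral>x. u x * partial_deriv i \<phi> x \<partial>lebesgue) = - (\<integral>x. v x * \<phi> x \<partial>lebesgue)"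
    using w by (auto simp: has_weak_partial_deriv_def)
  define \<zeta>' where "\<zeta>' = partial_deriv i \<zeta>"
  have \<zeta>0: "\<zeta> x = 0" if "norm x > R + 1" for x using \<zeta>(5) that by simp
  have \<zeta>1': "C_k (Suc 0) \<zeta>" by (rule C_k_test[OF \<zeta>(1)])
  have \<zeta>'out: "\<zeta>' x = 0" if "norm x > R + 1" for x
    unfolding \<zeta>'_def by (rule partial_deriv_outside_support[OF \<zeta>0 that])
  have \<zeta>'0: "\<zeta>' x = 0" if "x \<notin> ?A" for x
  proof -
    have o: "open {x :: real^'n. norm x < a / 2}"
      by (intro open_Collect_less continuous_intros)
    show ?thesis
    proof (cases "norm x > R + 1")
      case True
      then show ?thesis by (rule \<zeta>'out)
    next
      case False
      then have "norm x < a / 2" using that by auto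
      then show ?thesis unfolding \<zeta>'_def
        using partial_deriv_eq_0[OF o, of x \<zeta> 0 i] \<zeta>(5) by auto
    qed
  qed
  have \<zeta>0': "C_k 0 \<zeta>'" unfolding \<zeta>'_def by (rule C1_partial_deriv[OF \<zeta>1'])
  obtain L where L0: "L > 0" and L: "\<And>x. \<bar>\<zeta>' x\<bar> \<le> L"
    by (rule C_k_bounded[OF \<zeta>0']) (rule \<zeta>'out, assumption, blast)
  have \<zeta>m: "\<zeta> \<in> borel_measurable lebesgue" by (rule measurable_C_k[OF C_k_test[OF \<zeta>(1)]])
  have \<zeta>'m: "\<zeta>' \<in> borel_measurable lebesgue" unfolding \<zeta>'_def by (rule measurable_C_k[OF C1_partial_deriv[OF \<zeta>1']])
  have \<zeta>1: "\<bar>\<zeta> x\<bar> \<le> 1" for x using \<zeta>(2,3)[of x] by simp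
  define U where "U x = u x * \<zeta> x" for x
  define V where "V x = v x * \<zeta> x + u x * \<zeta>' x" for x
  \<comment> \<open>Inserting the indicator changes nothing, since \<zeta> and its derivative vanish
    off the annulus, but it exhibits a square-integrable factor times a bounded one.\<close>
  have e: "f x * \<zeta> x = (indicator ?A x * f x) * \<zeta> x" "f x * \<zeta>' x = (indicator ?A x * f x) * \<zeta>' x" for f :: "real^'n \<Rightarrow> real" and x
  proof -
    have "\<zeta> x = 0" if "x \<notin> ?A" by (rule \<zeta>(5)) (use that in auto)
    then show "f x * \<zeta> x = (indicator ?A x * f x) * \<zeta> x" "f x * \<zeta>' x = (indicator ?A x * f x) * \<zeta>' x"
      using \<zeta>'0[of x] by (cases "x \<in> ?A"; simp)+
  qed
  have UL: "U \<in> L2 lebesgue"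
    unfolding U_def[abs_def] e(1)[of u] by (rule L2_bounded_mult[OF u \<zeta>m \<zeta>1])
  have VL: "V \<in> L2 lebesgue"
    unfolding V_def[abs_def] e(1)[of v] e(2)[of u]
    by (intro L2_add L2_bounded_mult[OF v \<zeta>m \<zeta>1] L2_bounded_mult[OF u \<zeta>'m L])
  have U0: "U x = 0" and V0: "V x = 0" if "norm x > R + 1" for x
    using \<zeta>0[OF that] \<zeta>'out[OF that] by (auto simp: U_def V_def)
  have UV: "(\<integral>x. U x * partial_deriv i \<psi> x \<partial>lebesgue) = - (\<integral>x. V x * \<psi> x \<partial>lebesgue)"
    if \<psi>: "test_function \<psi>" for \<psi>
  proof -
    obtain S where S: "\<And>x. norm x > S \<Longrightarrow> \<psi> x = 0" using test_function_bound[OF \<psi>] by blast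
    obtain K where K0: "K > 0" and K: "\<And>x. \<bar>\<psi> x\<bar> \<le> K" 
      by (rule C_k_bounded[OF C_k_test[OF \<psi>]]) (rule S, assumption, blast)
    have \<psi>1: "C_k (Suc 0) \<psi>" by (rule C_k_test[OF \<psi>])
    have S': "partial_deriv i \<psi> x = 0" if "norm x > S" for x
      by (rule partial_deriv_outside_support[OF S that])
    obtain K' where K0': "K' > 0" and K': "\<And>x. \<bar>partial_deriv i \<psi> x\<bar> \<le> K'"
      by (rule C_k_bounded[OF C1_partial_deriv[OF \<psi>1, of i]]) (rule S', assumption, blast)
    have \<psi>m: "\<psi> \<in> borel_measurable lebesgue" by (rule measurable_C_k[OF C_k_test[OF \<psi>]])
    have \<psi>'m: "partial_deriv i \<psi> \<in> borel_measurable lebesgue" by (rule measurable_C_k[OF C1_partial_deriv[OF \<psi>1]])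
    have p: "partial_deriv i (\<lambda>x. \<zeta> x * \<psi> x) x = \<zeta> x * partial_deriv i \<psi> x + \<zeta>' x * \<psi> x" for x
      unfolding \<zeta>'_def by (rule partial_deriv_mult[OF C1_differentiable[OF \<zeta>1'] C1_differentiable[OF \<psi>1]])
    have b: "\<bar>\<zeta> x * partial_deriv i \<psi> x\<bar> \<le> 1 * K'" "\<bar>\<zeta>' x * \<psi> x\<bar> \<le> L * K" "\<bar>\<zeta> x * \<psi> x\<bar> \<le> 1 * K" for x
      unfolding abs_mult
      by (intro mult_mono \<zeta>1 K K' L; use L[of x] in linarith)+
    have i: "integrable lebesgue (\<lambda>x. u x * (\<zeta> x * partial_deriv i \<psi> x))"
       "integrable lebesgue (\<lambda>x. u x * (\<zeta>' x * \<psi> x))"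
       "integrable lebesgue (\<lambda>x. v x * (\<zeta> x * \<psi> x))"
      by (rule locally_integrable_mult_bounded[OF lu _ b(1), where R=S]
               locally_integrable_mult_bounded[OF lu _ b(2), where R=S]
               locally_integrable_mult_bounded[OF lv _ b(3), where R=S],
          intro borel_measurable_times \<zeta>m \<zeta>'m \<psi>m \<psi>'m, simp add: S S')+
    have "(\<integral>x. u x * partial_deriv i (\<lambda>x. \<zeta> x * \<psi> x) x \<partial>lebesgue) = - (\<integral>x. v x * (\<zeta> x * \<psi> x) \<partial>lebesgue)"
      using \<psi> by (intro wk test_function_mult[OF \<zeta>(1)] C_k_test)
    moreover have "(\<integral>x. u x * partial_deriv i (\<lambda>x. \<zeta> x * \<psi> x) x \<partial>lebesgue) =
       (\<integral>x. u x * (\<zeta> x * partial_deriv i \<psi> x) \<partial>lebesgue) + (\<integral>x. u x * (\<zeta>' x * \<psi> x) \<partial>lebesgue)"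
      unfolding p using i by (simp add: distrib_left)
    moreover have "(\<integral>x. V x * \<psi> x \<partial>lebesgue) = (\<integral>x. v x * (\<zeta> x * \<psi> x) \<partial>lebesgue) + (\<integral>x. u x * (\<zeta>' x * \<psi> x) \<partial>lebesgue)"
      unfolding V_def using i by (simp add: distrib_right mult.assoc)
    moreover have "(\<integral>x. U x * partial_deriv i \<psi> x \<partial>lebesgue) = (\<integral>x. u x * (\<zeta> x * partial_deriv i \<psi> x) \<partial>lebesgue)"
      unfolding U_def by (simp add: mult.assoc)
    ultimately show ?thesis by linarith
  qed
  have \<phi>0: "\<phi> x = 0" if "norm x > R" for x using \<phi>(2) that by simp
  have "R + 1 > 0" using a by simp
  have main: "(\<integral>x. (U x)\<^sup>2 * partial_deriv i \<phi> x \<partial>lebesgue) = - 2 * (\<integral>x. U x * V x * \<phi> x \<partial>lebesgue)"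
    by (rule weak_deriv_square[OF UL U0 VL V0 \<open>R + 1 > 0\<close> UV \<phi>(1) \<phi>0])
  have "(U x)\<^sup>2 * partial_deriv i \<phi> x = (u x)\<^sup>2 * partial_deriv i \<phi> x" for x
  proof (cases "a \<le> norm x \<and> norm x \<le> R")
    case True
    then show ?thesis using \<zeta>(4) by (simp add: U_def)
  next
    case False
    have o: "open {x :: real^'n. norm x < a}" "open {x :: real^'n. norm x > R}"
      by (intro open_Collect_less continuous_intros)+
    have "partial_deriv i \<phi> x = 0"
      using False partial_deriv_eq_0[OF o(1), of x \<phi> 0 i] partial_deriv_eq_0[OF o(2), of x \<phi> 0 i] \<phi>(2)
      by (cases "norm x < a") auto
    then show ?thesis by simp
  qed
  \<comment> \<open>On the open annulus \<zeta> is locally constant, so its derivative vanishes and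
    V agrees with v; on the bounding spheres and beyond them \<phi> vanishes.\<close>
  moreover have "U x * V x * \<phi> x = u x * v x * \<phi> x" for x
  proof (cases "a < norm x \<and> norm x < R")
    case True
    have "open ({x :: real^'n. a < norm x} \<inter> {x. norm x < R})"
      by (intro open_Int open_Collect_less continuous_intros)
    then have "\<zeta>' x = 0" unfolding \<zeta>'_def
      by (rule partial_deriv_eq_0[where c=1]) (use True \<zeta>(4) in auto)
    then show ?thesis using True \<zeta>(4) by (simp add: U_def V_def)
  next
    case False
    then show ?thesis using \<phi>(2)[of x] by auto
  qed
  ultimately show ?thesis using main by (simp only:)
qed

section \<open>The radial profile and the weight\<close>

lemma real_mult_powr_diff_1: "0 < r \<Longrightarrow> r * r powr (m - 1) = r powr (m::real)"
  using powr_mult_base[of r "m - 1"] by simp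

text \<open>The last inequality says that the radial field \<open>- P(r) x / r^2\<close> is admissible in the
  completion of the square. Near the origin the linear term \<open>A r^m\<close> with \<open>A > \<alpha> b\<close> absorbs the
  contribution \<open>\<alpha> b m r^m\<close> of the exponential, which would otherwise be singular for \<open>m < 2\<close>; away
  from the origin everything is bounded by \<open>C r^2\<close>.\<close>

lemma hardy_profile:
  fixes \<alpha> b m :: real
  assumes \<alpha>: "\<alpha> > 0" and b: "b \<ge> 0" and m: "m > 0"
  obtains P P' C where "C \<ge> 0"
    "\<And>r. r > 0 \<Longrightarrow> (P has_real_derivative P' r) (at r)" "continuous_on {0<..} P'"
    "\<And>r. r > 0 \<Longrightarrow> P r \<ge> 0" "\<And>r. r \<ge> 2 \<Longrightarrow> P r = 0"
    "\<And>r. r > 0 \<Longrightarrow> \<alpha>\<^sup>2 \<le> 2 * \<alpha> * P r - b * m * r powr m * P r + r * P' r - (P r)\<^sup>2 + C * r\<^sup>2"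
proof -
  \<comment> \<open>With this choice A - \<alpha> b = 1, so the gain linear in r^m near the origin
    is exactly m r^m.\<close>
  define A where "A = \<alpha> * b + 1"
  have A: "A > 0" using \<alpha> b by (simp add: A_def add_nonneg_pos)
  define P where "P r = step (2 - r) * (\<alpha> + A * r powr m)" for r
  define P' where "P' r = step (2 - r) * (A * (m * r powr (m - 1))) - step' (2 - r) * (\<alpha> + A * r powr m)" for r
  obtain H where H: "H > 0" "\<And>t. step' t \<le> H" using step'_bounded by blast
  \<comment> \<open>D is the coefficient of the quadratic loss in s = r^m; the expression to be
    estimated equals s (m - D s), which is nonnegative up to s = m / D.\<close>
  define D where "D = A\<^sup>2 + b * m * A"
  have D: "D > 0" using A b m by (simp add: D_def add_pos_nonneg)
  define s0 where "s0 = m / D"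
  have s0: "s0 > 0" using m D by (simp add: s0_def)
  \<comment> \<open>Below r0 two things hold: r < 1, so that \<open>step (2 - r)\<close> is 1, and
    r^m < s0.\<close>
  define r0 where "r0 = min 1 (s0 powr (1 / m))"
  have r0: "r0 > 0" "r0 \<le> 1" using s0 by (auto simp: r0_def)
  define K where "K = \<alpha> + A * 2 powr m"
  have K: "K > 0" using \<alpha> A by (simp add: K_def add_pos_pos)
  \<comment> \<open>Crude bounds on r0 \<le> r < 2 for the terms that may be negative: the one from
    the exponential weight, the derivative of the cut-off, and \<open>(P r)\<^sup>2\<close>.
    \<open>C\<close> is then scaled so that C r^2 covers \<alpha>^2 + B from r0 on.\<close>
  define B where "B = b * m * 2 powr m * K + 2 * (H * K) + K\<^sup>2"
  have B: "B \<ge> 0" using b m K H by (simp add: B_def)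
  define C where "C = (\<alpha>\<^sup>2 + B) / r0\<^sup>2"
  have C: "C \<ge> 0" using B by (simp add: C_def)
  have C': "\<alpha>\<^sup>2 + B \<le> C * r\<^sup>2" if "r0 \<le> r" for r
  proof -
    have "r0\<^sup>2 \<le> r\<^sup>2" using that r0 by (intro power_mono) auto
    then have "C * r0\<^sup>2 \<le> C * r\<^sup>2" using C by (rule mult_left_mono)
    then show ?thesis using r0 by (simp add: C_def)
  qed
  have 1: "(P has_real_derivative P' r) (at r)" if "r > 0" for r
  proof -
    have *: "((\<lambda>r. 2 - r) has_real_derivative - 1) (at r)" by (auto intro!: derivative_eq_intros)
    have s: "((\<lambda>r. step (2 - r)) has_real_derivative - step' (2 - r)) (at r)"
      using DERIV_chain2[of step _ "\<lambda>r. 2 - r", OF step_has_derivative *] by simp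
    have p: "((\<lambda>r. \<alpha> + A * r powr m) has_real_derivative A * (m * r powr (m - 1))) (at r)"
      using that by (auto intro!: derivative_eq_intros)
    show ?thesis
      unfolding P_def P'_def using DERIV_mult[OF s p] by (simp add: algebra_simps)
  qed
  have 2: "continuous_on {0<..} P'"
    unfolding P'_def
    by (intro continuous_on_diff continuous_on_mult continuous_on_add continuous_on_const
          continuous_on_compose2[OF continuous_step[of UNIV], of _ "\<lambda>r. 2 - r"]
          continuous_on_compose2[OF continuous_step'[of UNIV], of _ "\<lambda>r. 2 - r"]
          continuous_on_powr continuous_on_id) auto
  have 3: "P r \<ge> 0" if "r > 0" for r
    using step_nonneg[of "2 - r"] \<alpha> A by (simp add: P_def)
  have 4: "P r = 0" if "r \<ge> 2" for r using that by (simp add: P_def step_eq_0)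
  have 5: "\<alpha>\<^sup>2 \<le> 2 * \<alpha> * P r - b * m * r powr m * P r + r * P' r - (P r)\<^sup>2 + C * r\<^sup>2" if r: "r > 0" for r
  proof -
    define s where "s = r powr m"
    have s: "s > 0" using r by (simp add: s_def)
    have rp: "r * (A * (m * r powr (m - 1))) = A * m * s"
      using real_mult_powr_diff_1[OF r, of m] by (simp add: s_def algebra_simps)
    consider "r < r0" | "r0 \<le> r" "r < 2" | "r \<ge> 2" using r0 by linarith
    then show ?thesis
    proof cases
      case 1
      then have r1: "r < 1" "r < s0 powr (1 / m)" using r0 by (auto simp: r0_def)
      have "s < (s0 powr (1 / m)) powr m"
        unfolding s_def using r r1 m by (intro powr_less_mono2) auto
      then have "s < s0" using s0 m by (simp add: powr_powr)
      then have Ds: "D * s \<le> m" using D by (simp add: s0_def field_simps)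
      have P: "P r = \<alpha> + A * s" and P': "P' r = A * (m * r powr (m - 1))"
        using r1 by (auto simp: P_def P'_def s_def step_eq_1 step'_eq_0)
      have "2 * \<alpha> * P r - b * m * s * P r + r * P' r - (P r)\<^sup>2 - \<alpha>\<^sup>2
          = s * (m * (A - \<alpha> * b) - D * s)"
        unfolding P P' rp by (simp add: D_def power2_eq_square algebra_simps)
      also have "\<dots> = s * (m - D * s)" by (simp add: A_def)
      also have "\<dots> \<ge> 0" using s Ds by simp
      finally have "\<alpha>\<^sup>2 \<le> 2 * \<alpha> * P r - b * m * s * P r + r * P' r - (P r)\<^sup>2" by simp
      moreover have "C * r\<^sup>2 \<ge> 0" using C by simp
      ultimately show ?thesis unfolding s_def by linarith
    next
      case 2
      have s2: "s \<le> 2 powr m" unfolding s_def using 2 r m by (intro powr_mono2) auto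
      have K': "0 \<le> \<alpha> + A * s" "\<alpha> + A * s \<le> K"
        using s2 A \<alpha> s by (auto simp: K_def)
      have "step (2 - r) * (\<alpha> + A * s) \<le> 1 * K"
        using K' step_nonneg step_le_1 by (intro mult_mono) auto
      then have PK: "P r \<le> K" by (simp add: P_def s_def)
      note P0 = 3[OF r]
      have "step' (2 - r) * (\<alpha> + A * s) \<le> H * K"
        using H K' step'_nonneg by (intro mult_mono) auto
      then have "r * (step' (2 - r) * (\<alpha> + A * s)) \<le> 2 * (H * K)"
        by (rule mult_mono[rotated]) (use 2 r K' step'_nonneg[of "2 - r"] in auto)
      moreover have "r * P' r = step (2 - r) * (A * m * s) - r * (step' (2 - r) * (\<alpha> + A * s))"
        unfolding P'_def rp[symmetric] by (simp add: s_def algebra_simps)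
      moreover have "step (2 - r) * (A * m * s) \<ge> 0" using step_nonneg A m s by simp
      ultimately have "r * P' r \<ge> - (2 * (H * K))" by linarith
      moreover have "(P r)\<^sup>2 \<le> K\<^sup>2" using PK P0 by (intro power_mono)
      moreover have "b * m * s * P r \<le> b * m * 2 powr m * K"
        using b m s s2 PK P0 by (intro mult_mono) auto
      moreover have "2 * \<alpha> * P r \<ge> 0" using \<alpha> P0 by simp
      moreover have "\<alpha>\<^sup>2 + B \<le> C * r\<^sup>2" by (rule C') (use 2 in simp)
      ultimately show ?thesis unfolding B_def s_def by linarith
    next
      case 3
      then have "P r = 0" "P' r = 0" by (auto simp: P_def P'_def step_eq_0 step'_eq_0)
      moreover have "\<alpha>\<^sup>2 + B \<le> C * r\<^sup>2" by (rule C') (use 3 r0 in simp)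
      ultimately show ?thesis using B by simp
    qed
  qed
  show thesis by (rule that[OF C 1 2 3 4 5])
qed

section \<open>The radial weight and its L2 space\<close>

definition radial_weight :: "real \<Rightarrow> real \<Rightarrow> real \<Rightarrow> real \<Rightarrow> real" where
  "radial_weight \<beta> b m r = 1 / r powr \<beta> * exp (- b * r powr m)"

text \<open>\<open>0 powr \<beta>\<close> is 0 for every \<beta>, and dividing by it gives 0 again.
  Pointwise identities involving the weight can therefore include the origin.\<close>

lemma radial_weight_0 [simp]: "radial_weight \<beta> b m 0 = 0"
  and radial_weight_nonneg [simp]: "radial_weight \<beta> b m r \<ge> 0"
  and radial_weight_pos: "r > 0 \<Longrightarrow> radial_weight \<beta> b m r > 0"
  by (auto simp: radial_weight_def)

lemma radial_weight_has_derivative: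
  assumes r: "r > 0"
  shows "(radial_weight \<beta> b m has_real_derivative
    radial_weight \<beta> b m r * ((- \<beta> - b * m * r powr m) / r)) (at r)"
proof -
  have "((\<lambda>r. r powr - \<beta> * exp (- b * r powr m)) has_real_derivative
     r powr - \<beta> * exp (- b * r powr m) * ((- \<beta> - b * m * r powr m) / r)) (at r)"
    using r by (auto intro!: derivative_eq_intros simp: powr_diff field_simps)
  then show ?thesis by (simp add: radial_weight_def[abs_def] powr_minus divide_inverse)
qed

lemma continuous_radial_weight: "continuous_on {0<..} (radial_weight \<beta> b m)"
  by (rule continuous_at_imp_continuous_on) (auto intro: DERIV_isCont radial_weight_has_derivative)

lemma radial_weight_measurable [measurable]:
  "(\<lambda>x. radial_weight \<beta> b m (norm x)) \<in> borel_measurable (lebesgue :: 'a::euclidean_space measure)"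
  unfolding radial_weight_def by (intro measurable_completion) measurable

lemma weighted_measure_altdef:
  "weighted_measure \<beta> b m = density lebesgue (\<lambda>x. ennreal (radial_weight \<beta> b m (norm x)))"
  by (simp add: weighted_measure_def radial_weight_def)

lemma measurable_weighted_measure:
  "borel_measurable (weighted_measure \<beta> b m) = borel_measurable lebesgue"
  by (simp add: weighted_measure_altdef cong: measurable_cong_sets)

lemma integrable_weighted_measure:
  fixes f :: "real^'n::finite \<Rightarrow> real"
  assumes "f \<in> borel_measurable lebesgue"
  shows "integrable (weighted_measure \<beta> b m) f \<longleftrightarrow> integrable lebesgue (\<lambda>x. radial_weight \<beta> b m (norm x) * f x)"
  using integrable_density[OF assms radial_weight_measurable] by (simp add: weighted_measure_altdef)

lemma integral_weighted_measure:
  fixes f :: "real^'n::finite \<Rightarrow> real"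
  assumes "f \<in> borel_measurable lebesgue"
  shows "(\<integral>x. f x \<partial>weighted_measure \<beta> b m) = (\<integral>x. radial_weight \<beta> b m (norm x) * f x \<partial>lebesgue)"
  using integral_density[OF assms radial_weight_measurable] by (simp add: weighted_measure_altdef)

lemma L2_weighted_measure:
  fixes u :: "real^'n::finite \<Rightarrow> real"
  shows "u \<in> L2 (weighted_measure \<beta> b m) \<longleftrightarrow>
     u \<in> borel_measurable lebesgue \<and> integrable lebesgue (\<lambda>x. radial_weight \<beta> b m (norm x) * (u x)\<^sup>2)"
  using integrable_weighted_measure[of "\<lambda>x. (u x)\<^sup>2"]
  by (auto simp: L2_iff measurable_weighted_measure)

lemma radial_weight_annulus_bound:
  assumes "0 < a" obtains c where "c > 0" "\<And>r. a \<le> r \<Longrightarrow> r \<le> R \<Longrightarrow> c \<le> radial_weight \<beta> b m r"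
proof (cases "a \<le> R")
  case True
  have "\<exists>x\<in>{a..R}. \<forall>y\<in>{a..R}. radial_weight \<beta> b m x \<le> radial_weight \<beta> b m y"
    by (rule continuous_attains_inf)
       (use True assms in \<open>auto intro: continuous_on_subset[OF continuous_radial_weight]\<close>)
  then obtain x where x: "x \<in> {a..R}" "\<And>y. y \<in> {a..R} \<Longrightarrow> radial_weight \<beta> b m x \<le> radial_weight \<beta> b m y"
    by blast
  show ?thesis by (rule that[of "radial_weight \<beta> b m x"]) (use x assms in \<open>auto intro!: radial_weight_pos\<close>)
next
  case False
  then show ?thesis using that[of 1] by auto
qed

text \<open>On an annulus the weight has a positive lower bound, so the weighted norm controls the
  unweighted one. This fails near the origin for negative \<beta>, and at infinity for b >
  0.\<close>

lemma L2_weighted_annulus: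
  fixes u :: "real^'n::finite \<Rightarrow> real"
  assumes u: "u \<in> L2 (weighted_measure \<beta> b m)" and a: "0 < a"
  shows "(\<lambda>x. indicator {x. a \<le> norm x \<and> norm x \<le> R} x * u x) \<in> L2 lebesgue"
proof -
  let ?A = "{x :: real^'n. a \<le> norm x \<and> norm x \<le> R}"
  have um: "u \<in> borel_measurable lebesgue"
    and ui: "integrable lebesgue (\<lambda>x. radial_weight \<beta> b m (norm x) * (u x)\<^sup>2)"
    using u by (auto simp: L2_weighted_measure)
  obtain c where c: "c > 0" "\<And>r. a \<le> r \<Longrightarrow> r \<le> R \<Longrightarrow> c \<le> radial_weight \<beta> b m r"
    using radial_weight_annulus_bound[OF a] by blast
  have "closed ({x :: real^'n. a \<le> norm x} \<inter> {x. norm x \<le> R})"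
    by (intro closed_Int closed_Collect_le continuous_intros)
  then have A: "?A \<in> sets lebesgue" by (simp add: Collect_conj_eq borel_closed)
  have m: "(\<lambda>x. indicator ?A x * u x) \<in> borel_measurable lebesgue"
    by (intro borel_measurable_times borel_measurable_indicator A um)
  have "integrable lebesgue (\<lambda>x. (indicator ?A x * u x)\<^sup>2)"
  proof (rule Bochner_Integration.integrable_bound)
    show "integrable lebesgue (\<lambda>x. (1 / c) * (radial_weight \<beta> b m (norm x) * (u x)\<^sup>2))"
      by (intro integrable_mult_right ui)
    show "(\<lambda>x. (indicator ?A x * u x)\<^sup>2) \<in> borel_measurable lebesgue"
      by (intro borel_measurable_power m)
    have "(indicator ?A x * u x)\<^sup>2 \<le> (1 / c) * (radial_weight \<beta> b m (norm x) * (u x)\<^sup>2)" for x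
    proof (cases "x \<in> ?A")
      case True
      have "c * (u x)\<^sup>2 \<le> radial_weight \<beta> b m (norm x) * (u x)\<^sup>2"
        using c(2)[of "norm x"] True by (intro mult_right_mono) auto
      then show ?thesis using True c(1) by (simp add: field_simps)
    qed (use c(1) in simp)
    then show "AE x in lebesgue. norm ((indicator ?A x * u x)\<^sup>2) \<le> norm ((1 / c) * (radial_weight \<beta> b m (norm x) * (u x)\<^sup>2))"
      using c(1) by (intro AE_I2) (simp add: abs_mult)
  qed
  with m show ?thesis by (simp add: L2_iff)
qed

section \<open>Radial functions and radial vector fields that vanish near the origin\<close>

lemma radial_C1:
  fixes g g' :: "real \<Rightarrow> real"
  assumes g: "\<And>r. (g has_real_derivative g' r) (at r)" "continuous_on UNIV g'"
    and a: "a > 0" "\<And>r. r < a \<Longrightarrow> g r = 0"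
  shows "C_k (Suc 0) (\<lambda>x::real^'n::finite. g (norm x))"
    and "partial_deriv i (\<lambda>x::real^'n. g (norm x)) x = g' (norm x) * x $ i / norm x"
proof -
  have g'0: "g' r = 0" if "r < a" for r
  proof -
    have "((\<lambda>r. 0) has_real_derivative g' r) (at r)"
      by (rule has_field_derivative_transform_within_open[OF g(1), where S="{..<a}"]) (use that a in auto)
    then show ?thesis using DERIV_unique[OF _ DERIV_const] by blast
  qed
  have d: "((\<lambda>x. g (norm x)) has_derivative (\<lambda>h. g' (norm x) * (h \<bullet> sgn x))) (at x)" for x :: "real^'n"
  proof (cases "x = 0")
    case True
    have "((\<lambda>x::real^'n. 0) has_derivative (\<lambda>h. 0)) (at x)" by simp
    then have "((\<lambda>x::real^'n. g (norm x)) has_derivative (\<lambda>h. 0)) (at x)"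
      by (rule has_derivative_transform_within_open[of _ _ _ _ "ball 0 a"]) (use a True in auto)
    moreover have "g' (norm x) = 0" using True a by (simp add: g'0)
    ultimately show ?thesis by simp
  next
    case False
    from diff_chain_at[OF has_derivative_norm[OF False] g(1)[unfolded has_field_derivative_def]]
    show ?thesis by (simp add: o_def)
  qed
  have e: "partial_deriv i (\<lambda>x::real^'n. g (norm x)) x = g' (norm x) * x $ i / norm x" for i x
    unfolding partial_deriv_eqI[OF d] by (simp add: inner_axis' sgn_div_norm divide_inverse mult_ac)
  show "partial_deriv i (\<lambda>x::real^'n. g (norm x)) x = g' (norm x) * x $ i / norm x" by (rule e)
  have "continuous_on UNIV (partial_deriv i (\<lambda>x::real^'n. g (norm x)))" for i
  proof -
    \<comment> \<open>Since g' vanishes below radius a, raising the denominator to at least a / 2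
      does not change the quotient and makes its continuity at the origin immediate.\<close>
    have "partial_deriv i (\<lambda>x::real^'n. g (norm x)) = (\<lambda>x. g' (norm x) * x $ i / max (norm x) (a / 2))"
    proof
      fix x :: "real^'n"
      show "partial_deriv i (\<lambda>x::real^'n. g (norm x)) x = g' (norm x) * x $ i / max (norm x) (a / 2)"
        using a(1) by (cases "norm x < a") (auto simp: e g'0 max_def)
    qed
    moreover have "continuous_on UNIV (\<lambda>x::real^'n. g' (norm x) * x $ i / max (norm x) (a / 2))"
      using a(1) by (intro continuous_intros continuous_on_compose2[OF g(2)]) auto
    ultimately show ?thesis by simp
  qed
  then show "C_k (Suc 0) (\<lambda>x::real^'n. g (norm x))"
    using d by (auto simp: differentiable_def)
qed

lemma radial_field_C1:
  fixes g g' :: "real \<Rightarrow> real"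
  assumes g: "\<And>r. (g has_real_derivative g' r) (at r)" "continuous_on UNIV g'"
    and a: "a > 0" "\<And>r. r < a \<Longrightarrow> g r = 0"
  shows "C_k (Suc 0) (\<lambda>x::real^'n::finite. x $ i * g (norm x))"
    and "(\<Sum>i\<in>UNIV. partial_deriv i (\<lambda>x::real^'n. x $ i * g (norm x)) x)
        = real CARD('n) * g (norm x) + norm x * g' (norm x)"
proof -
  have b: "bounded_linear (\<lambda>x::real^'n. x $ i)" for i by (rule bounded_linear_vec_nth)
  note r = radial_C1[of g g' a, OF g a, where 'n='n]
  show c: "C_k (Suc 0) (\<lambda>x::real^'n::finite. x $ i * g (norm x))"
    by (intro C_k_mult C_k_bounded_linear[OF b] r(1))
  have "partial_deriv i (\<lambda>x::real^'n. x $ i * g (norm x)) x = g' (norm x) / norm x * (x $ i)\<^sup>2 + g (norm x)" for i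
  proof -
    have "partial_deriv i (\<lambda>x::real^'n. x $ i) x = axis i 1 $ i"
      by (rule partial_deriv_eqI[OF bounded_linear_imp_has_derivative[OF b]])
    moreover have "partial_deriv i (\<lambda>x::real^'n. x $ i * g (norm x)) x =
        x $ i * partial_deriv i (\<lambda>x. g (norm x)) x + partial_deriv i (\<lambda>x. x $ i) x * g (norm x)"
      by (rule partial_deriv_mult)
         (use r(1) C_k_bounded_linear[OF b, of "Suc 0"] in auto)
    ultimately show ?thesis by (simp add: r(2) power2_eq_square)
  qed
  then have "(\<Sum>i\<in>UNIV. partial_deriv i (\<lambda>x::real^'n. x $ i * g (norm x)) x)
      = g' (norm x) / norm x * (\<Sum>i\<in>UNIV. (x $ i)\<^sup>2) + real CARD('n) * g (norm x)"
    by (simp add: sum.distrib sum_distrib_left)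
  also have "(\<Sum>i\<in>UNIV. (x $ i)\<^sup>2) = (norm x)\<^sup>2"
    unfolding power2_norm_eq_inner by (simp add: inner_vec_def power2_eq_square)
  finally show "(\<Sum>i\<in>UNIV. partial_deriv i (\<lambda>x::real^'n. x $ i * g (norm x)) x)
        = real CARD('n) * g (norm x) + norm x * g' (norm x)"
    by (simp add: power2_eq_square)
qed

section \<open>The Hardy inequality\<close>

text \<open>Here \<open>g = W step(k r - 1) P / r^2\<close>. Cutting off at the origin costs nothing: the derivative of the
  cut-off is nonnegative and enters with the good sign.\<close>

lemma hardy_field:
  fixes \<alpha> \<beta> b m :: real
  assumes b: "b \<ge> 0" and m: "m > 0"
    and C: "C \<ge> 0"
    and P: "\<And>r. r > 0 \<Longrightarrow> (P has_real_derivative P' r) (at r)" "continuous_on {0<..} P'"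
      "\<And>r. r > 0 \<Longrightarrow> P r \<ge> 0" "\<And>r. r \<ge> 2 \<Longrightarrow> P r = 0"
      "\<And>r. r > 0 \<Longrightarrow> \<alpha>\<^sup>2 \<le> 2 * \<alpha> * P r - b * m * r powr m * P r + r * P' r - (P r)\<^sup>2 + C * r\<^sup>2"
    and k: "k > (0::real)"
  shows "\<exists>g g'. (\<forall>r. (g has_real_derivative g' r) (at r)) \<and> continuous_on UNIV g' \<and>
    (\<forall>r. r \<le> 1 / k \<or> r \<ge> 2 \<longrightarrow> g r = 0) \<and>
    (\<forall>r>0. \<alpha>\<^sup>2 * (step (k * r - 1) * radial_weight \<beta> b m r) \<le>
      r\<^sup>2 * ((2 * \<alpha> + \<beta> + 2) * g r + r * g' r + C * radial_weight \<beta> b m r - (g r)\<^sup>2 * r\<^sup>2 / radial_weight \<beta> b m r))"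
proof -
  define W where "W = radial_weight \<beta> b m"
  \<comment> \<open>Zero up to radius 1 / k and one from radius 2 / k on.\<close>
  define cut where "cut r = step (k * r - 1)" for r
  define cut' where "cut' r = k * step' (k * r - 1)" for r
  define T where "T r = cut r * P r" for r
  define T' where "T' r = cut r * P' r + cut' r * P r" for r
  define D where "D r = W r * ((- \<beta> - b * m * r powr m) / r)" for r
  \<comment> \<open>The extension by 0 to r \<le> 0 is smooth because the cut-off already makes g
    vanish up to 1 / k; the radial field lemmas ask for derivatives on the whole line.\<close>
  define g where "g r = (if r > 0 then W r * T r / r\<^sup>2 else 0)" for r
  define g' where "g' r = (if r > 0 then ((W r * T' r + D r * T r) * r\<^sup>2 - (W r * T r) * (2 * r)) / (r\<^sup>2 * r\<^sup>2) else 0)" for r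
  have cut0: "cut r = 0" "cut' r = 0" if "r \<le> 1 / k" for r
  proof -
    have "k * r - 1 \<le> 0" using that k by (simp add: field_simps)
    then show "cut r = 0" "cut' r = 0" by (simp_all add: cut_def cut'_def step_eq_0 step'_eq_0)
  qed
  have cutD: "(cut has_real_derivative cut' r) (at r)" for r
  proof -
    have "((\<lambda>r. k * r - 1) has_real_derivative k) (at r)" by (auto intro!: derivative_eq_intros)
    from DERIV_chain2[of step _ "\<lambda>r. k * r - 1", OF step_has_derivative this]
    show ?thesis by (simp add: cut_def[abs_def] cut'_def mult.commute)
  qed
  have TD: "(T has_real_derivative T' r) (at r)" if "r > 0" for r
    unfolding T_def[abs_def] T'_def
    using DERIV_mult[OF cutD P(1)[OF that]] by (simp add: algebra_simps)
  have WD: "(W has_real_derivative D r) (at r)" if "r > 0" for r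
    unfolding W_def D_def using that by (rule radial_weight_has_derivative)
  have W: "W r > 0" if "r > 0" for r unfolding W_def using that by (rule radial_weight_pos)
  have g0: "g r = 0" if "r \<le> 1 / k \<or> r \<ge> 2" for r
    using that cut0(1)[of r] P(4)[of r] by (auto simp: g_def T_def)
  have g'0: "g' r = 0" if "r < 1 / k" for r
    using that cut0[of r] by (simp add: g'_def T_def T'_def)
  have gD: "(g has_real_derivative g' r) (at r)" for r
  proof (cases "r > 0")
    case True
    have r2: "((\<lambda>r. r\<^sup>2) has_real_derivative 2 * r) (at r)" by (auto intro!: derivative_eq_intros)
    have "((\<lambda>r. W r * T r / r\<^sup>2) has_real_derivative g' r) (at r)"
      using DERIV_divide[OF DERIV_mult[OF WD[OF True] TD[OF True]] r2] True
      by (simp add: g'_def add.commute mult.commute)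
    then show ?thesis
      by (rule has_field_derivative_transform_within_open[where S="{0<..}"]) (use True in \<open>auto simp: g_def\<close>)
  next
    case False
    then have "r < 1 / k" using k by (simp add: not_less) (metis divide_pos_pos le_less_trans zero_less_one)
    then have "((\<lambda>r. 0) has_real_derivative g' r) (at r)" by (simp add: g'0)
    then show ?thesis
      by (rule has_field_derivative_transform_within_open[where S="{..<1 / k}"])
         (use \<open>r < 1 / k\<close> g0 in auto)
  qed
  have g'c: "continuous_on UNIV g'"
  proof -
    have cW: "continuous_on {0<..} W" unfolding W_def by (rule continuous_radial_weight)
    have cP: "continuous_on {0<..} P" by (rule continuous_at_imp_continuous_on) (auto intro: DERIV_isCont P(1))
    have ccut: "continuous_on {0<..} cut" by (rule continuous_at_imp_continuous_on) (auto intro: DERIV_isCont cutD)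
    have ccut': "continuous_on {0<..} cut'" unfolding cut'_def
      by (intro continuous_on_mult continuous_on_const continuous_on_compose2[OF continuous_step'[of UNIV], of _ "\<lambda>r. k * r - 1"]
          continuous_on_diff continuous_on_id) auto
    have "continuous_on {0<..} (\<lambda>r. ((W r * T' r + D r * T r) * r\<^sup>2 - (W r * T r) * (2 * r)) / (r\<^sup>2 * r\<^sup>2))"
      unfolding D_def T_def T'_def
      by (intro continuous_on_divide continuous_on_diff continuous_on_mult continuous_on_add continuous_on_minus
            continuous_on_power continuous_on_powr continuous_on_const continuous_on_id cW cP ccut ccut' P(2)) auto
    then have 1: "continuous_on {0<..} g'"
      by (rule continuous_on_eq) (simp add: g'_def)
    have 2: "continuous_on {..<1 / k} g'"
      by (rule continuous_on_eq[OF continuous_on_const[of _ 0]]) (simp add: g'0)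
    have "UNIV = {0<..} \<union> {..<1 / k}" using k by (auto simp: not_less) (metis divide_pos_pos le_less_trans zero_less_one)
    then show ?thesis using continuous_on_open_Un[OF _ _ 1 2] by simp
  qed
  have main: "\<alpha>\<^sup>2 * (cut r * W r) \<le> r\<^sup>2 * ((2 * \<alpha> + \<beta> + 2) * g r + r * g' r + C * W r - (g r)\<^sup>2 * r\<^sup>2 / W r)"
    if r: "r > 0" for r
  proof -
    have cut01: "0 \<le> cut r" "cut r \<le> 1" "0 \<le> cut' r"
      using k by (auto simp: cut_def cut'_def step_nonneg step_le_1 step'_nonneg)
    have "cut r * \<alpha>\<^sup>2 \<le> cut r * (2 * \<alpha> * P r - b * m * r powr m * P r + r * P' r - (P r)\<^sup>2 + C * r\<^sup>2)"
      using P(5)[OF r] cut01 by (intro mult_left_mono) auto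
    \<comment> \<open>Passing from P to T = cut P leaves three remainders: the one with the
      derivative of the cut-off, the one from cut - cut^2, and the one from 1 - cut. All are
      nonnegative and are subtracted.\<close>
    also have "\<dots> = 2 * \<alpha> * T r - b * m * r powr m * T r + r * T' r - (T r)\<^sup>2 + C * r\<^sup>2
       - (r * (cut' r * P r) + cut r * (1 - cut r) * (P r)\<^sup>2 + (1 - cut r) * (C * r\<^sup>2))"
      by (simp add: T_def T'_def power2_eq_square algebra_simps)
    also have "\<dots> \<le> 2 * \<alpha> * T r - b * m * r powr m * T r + r * T' r - (T r)\<^sup>2 + C * r\<^sup>2"
    proof -
      have "0 \<le> r * (cut' r * P r)" "0 \<le> cut r * (1 - cut r) * (P r)\<^sup>2" "0 \<le> (1 - cut r) * (C * r\<^sup>2)"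
        using cut01 r P(3)[OF r] C by simp_all
      then show ?thesis by linarith
    qed
    finally have "W r * (cut r * \<alpha>\<^sup>2) \<le> W r * (2 * \<alpha> * T r - b * m * r powr m * T r + r * T' r - (T r)\<^sup>2 + C * r\<^sup>2)"
      using W[OF r] by (intro mult_left_mono) auto
    \<comment> \<open>In the divergence, 2 \<alpha> + \<beta> + 2 is the dimension. Differentiating
      r^(-\<beta>) and r^(-2) in g removes \<beta> and 2, which leaves the coefficient 2 \<alpha> of
      T.\<close>
    also have "\<dots> = r\<^sup>2 * ((2 * \<alpha> + \<beta> + 2) * g r + r * g' r + C * W r - (g r)\<^sup>2 * r\<^sup>2 / W r)"
    proof -
      have "r\<^sup>2 * g r = W r * T r" using r by (simp add: g_def)
      moreover have "r\<^sup>2 * (r * g' r) = r * (W r * T' r) + (- \<beta> - b * m * r powr m) * (W r * T r) - 2 * (W r * T r)"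
        using r by (simp add: g'_def D_def power2_eq_square field_simps)
      moreover have "r\<^sup>2 * ((g r)\<^sup>2 * r\<^sup>2 / W r) = W r * (T r)\<^sup>2"
        using r W[OF r] by (simp add: g_def power2_eq_square field_simps)
      moreover have "r\<^sup>2 * ((2 * \<alpha> + \<beta> + 2) * g r + r * g' r + C * W r - (g r)\<^sup>2 * r\<^sup>2 / W r)
         = (2 * \<alpha> + \<beta> + 2) * (r\<^sup>2 * g r) + r\<^sup>2 * (r * g' r) + C * r\<^sup>2 * W r - r\<^sup>2 * ((g r)\<^sup>2 * r\<^sup>2 / W r)"
        by (simp only: algebra_simps)
      ultimately show ?thesis by (simp add: algebra_simps)
    qed
    finally show ?thesis by (simp only: mult_ac)
  qed
  show ?thesis
    by (intro exI[of _ g] exI[of _ g'] conjI allI impI gD g'c g0; use main in \<open>simp add: W_def cut_def\<close>)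
qed

text \<open>The field with components G i = x_i g(|x|) is minus the weight times the vector field of
  the completed square, and its divergence is N g + r g'. The weight times |v + (u g / W) x|^2 is
  nonnegative, and integration by parts on the annulus trades the cross term for the divergence. The
  bound does not depend on k.\<close>

lemma hardy_truncated:
  fixes u :: "real^'n::finite \<Rightarrow> real" and v :: "'n \<Rightarrow> real^'n \<Rightarrow> real"
  assumes b: "b \<ge> 0" and m: "m > 0" and \<alpha>: "2 * \<alpha> = real CARD('n) - \<beta> - 2"
    and C: "C \<ge> 0"
    and P: "\<And>r. r > 0 \<Longrightarrow> (P has_real_derivative P' r) (at r)" "continuous_on {0<..} P'"
      "\<And>r. r > 0 \<Longrightarrow> P r \<ge> 0" "\<And>r. r \<ge> 2 \<Longrightarrow> P r = 0"
      "\<And>r. r > 0 \<Longrightarrow> \<alpha>\<^sup>2 \<le> 2 * \<alpha> * P r - b * m * r powr m * P r + r * P' r - (P r)\<^sup>2 + C * r\<^sup>2"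
    and u: "u \<in> L2 (weighted_measure \<beta> b m)" and v: "\<And>i. v i \<in> L2 (weighted_measure \<beta> b m)"
    and w: "\<And>i. has_weak_partial_deriv i u (v i)" and k: "k \<ge> (1::real)"
  defines "F \<equiv> \<lambda>x. \<alpha>\<^sup>2 * (step (k * norm x - 1) * radial_weight \<beta> b m (norm x)) * ((u x)\<^sup>2 / (norm x)\<^sup>2)"
  shows "integrable lebesgue F"
    and "(\<integral>x. F x \<partial>lebesgue) \<le> (\<integral>x. radial_weight \<beta> b m (norm x) * (\<Sum>i\<in>UNIV. (v i x)\<^sup>2) \<partial>lebesgue)
      + C * (\<integral>x. radial_weight \<beta> b m (norm x) * (u x)\<^sup>2 \<partial>lebesgue)"
proof -
  let ?W = "\<lambda>x::real^'n. radial_weight \<beta> b m (norm x)"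
  have k0: "k > 0" using k by simp
  have "\<exists>g g'. (\<forall>r. (g has_real_derivative g' r) (at r)) \<and> continuous_on UNIV g' \<and>
    (\<forall>r. r \<le> 1 / k \<or> r \<ge> 2 \<longrightarrow> g r = 0) \<and>
    (\<forall>r>0. \<alpha>\<^sup>2 * (step (k * r - 1) * radial_weight \<beta> b m r) \<le>
      r\<^sup>2 * ((2 * \<alpha> + \<beta> + 2) * g r + r * g' r + C * radial_weight \<beta> b m r - (g r)\<^sup>2 * r\<^sup>2 / radial_weight \<beta> b m r))"
    by (rule hardy_field[OF b m C P k0])
  then obtain g g' where g: "\<And>r. (g has_real_derivative g' r) (at r)" "continuous_on UNIV g'"
    "\<And>r. r \<le> 1 / k \<or> r \<ge> 2 \<Longrightarrow> g r = 0"
    and main: "\<And>r. r > 0 \<Longrightarrow> \<alpha>\<^sup>2 * (step (k * r - 1) * radial_weight \<beta> b m r) \<le>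
      r\<^sup>2 * ((2 * \<alpha> + \<beta> + 2) * g r + r * g' r + C * radial_weight \<beta> b m r - (g r)\<^sup>2 * r\<^sup>2 / radial_weight \<beta> b m r)"
    by blast
  \<comment> \<open>The annulus 1 / k < r < 2 is nonempty because k \<ge> 1.\<close>
  have a: "0 < 1 / k" "1 / k < 2" using k by (auto simp: field_simps)
  have g0: "g r = 0" if "r < 1 / k" for r using g(3) that by simp
  define G where "G i x = x $ i * g (norm x)" for i and x :: "real^'n"
  have GC: "C_k (Suc 0) (G i)" for i
    unfolding G_def[abs_def] by (rule radial_field_C1(1)[OF g(1,2) a(1) g0])
  have Gdiv: "(\<Sum>i\<in>UNIV. partial_deriv i (G i) x) = real CARD('n) * g (norm x) + norm x * g' (norm x)" for x
    unfolding G_def[abs_def] by (rule radial_field_C1(2)[OF g(1,2) a(1) g0])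
  have G0: "G i x = 0" if "norm x \<le> 1 / k \<or> norm x \<ge> 2" for i x
    using g(3)[OF that] by (simp add: G_def)
  have G0': "G i x = 0" if "norm x > 2" for i x using G0 that by simp
  let ?A = "{x :: real^'n. (1 / k) / 2 \<le> norm x \<and> norm x \<le> 2 + 1}"
  have a2: "0 < (1 / k) / 2" using a by simp
  note uA = L2_weighted_annulus[OF u a2, of "2 + 1"]
  note vA = L2_weighted_annulus[OF v a2, where R="2 + 1"]
  have ibp: "(\<integral>x. (u x)\<^sup>2 * partial_deriv i (G i) x \<partial>lebesgue) = - 2 * (\<integral>x. u x * v i x * G i x \<partial>lebesgue)" for i
    by (rule weak_deriv_square_annulus[OF w a uA vA GC G0])
  have outA: "norm x < 1 / k \<or> norm x > 2" if "x \<notin> ?A" for x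
  proof -
    have "t < e \<or> t > 2" if "\<not> (e / 2 \<le> t \<and> t \<le> 2 + 1)" "0 < e" for e t :: real
      using that by auto
    then show ?thesis using that a(1) unfolding mem_Collect_eq by blast
  qed
  have pG0: "partial_deriv i (G i) x = 0" if "x \<notin> ?A" for i x
  proof -
    have o: "open {x :: real^'n. norm x < 1 / k}" "open {x :: real^'n. norm x > 2}"
      by (intro open_Collect_less continuous_intros)+
    have "norm x < 1 / k \<or> norm x > 2" using that by (rule outA)
    then show ?thesis
      using partial_deriv_eq_0[OF o(1), of x "G i" 0 i] partial_deriv_eq_0[OF o(2), of x "G i" 0 i] G0 by auto
  qed
  have i1: "integrable lebesgue (\<lambda>x. (u x)\<^sup>2 * partial_deriv i (G i) x)" for i
  proof -
    obtain K where K: "K > 0" "\<And>x. \<bar>partial_deriv i (G i) x\<bar> \<le> K"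
      by (rule C_k_bounded[OF C1_partial_deriv[OF GC[of i], of i]])
         (rule partial_deriv_outside_support[OF G0'], assumption, assumption, blast)
    have "integrable lebesgue (\<lambda>x. (indicator ?A x * u x)\<^sup>2 * partial_deriv i (G i) x)"
      by (rule integrable_mult_bounded[OF L2_integrable_square[OF uA] measurable_C_k[OF C1_partial_deriv[OF GC]] K(2)])
    moreover have "(indicator ?A x * u x)\<^sup>2 * partial_deriv i (G i) x = (u x)\<^sup>2 * partial_deriv i (G i) x" for x
      using pG0[of x i] by (cases "x \<in> ?A") auto
    ultimately show ?thesis by (simp only:)
  qed
  have i2: "integrable lebesgue (\<lambda>x. u x * v i x * G i x)" for i
  proof -
    obtain K where K: "K > 0" "\<And>x. \<bar>G i x\<bar> \<le> K"
      by (rule C_k_bounded[OF GC[of i]]) (rule G0', assumption, blast)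
    have "integrable lebesgue (\<lambda>x. (indicator ?A x * u x) * (indicator ?A x * v i x) * G i x)"
      by (rule integrable_mult_bounded[OF L2_integrable_mult[OF uA vA] measurable_C_k[OF GC] K(2)])
    moreover have "(indicator ?A x * u x) * (indicator ?A x * v i x) * G i x = u x * v i x * G i x" for x
    proof (cases "x \<in> ?A")
      case False
      from outA[OF this] have "G i x = 0" by (intro G0) auto
      then show ?thesis by simp
    qed simp
    ultimately show ?thesis by (simp only:)
  qed
  have i3: "integrable lebesgue (\<lambda>x. ?W x * (\<Sum>i\<in>UNIV. (v i x)\<^sup>2))"
    using v by (auto simp: L2_weighted_measure sum_distrib_left)
  have i4: "integrable lebesgue (\<lambda>x. ?W x * (u x)\<^sup>2)"
    using u by (auto simp: L2_weighted_measure)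
  \<comment> \<open>By \<open>ibp\<close> the integrals of the first two summands cancel. They are
    kept in the integrand so that the comparison with F is pointwise, which also yields the
    integrability of F.\<close>
  define R where "R x = (\<Sum>i\<in>UNIV. (u x)\<^sup>2 * partial_deriv i (G i) x) + 2 * (\<Sum>i\<in>UNIV. u x * v i x * G i x)
      + ?W x * (\<Sum>i\<in>UNIV. (v i x)\<^sup>2) + C * (?W x * (u x)\<^sup>2)" for x
  have iR: "integrable lebesgue R"
    unfolding R_def[abs_def]
    by (intro Bochner_Integration.integrable_add Bochner_Integration.integrable_sum integrable_mult_right i1 i2 i3 i4)
  have pw: "F x \<le> R x" for x
  proof (cases "x = 0")
    case True
    have "partial_deriv i (G i) x = 0" for i using pG0[of x] True a by simp
    moreover have "G i x = 0" for i using G0[of x] True a by simp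
    ultimately show ?thesis using True by (simp add: F_def R_def)
  next
    case False
    define r where "r = norm x"
    have r: "r > 0" using False by (simp add: r_def)
    define W where "W = radial_weight \<beta> b m r"
    have W: "W > 0" unfolding W_def using r by (rule radial_weight_pos)
    have N: "real CARD('n) = 2 * \<alpha> + \<beta> + 2" using \<alpha> by simp
    have "F x = \<alpha>\<^sup>2 * (step (k * r - 1) * W) * ((u x)\<^sup>2 / r\<^sup>2)"
      by (simp add: F_def W_def r_def)
    also have "\<dots> \<le> (r\<^sup>2 * ((2 * \<alpha> + \<beta> + 2) * g r + r * g' r + C * W - (g r)\<^sup>2 * r\<^sup>2 / W)) * ((u x)\<^sup>2 / r\<^sup>2)"
      using main[OF r] unfolding W_def by (intro mult_right_mono) auto
    also have "\<dots> = (u x)\<^sup>2 * ((2 * \<alpha> + \<beta> + 2) * g r + r * g' r) + C * (W * (u x)\<^sup>2) - (u x)\<^sup>2 * ((g r)\<^sup>2 * r\<^sup>2 / W)"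
    proof -
      have "(r\<^sup>2 * y) * ((u x)\<^sup>2 / r\<^sup>2) = (u x)\<^sup>2 * y" for y using r by simp
      then show ?thesis by (simp only:) (simp add: algebra_simps)
    qed
    also have "\<dots> \<le> R x"
    proof -
      have q: "(\<Sum>i\<in>UNIV. (x $ i)\<^sup>2) = r\<^sup>2"
        unfolding r_def power2_norm_eq_inner by (simp add: inner_vec_def power2_eq_square)
      \<comment> \<open>The completed square: its cross term is the pairing of u v with G, and its
        last term is the loss quadratic in g.\<close>
      have "0 \<le> (\<Sum>i\<in>UNIV. W * (v i x + u x * g r / W * x $ i)\<^sup>2)"
        using W by (intro sum_nonneg) simp
      also have "\<dots> = (\<Sum>i\<in>UNIV. W * (v i x)\<^sup>2 + 2 * (u x * v i x * G i x) + (u x)\<^sup>2 * (g r)\<^sup>2 / W * (x $ i)\<^sup>2)"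
      proof (rule sum.cong[OF refl])
        fix i
        show "W * (v i x + u x * g r / W * x $ i)\<^sup>2
          = W * (v i x)\<^sup>2 + 2 * (u x * v i x * G i x) + (u x)\<^sup>2 * (g r)\<^sup>2 / W * (x $ i)\<^sup>2"
          using W by (simp add: G_def r_def[symmetric] power2_eq_square field_simps)
      qed
      also have "\<dots> = W * (\<Sum>i\<in>UNIV. (v i x)\<^sup>2) + 2 * (\<Sum>i\<in>UNIV. u x * v i x * G i x) + (u x)\<^sup>2 * (g r)\<^sup>2 / W * r\<^sup>2"
        by (simp add: sum.distrib sum_distrib_left q[symmetric])
      finally have "- ((u x)\<^sup>2 * ((g r)\<^sup>2 * r\<^sup>2 / W)) \<le> W * (\<Sum>i\<in>UNIV. (v i x)\<^sup>2) + 2 * (\<Sum>i\<in>UNIV. u x * v i x * G i x)"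
        by (simp add: mult_ac)
      moreover have "(\<Sum>i\<in>UNIV. (u x)\<^sup>2 * partial_deriv i (G i) x) = (u x)\<^sup>2 * ((2 * \<alpha> + \<beta> + 2) * g r + r * g' r)"
        unfolding sum_distrib_left[symmetric] Gdiv N r_def ..
      ultimately show ?thesis unfolding R_def W_def r_def by linarith
    qed
    finally show ?thesis .
  qed
  have F0: "0 \<le> F x" for x by (simp add: F_def step_nonneg)
  have um: "u \<in> borel_measurable lebesgue" using u by (simp add: L2_weighted_measure)
  have sm: "(\<lambda>x::real^'n. step (k * norm x - 1)) \<in> borel_measurable lebesgue"
    by (intro measurable_completion) (auto intro!: borel_measurable_continuous_onI
          continuous_on_compose2[OF continuous_step[of UNIV], of _ "\<lambda>x. k * norm x - 1"] continuous_intros)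
  have nm: "(\<lambda>x::real^'n. norm x) \<in> borel_measurable lebesgue"
    by (intro measurable_completion) simp
  have Fm: "F \<in> borel_measurable lebesgue" unfolding F_def
    by (intro borel_measurable_times borel_measurable_divide borel_measurable_power borel_measurable_const
          radial_weight_measurable um sm nm)
  show iF: "integrable lebesgue F"
    by (rule Bochner_Integration.integrable_bound[OF iR Fm]) (use pw F0 in \<open>auto intro!: AE_I2 order_trans[OF _ abs_ge_self]\<close>)
  have "(\<integral>x. F x \<partial>lebesgue) \<le> (\<integral>x. R x \<partial>lebesgue)"
    by (rule integral_mono[OF iF iR pw])
  also have "\<dots> = (\<Sum>i\<in>UNIV. \<integral>x. (u x)\<^sup>2 * partial_deriv i (G i) x \<partial>lebesgue)
      + 2 * (\<Sum>i\<in>UNIV. \<integral>x. u x * v i x * G i x \<partial>lebesgue)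
      + (\<integral>x. ?W x * (\<Sum>i\<in>UNIV. (v i x)\<^sup>2) \<partial>lebesgue) + C * (\<integral>x. ?W x * (u x)\<^sup>2 \<partial>lebesgue)"
    unfolding R_def[abs_def]
    by (simp add: Bochner_Integration.integral_add Bochner_Integration.integral_sum
          Bochner_Integration.integrable_add Bochner_Integration.integrable_sum i1 i2 i3 i4)
  also have "(\<Sum>i\<in>UNIV. \<integral>x. (u x)\<^sup>2 * partial_deriv i (G i) x \<partial>lebesgue)
      = - (2 * (\<Sum>i\<in>UNIV. \<integral>x. u x * v i x * G i x \<partial>lebesgue))"
    unfolding ibp by (simp add: sum_distrib_left sum_negf)
  finally show "(\<integral>x. F x \<partial>lebesgue) \<le> (\<integral>x. ?W x * (\<Sum>i\<in>UNIV. (v i x)\<^sup>2) \<partial>lebesgue)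
      + C * (\<integral>x. ?W x * (u x)\<^sup>2 \<partial>lebesgue)" by simp
qed

text \<open>Fatou's lemma yields integrability together with the bound. Both matter, since the
  Bochner integral of a non-integrable function is 0 and a bound on it alone would say
  nothing.\<close>

lemma integral_le_by_approximation:
  fixes f :: "'a \<Rightarrow> real"
  assumes f: "f \<in> borel_measurable M" "\<And>x. f x \<ge> 0"
    and i: "\<And>k::nat. integrable M (\<lambda>x. c k x * f x)" and c: "\<And>k x. c k x \<ge> 0"
    and lim: "\<And>x. x \<in> space M \<Longrightarrow> f x \<noteq> 0 \<Longrightarrow> \<forall>\<^sub>F k in sequentially. c k x = 1"
    and B: "\<And>k. (\<integral>x. c k x * f x \<partial>M) \<le> B" and B0: "B \<ge> 0"
  shows "integrable M f" "(\<integral>x. f x \<partial>M) \<le> B"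
proof -
  have "(\<integral>\<^sup>+x. ennreal (f x) \<partial>M) \<le> (\<integral>\<^sup>+x. liminf (\<lambda>k. ennreal (c k x * f x)) \<partial>M)"
  proof (rule nn_integral_mono)
    fix x assume x: "x \<in> space M"
    have "\<forall>\<^sub>F k in sequentially. ennreal (c k x * f x) = ennreal (f x)"
    proof (cases "f x = 0")
      case False
      show ?thesis using lim[OF x False] by eventually_elim simp
    qed simp
    then have "(\<lambda>k. ennreal (c k x * f x)) \<longlonglongrightarrow> ennreal (f x)" by (rule tendsto_eventually)
    then show "ennreal (f x) \<le> liminf (\<lambda>k. ennreal (c k x * f x))"
      using lim_imp_Liminf[OF sequentially_bot] by (metis order_refl)
  qed
  also have "\<dots> \<le> liminf (\<lambda>k. \<integral>\<^sup>+x. ennreal (c k x * f x) \<partial>M)"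
    by (rule nn_integral_liminf) (use borel_measurable_integrable[OF i] in measurable)
  also have "\<dots> \<le> ennreal B"
  proof (rule Liminf_le)
    show "\<forall>\<^sub>F k in sequentially. (\<integral>\<^sup>+x. ennreal (c k x * f x) \<partial>M) \<le> ennreal B"
    proof (rule always_eventually, rule allI)
      fix k
      have "(\<integral>\<^sup>+x. ennreal (c k x * f x) \<partial>M) = ennreal (\<integral>x. c k x * f x \<partial>M)"
        by (rule nn_integral_eq_integral[OF i]) (use c f(2) in auto)
      also have "\<dots> \<le> ennreal B" using B[of k] by (rule ennreal_leI)
      finally show "(\<integral>\<^sup>+x. ennreal (c k x * f x) \<partial>M) \<le> ennreal B" .
    qed
  qed simp
  finally have *: "(\<integral>\<^sup>+x. ennreal (f x) \<partial>M) \<le> ennreal B" .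
  show i: "integrable M f"
    by (rule integrableI_nonneg[OF f(1)]) (use f(2) * in \<open>auto intro: le_less_trans\<close>)
  have "ennreal (\<integral>x. f x \<partial>M) \<le> ennreal B"
    using * nn_integral_eq_integral[OF i] f(2) by auto
  then show "(\<integral>x. f x \<partial>M) \<le> B" using B0 by (simp add: ennreal_le_iff)
qed

lemma has_weak_partial_deriv_measurable: "has_weak_partial_deriv i u v \<Longrightarrow> v \<in> borel_measurable lebesgue"
  by (simp add: has_weak_partial_deriv_def locally_integrable_measurable)

text \<open>The exceptional null sets of the finitely many components are combined into one.\<close>

lemma weak_gradient_AE:
  assumes "\<And>i. has_weak_partial_deriv i u (v i)"
  shows "AE x in lebesgue. (norm (weak_gradient u x))\<^sup>2 = (\<Sum>i\<in>UNIV. (v i x)\<^sup>2)"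
proof -
  have "AE x in lebesgue. (SOME v. has_weak_partial_deriv i u v) x = v i x" for i
    by (rule has_weak_partial_deriv_unique[OF someI[of "has_weak_partial_deriv i u" "v i", OF assms] assms])
  then have "AE x in lebesgue. \<forall>i. (SOME v. has_weak_partial_deriv i u v) x = v i x"
    by (simp add: AE_all_countable)
  then show ?thesis
  proof eventually_elim
    case (elim x)
    then show ?case
      unfolding power2_norm_eq_inner by (simp add: weak_gradient_def inner_vec_def power2_eq_square)
  qed
qed

lemma integral_weak_gradient:
  fixes u :: "real^'n::finite \<Rightarrow> real"
  assumes w: "\<And>i. has_weak_partial_deriv i u (v i)"
  shows "(\<integral>x. (norm (weak_gradient u x))\<^sup>2 \<partial>weighted_measure \<beta> b m)
    = (\<integral>x. radial_weight \<beta> b m (norm x) * (\<Sum>i\<in>UNIV. (v i x)\<^sup>2) \<partial>lebesgue)"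
proof -
  note AE = weak_gradient_AE[OF w]
  have "v i \<in> borel_measurable lebesgue" for i
    by (rule has_weak_partial_deriv_measurable[OF w])
  then have m: "(\<lambda>x. \<Sum>i\<in>UNIV. (v i x)\<^sup>2) \<in> borel_measurable lebesgue"
    by (intro borel_measurable_sum borel_measurable_power)
  have "(SOME v. has_weak_partial_deriv i u v) \<in> borel_measurable lebesgue" for i
    by (rule has_weak_partial_deriv_measurable[OF someI[of "has_weak_partial_deriv i u" "v i", OF w]])
  then have "(\<lambda>x. \<Sum>i\<in>UNIV. ((SOME v. has_weak_partial_deriv i u v) x)\<^sup>2) \<in> borel_measurable lebesgue"
    by (intro borel_measurable_sum borel_measurable_power)
  then have m': "(\<lambda>x. (norm (weak_gradient u x))\<^sup>2) \<in> borel_measurable lebesgue"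
    unfolding power2_norm_eq_inner by (simp add: weak_gradient_def inner_vec_def power2_eq_square)
  show ?thesis
    unfolding integral_weighted_measure[OF m']
  proof (rule integral_cong_AE)
    show "AE x in lebesgue. radial_weight \<beta> b m (norm x) * (norm (weak_gradient u x))\<^sup>2
        = radial_weight \<beta> b m (norm x) * (\<Sum>i\<in>UNIV. (v i x)\<^sup>2)"
      using AE by eventually_elim simp
  qed (intro borel_measurable_times radial_weight_measurable m m')+
qed

text \<open>The truncated inequality holds with one right-hand side for all cut-off scales
  \<open>Suc k\<close>, and away from the origin each cut-off is eventually 1. The constant C of the
  profile depends only on \<alpha>, b and m, hence it serves all u at once.\<close>

theorem hardy_inequality:
  fixes \<beta> m b :: real
  assumes \<beta>: "\<beta> < real CARD('n) - 2" and m: "m > 0" and b: "b \<ge> 0"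
  shows "\<exists>C\<ge>0. \<forall>u\<in>H1 (weighted_measure \<beta> b m :: (real^'n::finite) measure).
      integrable (weighted_measure \<beta> b m) (\<lambda>x. (u x)\<^sup>2 / (norm x)\<^sup>2) \<and>
      ((real CARD('n) - \<beta> - 2) / 2)\<^sup>2 * (\<integral>x. (u x)\<^sup>2 / (norm x)\<^sup>2 \<partial>weighted_measure \<beta> b m)
        \<le> (\<integral>x. (norm (weak_gradient u x))\<^sup>2 \<partial>weighted_measure \<beta> b m)
          + C * (\<integral>x. (u x)\<^sup>2 \<partial>weighted_measure \<beta> b m)"
proof -
  define \<alpha> where "\<alpha> = (real CARD('n) - \<beta> - 2) / 2"
  have \<alpha>: "\<alpha> > 0" "2 * \<alpha> = real CARD('n) - \<beta> - 2" using \<beta> by (auto simp: \<alpha>_def)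
  obtain P P' C where C: "C \<ge> 0"
    and P: "\<And>r. r > 0 \<Longrightarrow> (P has_real_derivative P' r) (at r)" "continuous_on {0<..} P'"
    "\<And>r. r > 0 \<Longrightarrow> P r \<ge> 0" "\<And>r. r \<ge> 2 \<Longrightarrow> P r = 0"
    "\<And>r. r > 0 \<Longrightarrow> \<alpha>\<^sup>2 \<le> 2 * \<alpha> * P r - b * m * r powr m * P r + r * P' r - (P r)\<^sup>2 + C * r\<^sup>2"
    by (rule hardy_profile[OF \<alpha>(1) b m]) blast
  show ?thesis
    unfolding \<alpha>_def[symmetric]
  proof (intro exI[of _ C] conjI ballI C)
    fix u :: "real^'n \<Rightarrow> real" assume u: "u \<in> H1 (weighted_measure \<beta> b m)"
    let ?W = "\<lambda>x::real^'n. radial_weight \<beta> b m (norm x)"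
    have uL: "u \<in> L2 (weighted_measure \<beta> b m)" using u by (simp add: H1_def)
    have um: "u \<in> borel_measurable lebesgue" using uL by (simp add: L2_weighted_measure)
    from u have "\<forall>i. \<exists>v. v \<in> L2 (weighted_measure \<beta> b m) \<and> has_weak_partial_deriv i u v"
      by (auto simp: H1_def)
    then obtain v where v: "\<And>i. v i \<in> L2 (weighted_measure \<beta> b m)" "\<And>i. has_weak_partial_deriv i u (v i)"
      by metis
    define B where "B = (\<integral>x. ?W x * (\<Sum>i\<in>UNIV. (v i x)\<^sup>2) \<partial>lebesgue) + C * (\<integral>x. ?W x * (u x)\<^sup>2 \<partial>lebesgue)"
    have B0: "B \<ge> 0" unfolding B_def
      by (intro add_nonneg_nonneg mult_nonneg_nonneg C Bochner_Integration.integral_nonneg sum_nonneg) auto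
    define f where "f x = \<alpha>\<^sup>2 * ?W x * ((u x)\<^sup>2 / (norm x)\<^sup>2)" for x
    define c where "c k x = step (real (Suc k) * norm x - 1)" for k and x :: "real^'n"
    have nm: "(\<lambda>x::real^'n. norm x) \<in> borel_measurable lebesgue"
      by (intro measurable_completion) simp
    have qm: "(\<lambda>x. (u x)\<^sup>2 / (norm x)\<^sup>2) \<in> borel_measurable lebesgue"
      by (intro borel_measurable_divide borel_measurable_power um nm)
    have fm: "f \<in> borel_measurable lebesgue"
      unfolding f_def[abs_def]
      by (intro borel_measurable_times borel_measurable_const radial_weight_measurable qm)
    have e: "c k x * f x = \<alpha>\<^sup>2 * (step (real (Suc k) * norm x - 1) * ?W x) * ((u x)\<^sup>2 / (norm x)\<^sup>2)" for k x
      by (simp only: c_def f_def mult_ac)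
    have k1: "1 \<le> real (Suc k)" for k by simp
    have i: "integrable lebesgue (\<lambda>x. c k x * f x)" for k
      unfolding e by (rule hardy_truncated(1)[OF b m \<alpha>(2) C P uL v k1])
    have Bk: "(\<integral>x. c k x * f x \<partial>lebesgue) \<le> B" for k
      unfolding e B_def by (rule hardy_truncated(2)[OF b m \<alpha>(2) C P uL v k1])
    \<comment> \<open>Division by zero gives 0, so \<open>f\<close> vanishes at the origin and only
      points with positive norm have to be considered.\<close>
    have lim: "\<forall>\<^sub>F k in sequentially. c k x = 1" if "f x \<noteq> 0" for x
    proof -
      have x: "norm x > 0" using that by (auto simp: f_def)
      show ?thesis using eventually_ge_at_top[of "nat \<lceil>2 / norm x\<rceil>"]
      proof eventually_elim
        case (elim k)
        then have "2 / norm x \<le> real (Suc k)" by linarith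
        then have "2 \<le> real (Suc k) * norm x" using x by (simp add: pos_divide_le_eq)
        then show ?case unfolding c_def by (intro step_eq_1) simp
      qed
    qed
    have fi: "integrable lebesgue f" and fB: "(\<integral>x. f x \<partial>lebesgue) \<le> B"
      by (rule integral_le_by_approximation[of f lebesgue c B];
          use fm i Bk lim B0 in \<open>auto simp: f_def c_def step_nonneg\<close>)+
    have f': "f x = \<alpha>\<^sup>2 * (?W x * ((u x)\<^sup>2 / (norm x)\<^sup>2))" for x by (simp add: f_def)
    show "integrable (weighted_measure \<beta> b m) (\<lambda>x. (u x)\<^sup>2 / (norm x)\<^sup>2)"
      unfolding integrable_weighted_measure[OF qm]
      using integrable_mult_right[OF fi, of "1 / \<alpha>\<^sup>2"] \<alpha>(1) by (simp add: f'[abs_def])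
    have "\<alpha>\<^sup>2 * (\<integral>x. (u x)\<^sup>2 / (norm x)\<^sup>2 \<partial>weighted_measure \<beta> b m) = (\<integral>x. f x \<partial>lebesgue)"
      unfolding integral_weighted_measure[OF qm] f' by (simp only: integral_mult_right_zero)
    also have "\<dots> \<le> B" by (rule fB)
    also have "B = (\<integral>x. (norm (weak_gradient u x))\<^sup>2 \<partial>weighted_measure \<beta> b m)
          + C * (\<integral>x. (u x)\<^sup>2 \<partial>weighted_measure \<beta> b m)"
      unfolding B_def integral_weak_gradient[OF v(2)]
      using integral_weighted_measure[of "\<lambda>x. (u x)\<^sup>2" \<beta> b m] um by simp
    finally show "\<alpha>\<^sup>2 * (\<integral>x. (u x)\<^sup>2 / (norm x)\<^sup>2 \<partial>weighted_measure \<beta> b m)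
        \<le> (\<integral>x. (norm (weak_gradient u x))\<^sup>2 \<partial>weighted_measure \<beta> b m)
          + C * (\<integral>x. (u x)\<^sup>2 \<partial>weighted_measure \<beta> b m)" .
  qed
qed

section \<open>Optimality of the constant\<close>

lemma lebesgue_integral_scale:
  fixes f :: "'a::euclidean_space \<Rightarrow> real"
  assumes f: "f \<in> borel_measurable lebesgue" and c: "c > 0"
  shows "(\<integral>x. f x \<partial>lebesgue) = c ^ DIM('a) * (\<integral>x. f (c *\<^sub>R x) \<partial>lebesgue)"
proof -
  have T: "(\<lambda>x::'a. 0 + (\<Sum>j\<in>Basis. (c * (x \<bullet> j)) *\<^sub>R j)) = (\<lambda>x. c *\<^sub>R x)"
    unfolding scaleR_scaleR[symmetric] scaleR_sum_right[symmetric] by (simp add: euclidean_representation)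
  have m: "(\<lambda>x::'a. c *\<^sub>R x) \<in> lebesgue \<rightarrow>\<^sub>M lebesgue"
    using lebesgue_affine_measurable[of "\<lambda>_. c" 0] c unfolding T by simp
  have "(lebesgue :: 'a measure) = density (distr lebesgue lebesgue (\<lambda>x. c *\<^sub>R x)) (\<lambda>_. ennreal (c ^ DIM('a)))"
    using lebesgue_affine_euclidean[of "\<lambda>_::'a. c" 0] c unfolding T by simp
  then have "(\<integral>x. f x \<partial>lebesgue) =
      (\<integral>x. f x \<partial>density (distr lebesgue lebesgue (\<lambda>x. c *\<^sub>R x)) (\<lambda>_. ennreal (c ^ DIM('a))))"
    by (rule arg_cong)
  also have "\<dots> = (\<integral>x. c ^ DIM('a) *\<^sub>R f x \<partial>distr lebesgue lebesgue (\<lambda>x. c *\<^sub>R x))"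
    by (rule integral_density) (use f c in auto)
  also have "\<dots> = c ^ DIM('a) * (\<integral>x. f (c *\<^sub>R x) \<partial>lebesgue)"
    using f by (subst integral_distr[OF m]) auto
  finally show ?thesis .
qed

text \<open>Logarithmic radii turn dilations into shifts of the two parameters; half-open shells
  join without overlap.\<close>

definition shell :: "real \<Rightarrow> real \<Rightarrow> 'a::euclidean_space set" where
  "shell a b = {x. exp a \<le> norm x \<and> norm x < exp b}"

text \<open>The exponent \<open>- DIM('a)\<close> makes the mass of a shell invariant under dilations.\<close>

definition shell_density :: "real \<Rightarrow> real \<Rightarrow> 'a::euclidean_space \<Rightarrow> real" where
  "shell_density a b x = indicator (shell a b) x * norm x powr - real DIM('a)"

lemma shell_density_nonneg: "shell_density a b x \<ge> 0"
  by (simp add: shell_density_def)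

lemma shell_density_measurable:
  "(shell_density a b :: 'a::euclidean_space \<Rightarrow> real) \<in> borel_measurable lebesgue"
proof -
  have "shell a b \<in> sets (borel :: 'a measure)"
    unfolding shell_def by measurable
  then show ?thesis
    unfolding shell_density_def by (intro measurable_completion) simp
qed

lemma shell_density_integrable: "integrable lebesgue (shell_density a b :: 'a::euclidean_space \<Rightarrow> real)"
proof (rule integrable_bounded_support[OF shell_density_measurable])
  fix x :: 'a
  show "\<bar>shell_density a b x\<bar> \<le> exp a powr - real DIM('a)"
  proof (cases "x \<in> shell a b")
    case True
    then have "norm x powr - real DIM('a) \<le> exp a powr - real DIM('a)"
      by (intro powr_mono2') (auto simp: shell_def)
    then show ?thesis by (simp add: shell_density_def True)
  qed (simp add: shell_density_def)
  show "norm x > exp b \<Longrightarrow> shell_density a b x = 0"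
    by (simp add: shell_density_def shell_def)
qed

text \<open>Dilation by exp t has Jacobian exp(t N), which cancels the homogeneity of degree
  -N.\<close>

lemma integral_shell_density_shift:
  "integral\<^sup>L (lebesgue :: 'a::euclidean_space measure) (shell_density (a + t) (b + t)) = integral\<^sup>L (lebesgue :: 'a measure) (shell_density a b)"
proof -
  have "shell_density (a + t) (b + t) (exp t *\<^sub>R x) = exp t powr - real DIM('a) * shell_density a b x" for x :: 'a
  proof -
    have "exp t *\<^sub>R x \<in> shell (a + t) (b + t) \<longleftrightarrow> x \<in> shell a b"
      by (simp add: shell_def exp_add mult.commute[of _ "exp t"])
    then show ?thesis by (simp add: shell_density_def powr_mult indicator_def)
  qed
  then have "integral\<^sup>L (lebesgue :: 'a measure) (shell_density (a + t) (b + t))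
      = exp t ^ DIM('a) * exp t powr - real DIM('a) * integral\<^sup>L (lebesgue :: 'a measure) (shell_density a b)"
    using lebesgue_integral_scale[OF shell_density_measurable, of "exp t" "a + t" "b + t", where 'a='a] by simp
  also have "exp t ^ DIM('a) * exp t powr - real DIM('a) = 1"
    by (simp add: powr_minus powr_realpow)
  finally show ?thesis by simp
qed

lemma integral_shell_density_add:
  assumes "a \<le> b" "b \<le> c"
  shows "integral\<^sup>L (lebesgue :: 'a::euclidean_space measure) (shell_density a c)
    = integral\<^sup>L (lebesgue :: 'a measure) (shell_density a b) + integral\<^sup>L (lebesgue :: 'a measure) (shell_density b c)"
proof -
  have "exp a \<le> exp b" "exp b \<le> exp c" using assms by auto
  then have "shell_density a c x = shell_density a b x + shell_density b c x" for x :: 'a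
    by (auto simp: shell_density_def shell_def indicator_def simp del: exp_le_cancel_iff)
  then have "(shell_density a c :: 'a \<Rightarrow> real) = (\<lambda>x. shell_density a b x + shell_density b c x)"
    by (rule ext)
  then show ?thesis by (simp add: shell_density_integrable)
qed

text \<open>A vanishing integral would make the interior of the shell negligible, but it is a
  nonempty open set.\<close>

lemma integral_shell_density_pos:
  assumes "a < b"
  shows "integral\<^sup>L (lebesgue :: 'a::euclidean_space measure) (shell_density a b) > 0"
proof (rule ccontr)
  have nn: "integral\<^sup>L (lebesgue :: 'a measure) (shell_density a b) \<ge> 0"
    by (intro Bochner_Integration.integral_nonneg shell_density_nonneg)
  assume "\<not> ?thesis"
  with nn have "integral\<^sup>L (lebesgue :: 'a measure) (shell_density a b) = 0" by simp
  then have ae: "AE x in lebesgue. shell_density a b (x::'a) = 0"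
    by (subst (asm) integral_nonneg_eq_0_iff_AE[OF shell_density_integrable]) (auto simp: shell_density_nonneg)
  let ?S = "{x::'a. exp a < norm x} \<inter> {x. norm x < exp b}"
  have "AE x in lebesgue. x \<notin> ?S"
    using ae by eventually_elim (auto simp: shell_density_def shell_def indicator_def split: if_splits)
  then have "negligible ?S"
    by (auto simp: eventually_ae_filter_negligible intro: negligible_subset)
  moreover have "open ?S" by (intro open_Int open_Collect_less continuous_intros)
  moreover have "?S \<noteq> {}"
  proof -
    obtain e :: 'a where e: "e \<in> Basis" using nonempty_Basis by blast
    have "exp ((a + b) / 2) *\<^sub>R e \<in> ?S" using assms e by (simp add: norm_Basis)
    then show ?thesis by blast
  qed
  ultimately show False using open_not_negligible by blast
qed

lemma integrable_radial_weight_mult: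
  fixes f :: "real^'n::finite \<Rightarrow> real"
  assumes f: "f \<in> borel_measurable lebesgue" "\<And>x. \<bar>f x\<bar> \<le> K" "\<And>x. norm x < a \<or> norm x > R \<Longrightarrow> f x = 0"
    and a: "a > 0"
  shows "integrable lebesgue (\<lambda>x. radial_weight \<beta> b m (norm x) * f x)"
proof -
  have "compact (radial_weight \<beta> b m ` {a..R})"
    by (rule compact_continuous_image[OF _ compact_Icc])
       (rule continuous_on_subset[OF continuous_radial_weight], use a in auto)
  then have "bounded (radial_weight \<beta> b m ` {a..R})" by (rule compact_imp_bounded)
  then obtain B where B: "B > 0" "\<And>y. y \<in> radial_weight \<beta> b m ` {a..R} \<Longrightarrow> \<bar>y\<bar> \<le> B"
    unfolding bounded_pos real_norm_def by blast
  show ?thesis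
  proof (rule integrable_bounded_support[where R=R and K="B * K"])
    show "(\<lambda>x. radial_weight \<beta> b m (norm x) * f x) \<in> borel_measurable lebesgue"
      by (intro borel_measurable_times radial_weight_measurable f(1))
    have K: "K \<ge> 0" using f(2)[of 0] by simp
    show "\<bar>radial_weight \<beta> b m (norm x) * f x\<bar> \<le> B * K" if "norm x \<le> R" for x
    proof (cases "norm x < a")
      case True
      then show ?thesis using f(3) B(1) K by simp
    next
      case False
      then have "\<bar>radial_weight \<beta> b m (norm x)\<bar> \<le> B" using that by (intro B(2)) auto
      then show ?thesis unfolding abs_mult using f(2)[of x] B(1) by (intro mult_mono) auto
    qed
    show "radial_weight \<beta> b m (norm x) * f x = 0" if "norm x > R" for x using f(3) that by simp
  qed
qed

lemma locally_integrableI: "integrable lebesgue f \<Longrightarrow> locally_integrable f"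
  unfolding locally_integrable_def set_integrable_def
  by (intro allI impI integrable_mult_indicator) (auto intro: fmeasurableD lmeasurable_compact)

text \<open>The product of u with a test function is C1 and vanishes outside a ball, so its partial
  derivative has integral zero; the product rule splits it.\<close>

lemma C1_has_weak_partial_deriv:
  fixes u :: "real^'n::finite \<Rightarrow> real"
  assumes u: "C_k (Suc 0) u" "\<And>x. norm x > R \<Longrightarrow> u x = 0"
  shows "has_weak_partial_deriv i u (partial_deriv i u)"
  unfolding has_weak_partial_deriv_def
proof (intro conjI allI impI)
  note u' = C1_partial_deriv[OF u(1)]
  have u'0: "partial_deriv i u x = 0" if "norm x > R" for x
    by (rule partial_deriv_outside_support[OF u(2) that])
  have iu: "integrable lebesgue u" by (rule C_k_integrable_L2(1)[OF u])
  have iu': "integrable lebesgue (partial_deriv i u)" by (rule C_k_integrable_L2(1)[OF u' u'0])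
  show "locally_integrable u" "locally_integrable (partial_deriv i u)"
    using iu iu' by (auto intro: locally_integrableI)
  fix \<psi> :: "real^'n \<Rightarrow> real" assume \<psi>: "test_function \<psi>"
  have \<psi>1: "C_k (Suc 0) \<psi>" by (rule C_k_test[OF \<psi>])
  have i: "integrable lebesgue (\<lambda>x. u x * partial_deriv i \<psi> x)" "integrable lebesgue (\<lambda>x. partial_deriv i u x * \<psi> x)"
    by (rule C_k_integrable_L2(1)[where R=R and k=0], rule C_k_mult,
        use C_k_Suc_imp[OF u(1)] C_k_Suc_imp[OF \<psi>1] u' C1_partial_deriv[OF \<psi>1] u(2) u'0 in auto)+
  have p: "partial_deriv i (\<lambda>x. u x * \<psi> x) x = u x * partial_deriv i \<psi> x + partial_deriv i u x * \<psi> x" for x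
    by (rule partial_deriv_mult[OF C1_differentiable[OF u(1)] C1_differentiable[OF \<psi>1]])
  have "(\<integral>x. partial_deriv i (\<lambda>x. u x * \<psi> x) x \<partial>lebesgue) = 0"
    by (rule integral_partial_deriv_eq_0[OF C_k_mult[OF u(1) \<psi>1], of R]) (simp add: u(2))
  then show "(\<integral>x. u x * partial_deriv i \<psi> x \<partial>lebesgue) = - (\<integral>x. partial_deriv i u x * \<psi> x \<partial>lebesgue)"
    unfolding p using i by simp
qed

lemma C1_L2_weighted:
  fixes f :: "real^'n::finite \<Rightarrow> real"
  assumes f: "C_k k f" "\<And>x. norm x < a \<or> norm x > R \<Longrightarrow> f x = 0" and a: "a > 0"
  shows "f \<in> L2 (weighted_measure \<beta> b m)"
proof -
  have fR: "f x = 0" if "norm x > R" for x using f(2) that by simp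
  obtain K where K: "K > 0" "\<And>x. \<bar>f x\<bar> \<le> K"
    by (rule C_k_bounded[OF f(1)]) (rule fR, assumption, blast)
  have m: "f \<in> borel_measurable lebesgue" by (rule measurable_C_k[OF f(1)])
  have "integrable lebesgue (\<lambda>x. radial_weight \<beta> b m (norm x) * (f x)\<^sup>2)"
  proof (rule integrable_radial_weight_mult[where K="K\<^sup>2" and R=R, OF _ _ _ a])
    show "\<bar>(f x)\<^sup>2\<bar> \<le> K\<^sup>2" for x using power_mono[OF K(2)[of x], of 2] by simp
  qed (use m f(2) in auto)
  with m show ?thesis by (simp add: L2_weighted_measure)
qed

text \<open>Support in an annulus, where the weight is bounded, gives membership for every choice of
  the weight parameters; the length of the gradient is |f'|.\<close>

lemma C1_radial_H1:
  fixes f f' :: "real \<Rightarrow> real"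
  assumes f: "\<And>r. (f has_real_derivative f' r) (at r)" "continuous_on UNIV f'"
    and a: "a > 0" "\<And>r. r < a \<or> r > R \<Longrightarrow> f r = 0"
  defines "u \<equiv> \<lambda>x::real^'n::finite. f (norm x)"
  shows "u \<in> H1 (weighted_measure \<beta> b m)"
    and "(\<integral>x. (norm (weak_gradient u x))\<^sup>2 \<partial>weighted_measure \<beta> b m)
      = (\<integral>x. radial_weight \<beta> b m (norm x) * (f' (norm x))\<^sup>2 \<partial>(lebesgue :: (real^'n) measure))"
proof -
  have fa: "f r = 0" if "r < a" for r using a(2) that by simp
  have uC: "C_k (Suc 0) u" unfolding u_def by (rule radial_C1(1)[OF f a(1) fa])
  have pu: "partial_deriv i u x = f' (norm x) * x $ i / norm x" for i x
    unfolding u_def by (rule radial_C1(2)[OF f a(1) fa])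
  have u0: "u x = 0" if "norm x < a \<or> norm x > R" for x using a(2)[OF that] by (simp add: u_def)
  have uR: "u x = 0" if "norm x > R" for x using u0 that by simp
  have pu0: "partial_deriv i u x = 0" if "norm x < a \<or> norm x > R" for i x
  proof -
    have "open {x :: real^'n. norm x < a}" "open {x :: real^'n. norm x > R}"
      by (intro open_Collect_less continuous_intros)+
    from partial_deriv_eq_0[OF this(1), of x u 0 i] partial_deriv_eq_0[OF this(2), of x u 0 i]
    show ?thesis using that u0 by auto
  qed
  have w: "has_weak_partial_deriv i u (partial_deriv i u)" for i
    by (rule C1_has_weak_partial_deriv[OF uC uR])
  have "u \<in> L2 (weighted_measure \<beta> b m)" by (rule C1_L2_weighted[OF uC u0 a(1)])
  moreover have "partial_deriv i u \<in> L2 (weighted_measure \<beta> b m)" for i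
    by (rule C1_L2_weighted[OF C1_partial_deriv[OF uC] pu0 a(1)])
  ultimately show "u \<in> H1 (weighted_measure \<beta> b m)"
    using w by (auto simp: H1_def)
  have "radial_weight \<beta> b m (norm x) * (\<Sum>i\<in>UNIV. (partial_deriv i u x)\<^sup>2)
      = radial_weight \<beta> b m (norm x) * (f' (norm x))\<^sup>2" for x :: "real^'n"
  proof (cases "x = 0")
    case False
    have q: "(\<Sum>i\<in>UNIV. (x $ i)\<^sup>2) = (norm x)\<^sup>2"
      unfolding power2_norm_eq_inner by (simp add: inner_vec_def power2_eq_square)
    have "(\<Sum>i\<in>UNIV. (partial_deriv i u x)\<^sup>2) = (f' (norm x) / norm x)\<^sup>2 * (\<Sum>i\<in>UNIV. (x $ i)\<^sup>2)"
      unfolding pu sum_distrib_left by (intro sum.cong) (auto simp: power_mult_distrib power_divide)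
    also have "\<dots> = (f' (norm x))\<^sup>2" unfolding q using False by (simp add: power_divide)
    finally show ?thesis by simp
  qed simp
  then show "(\<integral>x. (norm (weak_gradient u x))\<^sup>2 \<partial>weighted_measure \<beta> b m)
      = (\<integral>x. radial_weight \<beta> b m (norm x) * (f' (norm x))\<^sup>2 \<partial>(lebesgue :: (real^'n) measure))"
    unfolding integral_weak_gradient[OF w] by (simp only:)
qed

text \<open>The critical power \<open>r powr - \<alpha>\<close> is cut off in the variable \<open>ln r / n\<close>: this costs only
  \<open>O(1 / n^2)\<close> relative to the potential energy.\<close>

lemma critical_profile:
  fixes \<alpha> n :: real
  assumes n: "n > 0" and H: "\<And>t. step' t \<le> H"
  shows "\<exists>f f' \<kappa>. (\<forall>r. (f has_real_derivative f' r) (at r)) \<and> continuous_on UNIV f' \<and>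
    (\<forall>r. r < exp (- 4 * n) \<or> r \<ge> exp (- n) \<longrightarrow> f r = 0 \<and> f' r = 0 \<and> \<kappa> r = 0) \<and>
    (\<forall>r>0. f r = r powr - \<alpha> * \<kappa> r) \<and>
    (\<forall>r>0. \<forall>d>0.
      (f' r)\<^sup>2 \<le> r powr (- 2 * \<alpha> - 2) * ((1 + d) * \<alpha>\<^sup>2 * (\<kappa> r)\<^sup>2 + (1 + 1 / d) * (2 * H)\<^sup>2 / n\<^sup>2)) \<and>
    (\<forall>r. 0 \<le> \<kappa> r \<and> \<kappa> r \<le> 1) \<and>
    (\<forall>r. exp (- 3 * n) \<le> r \<longrightarrow> r < exp (- 2 * n) \<longrightarrow> \<kappa> r = 1)"
proof -
  \<comment> \<open>A bump on the logarithmic scale: it rises on [-4, -3], equals 1 on [-3, -2] and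
    falls on [-2, -1].\<close>
  define k where "k t = step (t + 4) * step (- 1 - t)" for t
  define k' where "k' t = step' (t + 4) * step (- 1 - t) - step (t + 4) * step' (- 1 - t)" for t
  have kD: "(k has_real_derivative k' t) (at t)" for t
  proof -
    have 1: "((\<lambda>t. t + 4) has_real_derivative 1) (at t)" "((\<lambda>t. - 1 - t) has_real_derivative - 1) (at t)"
      by (auto intro!: derivative_eq_intros)
    have "((\<lambda>t. step (t + 4)) has_real_derivative step' (t + 4)) (at t)"
      "((\<lambda>t. step (- 1 - t)) has_real_derivative - step' (- 1 - t)) (at t)"
      using DERIV_chain2[of step _ "\<lambda>t. t + 4", OF step_has_derivative 1(1)]
            DERIV_chain2[of step _ "\<lambda>t. - 1 - t", OF step_has_derivative 1(2)] by auto
    from DERIV_mult[OF this] show ?thesis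
      unfolding k_def[abs_def] k'_def by (simp add: algebra_simps)
  qed
  have k'c: "continuous_on S k'" for S
    unfolding k'_def
    by (intro continuous_on_diff continuous_on_mult
          continuous_on_compose2[OF continuous_step[of UNIV], of _ "\<lambda>r. r + 4"]
          continuous_on_compose2[OF continuous_step'[of UNIV], of _ "\<lambda>r. r + 4"]
          continuous_on_compose2[OF continuous_step[of UNIV], of _ "\<lambda>r. - 1 - r"]
          continuous_on_compose2[OF continuous_step'[of UNIV], of _ "\<lambda>r. - 1 - r"]
          continuous_intros) auto
  have kc: "continuous_on S k" for S
    by (rule continuous_at_imp_continuous_on) (auto intro: DERIV_isCont kD)
  have k0: "k t = 0" "k' t = 0" if "t \<le> - 4 \<or> t \<ge> - 1" for t
    using that by (auto simp: k_def k'_def step_eq_0 step'_eq_0)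
  have k1: "k t = 1" if "- 3 \<le> t" "t \<le> - 2" for t
    using that by (simp add: k_def step_eq_1)
  have k01: "0 \<le> k t" "k t \<le> 1" for t
    using step_nonneg step_le_1 by (auto simp: k_def intro!: mult_le_one)
  have H0: "H \<ge> 0" using H[of 0] step'_nonneg[of 0] by simp
  have k'H: "\<bar>k' t\<bar> \<le> 2 * H" for t
  proof -
    have "step' (t + 4) * step (- 1 - t) \<le> H * 1" "step (t + 4) * step' (- 1 - t) \<le> 1 * H"
      using H H0 step_nonneg step_le_1 step'_nonneg by (intro mult_mono; simp)+
    moreover have "0 \<le> step' (t + 4) * step (- 1 - t)" "0 \<le> step (t + 4) * step' (- 1 - t)"
      using step_nonneg step'_nonneg by simp_all
    ultimately show ?thesis unfolding k'_def by linarith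
  qed
  define \<kappa> where "\<kappa> r = (if r > 0 then k (ln r / n) else 0)" for r
  define f where "f r = (if r > 0 then r powr - \<alpha> * k (ln r / n) else 0)" for r
  \<comment> \<open>Both terms of the product rule carry r^(-\<alpha> - 1); differentiating ln r / n
    contributes the factor 1 / n to the cut-off term.\<close>
  define f' where "f' r = (if r > 0 then r powr (- \<alpha> - 1) * (k' (ln r / n) / n - \<alpha> * k (ln r / n)) else 0)" for r
  have out: "ln r / n \<le> - 4 \<or> ln r / n \<ge> - 1" if "r < exp (- 4 * n) \<or> r \<ge> exp (- n)" "r > 0" for r
  proof -
    have "ln r < - 4 * n \<or> ln r \<ge> - n"
      using that by (metis exp_ln exp_less_cancel_iff exp_le_cancel_iff)
    then show ?thesis using n by (auto simp: field_simps)
  qed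
  have f0: "f r = 0" "f' r = 0" "\<kappa> r = 0" if "r < exp (- 4 * n) \<or> r \<ge> exp (- n)" for r
    using k0[OF out[OF that]] by (auto simp: f_def f'_def \<kappa>_def)
  have fD: "(f has_real_derivative f' r) (at r)" for r
  proof (cases "r > 0")
    case True
    have l: "((\<lambda>r. ln r / n) has_real_derivative 1 / (r * n)) (at r)"
      using True n by (auto intro!: derivative_eq_intros)
    have p: "((\<lambda>r. r powr - \<alpha>) has_real_derivative - \<alpha> * r powr (- \<alpha> - 1)) (at r)"
      using True by (auto intro!: derivative_eq_intros)
    have e: "r powr - \<alpha> = r powr (- \<alpha> - 1) * r" using True real_mult_powr_diff_1[of r "- \<alpha>"] by (simp add: mult.commute)
    have "((\<lambda>r. r powr - \<alpha> * k (ln r / n)) has_real_derivative f' r) (at r)"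
      using DERIV_mult[OF p DERIV_chain2[of k _ "\<lambda>r. ln r / n", OF kD l]] True n
      by (simp add: f'_def e field_simps)
    then show ?thesis
      by (rule has_field_derivative_transform_within_open[where S="{0<..}"]) (use True in \<open>auto simp: f_def\<close>)
  next
    case False
    then have r: "r < exp (- 4 * n)" using exp_gt_zero[of "- 4 * n"] by linarith
    then have "((\<lambda>r. 0) has_real_derivative f' r) (at r)" by (simp add: f0)
    then show ?thesis
      by (rule has_field_derivative_transform_within_open[where S="{..<exp (- 4 * n)}"])
         (use r f0 in auto)
  qed
  have f'c: "continuous_on UNIV f'"
  proof -
    have "continuous_on {0<..} (\<lambda>r. r powr (- \<alpha> - 1) * (k' (ln r / n) / n - \<alpha> * k (ln r / n)))"
      using n
      by (intro continuous_on_mult continuous_on_diff continuous_on_divide continuous_on_powr continuous_on_const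
          continuous_on_id continuous_on_compose2[OF k'c[of UNIV], of _ "\<lambda>r. ln r / n"]
          continuous_on_compose2[OF kc[of UNIV], of _ "\<lambda>r. ln r / n"] continuous_on_ln) auto
    then have 1: "continuous_on {0<..} f'"
      by (rule continuous_on_eq) (simp add: f'_def)
    have 2: "continuous_on {..<exp (- 4 * n)} f'"
      by (rule continuous_on_eq[OF continuous_on_const[of _ 0]]) (simp add: f0)
    have "r \<in> {0<..} \<union> {..<exp (- 4 * n)}" for r
      using exp_gt_zero[of "- 4 * n"] by (cases "r > 0") (simp, simp only: Un_iff lessThan_iff, linarith)
    then have "UNIV = {0<..} \<union> {..<exp (- 4 * n)}" by blast
    then show ?thesis using continuous_on_open_Un[OF _ _ 1 2] by simp
  qed
  have est: "(f' r)\<^sup>2 \<le> r powr (- 2 * \<alpha> - 2) * ((1 + d) * \<alpha>\<^sup>2 * (\<kappa> r)\<^sup>2 + (1 + 1 / d) * (2 * H)\<^sup>2 / n\<^sup>2)"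
    if r: "r > 0" and d: "d > 0" for r d
  proof -
    define x y where "x = \<alpha> * \<kappa> r" and "y = k' (ln r / n) / n"
    have "(r powr (- \<alpha> - 1))\<^sup>2 = r powr (- 2 * \<alpha> - 2)"
      by (simp add: power2_eq_square powr_add[symmetric])
    then have "(f' r)\<^sup>2 = r powr (- 2 * \<alpha> - 2) * (y - x)\<^sup>2"
      using r by (simp add: f'_def x_def y_def \<kappa>_def power_mult_distrib)
    also have "\<dots> \<le> r powr (- 2 * \<alpha> - 2) * ((1 + d) * x\<^sup>2 + (1 + 1 / d) * (2 * H)\<^sup>2 / n\<^sup>2)"
    proof (rule mult_left_mono)
      \<comment> \<open>Young's inequality with parameter d keeps the leading coefficient within a
        factor 1 + d of \<alpha>^2 and moves the rest to y^2, which is of order 1 / n^2.\<close>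
      have "0 \<le> (d * x + y)\<^sup>2 / d" using d by simp
      also have "\<dots> = (1 + d) * x\<^sup>2 + (1 + 1 / d) * y\<^sup>2 - (y - x)\<^sup>2"
        using d by (simp add: power2_eq_square field_simps)
      finally have "(y - x)\<^sup>2 \<le> (1 + d) * x\<^sup>2 + (1 + 1 / d) * y\<^sup>2" by simp
      also have "y\<^sup>2 \<le> (2 * H)\<^sup>2 / n\<^sup>2"
      proof -
        have "(k' (ln r / n))\<^sup>2 \<le> (2 * H)\<^sup>2" using power_mono[OF k'H[of "ln r / n"], of 2] by simp
        then show ?thesis unfolding y_def power_divide by (rule divide_right_mono) simp
      qed
      finally show "(y - x)\<^sup>2 \<le> (1 + d) * x\<^sup>2 + (1 + 1 / d) * (2 * H)\<^sup>2 / n\<^sup>2"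
        using d by (simp add: mult_left_mono)
    qed simp
    finally show ?thesis by (simp add: x_def power_mult_distrib mult.assoc)
  qed
  have \<kappa>1: "\<kappa> r = 1" if "exp (- 3 * n) \<le> r" "r < exp (- 2 * n)" for r
  proof -
    have r: "r > 0" using that(1) exp_gt_zero[of "- 3 * n"] by linarith
    have "- 3 * n \<le> ln r" "ln r \<le> - 2 * n"
      using that r by (metis exp_ln exp_le_cancel_iff less_imp_le)+
    then have "- 3 \<le> ln r / n" "ln r / n \<le> - 2" using n by (auto simp: field_simps)
    then show ?thesis using k1 r by (simp add: \<kappa>_def)
  qed
  have 1: "f r = r powr - \<alpha> * \<kappa> r" if "r > 0" for r using that by (simp add: f_def \<kappa>_def)
  have 2: "0 \<le> \<kappa> r \<and> \<kappa> r \<le> 1" for r using k01 by (simp add: \<kappa>_def)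
  show ?thesis
    by (intro exI[of _ f] exI[of _ f'] exI[of _ \<kappa>]) (use fD f'c f0 1 2 est \<kappa>1 in simp)
qed

text \<open>Everything is compared with J, the mass of the plateau shell. The error terms are at
  most multiples of 3 J / n^2, while the potential energy is at least exp(-b) J. After J cancels,
  the excess of c over (1 + d) \<alpha>^2 is bounded by a constant over n^2.\<close>

lemma critical_test_functions:
  fixes \<alpha> \<beta> b m c C d H :: real and n :: real
  assumes \<alpha>: "2 * \<alpha> = real CARD('n::finite) - \<beta> - 2" and b: "b \<ge> 0" and m: "m > 0"
    and H: "\<And>t. step' t \<le> H" and n: "n \<ge> 1" and d: "d > 0" and c: "(1 + d) * \<alpha>\<^sup>2 \<le> c"
    and ineq: "\<And>u. u \<in> H1 (weighted_measure \<beta> b m :: (real^'n) measure) \<Longrightarrow>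
        c * (\<integral>x. (u x)\<^sup>2 / (norm x)\<^sup>2 \<partial>weighted_measure \<beta> b m)
          \<le> (\<integral>x. (norm (weak_gradient u x))\<^sup>2 \<partial>weighted_measure \<beta> b m)
            + C * (\<integral>x. (u x)\<^sup>2 \<partial>weighted_measure \<beta> b m)"
  shows "(c - (1 + d) * \<alpha>\<^sup>2) * exp (- b) * n\<^sup>2 \<le> 3 * ((1 + 1 / d) * (2 * H)\<^sup>2 + \<bar>C\<bar>)"
proof -
  have n0: "n > 0" using n by simp
  from critical_profile[OF n0 H, of \<alpha>] obtain f f' \<kappa> where
    f: "\<And>r. (f has_real_derivative f' r) (at r)" "continuous_on UNIV f'"
    and out: "\<And>r. r < exp (- 4 * n) \<or> r \<ge> exp (- n) \<Longrightarrow> f r = 0 \<and> f' r = 0 \<and> \<kappa> r = 0"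
    and f\<kappa>: "\<And>r. r > 0 \<Longrightarrow> f r = r powr - \<alpha> * \<kappa> r"
    and f': "\<And>r d. r > 0 \<Longrightarrow> d > 0 \<Longrightarrow>
      (f' r)\<^sup>2 \<le> r powr (- 2 * \<alpha> - 2) * ((1 + d) * \<alpha>\<^sup>2 * (\<kappa> r)\<^sup>2 + (1 + 1 / d) * (2 * H)\<^sup>2 / n\<^sup>2)"
    and \<kappa>01: "\<And>r. 0 \<le> \<kappa> r \<and> \<kappa> r \<le> 1"
    and \<kappa>1: "\<And>r. exp (- 3 * n) \<le> r \<Longrightarrow> r < exp (- 2 * n) \<Longrightarrow> \<kappa> r = 1"
    by blast
  have f0: "f r = 0" if "r < exp (- 4 * n) \<or> r > exp (- n)" for r using out[of r] that by auto
  let ?W = "\<lambda>x::real^'n. radial_weight \<beta> b m (norm x)"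
  let ?N = "- real CARD('n)"
  define u :: "real^'n \<Rightarrow> real" where "u x = f (norm x)" for x
  define K where "K = (1 + 1 / d) * (2 * H)\<^sup>2"
  have K: "K \<ge> 0" using d by (simp add: K_def)
  define Q :: "real^'n \<Rightarrow> real" where "Q x = ?W x * ((u x)\<^sup>2 / (norm x)\<^sup>2)" for x
  define S where "S = (shell_density (- 4 * n) (- n) :: real^'n \<Rightarrow> real)"
  define S1 where "S1 = (shell_density (- 3 * n) (- 2 * n) :: real^'n \<Rightarrow> real)"
  define J where "J = integral\<^sup>L lebesgue S1"
  have Si: "integrable lebesgue S" "integrable lebesgue S1"
    unfolding S_def S1_def by (rule shell_density_integrable)+
  have S0: "S x \<ge> 0" for x unfolding S_def by (rule shell_density_nonneg)
  have S_in: "S x = norm x powr ?N" if "exp (- 4 * n) \<le> norm x" "norm x < exp (- n)" for x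
    using that by (simp add: S_def shell_density_def shell_def)
  have J: "J > 0" unfolding J_def S1_def by (rule integral_shell_density_pos) (use n in simp)
  \<comment> \<open>The full shell consists of three shells of logarithmic length n, each a dilate
    of the plateau shell.\<close>
  have SJ: "integral\<^sup>L lebesgue S = 3 * J"
  proof -
    let ?I = "\<lambda>p q. integral\<^sup>L (lebesgue :: (real^'n) measure) (shell_density p q)"
    have "integral\<^sup>L lebesgue S = ?I (- 4 * n) (- 3 * n)
        + ?I (- 3 * n) (- n)"
      unfolding S_def by (rule integral_shell_density_add) (use n in auto)
    also have "?I (- 3 * n) (- n) =
        J + ?I (- 2 * n) (- n)"
      unfolding J_def S1_def by (rule integral_shell_density_add) (use n in auto)
    also have "?I (- 4 * n) (- 3 * n) = J"
      using integral_shell_density_shift[of "- 4 * n" n "- 3 * n", where 'a="real^'n"] by (simp add: J_def S1_def)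
    also have "?I (- 2 * n) (- n) = J"
      using integral_shell_density_shift[of "- 3 * n" n "- 2 * n", where 'a="real^'n"] by (simp add: J_def S1_def)
    finally show ?thesis by simp
  qed
  have uH: "u \<in> H1 (weighted_measure \<beta> b m)"
    and uW: "(\<integral>x. (norm (weak_gradient u x))\<^sup>2 \<partial>weighted_measure \<beta> b m) = (\<integral>x. ?W x * (f' (norm x))\<^sup>2 \<partial>lebesgue)"
    unfolding u_def[abs_def] by (rule C1_radial_H1[OF f _ f0]; simp)+
  \<comment> \<open>The exponents add up: -2 \<alpha> - 2 - \<beta> = -N. Criticality of
    r^(-\<alpha>) means that its potential energy density is exactly the dilation-invariant one, up
    to the exponential factor.\<close>
  have E: "r powr (- 2 * \<alpha> - 2) * radial_weight \<beta> b m r = r powr ?N * exp (- b * r powr m)" if "r > 0" for r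
  proof -
    have "r powr ?N = r powr (- 2 * \<alpha> - 2) * r powr - \<beta>"
      unfolding powr_add[symmetric] using \<alpha> by simp
    then show ?thesis by (simp add: radial_weight_def powr_minus divide_inverse)
  qed
  have E1: "r powr (- 2 * \<alpha> - 2) * radial_weight \<beta> b m r \<le> r powr ?N" if "r > 0" for r
    unfolding E[OF that] using b by (intro mult_left_le) auto
  have QE: "Q x = (norm x powr (- 2 * \<alpha> - 2) * ?W x) * (\<kappa> (norm x))\<^sup>2" if "x \<noteq> 0" for x
  proof -
    have p: "norm x > 0" using that by simp
    have "norm x powr (- 2 * \<alpha> - 2) * (norm x)\<^sup>2 = norm x powr (- 2 * \<alpha>)"
      using p by (simp add: powr_diff powr_numeral)
    moreover have "(norm x powr - \<alpha>)\<^sup>2 = norm x powr (- 2 * \<alpha>)"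
      by (simp add: power2_eq_square powr_add[symmetric])
    ultimately have "(u x)\<^sup>2 = norm x powr (- 2 * \<alpha> - 2) * (norm x)\<^sup>2 * (\<kappa> (norm x))\<^sup>2"
      unfolding u_def f\<kappa>[OF p] by (simp add: power_mult_distrib)
    then show ?thesis using p by (simp add: Q_def)
  qed
  \<comment> \<open>On the support r is below exp(-n), hence at most 1 / n, so the mass term carries
    a factor r^2 \<le> 1 / n^2 relative to the potential energy and no C can compensate for
    it.\<close>
  have "n \<le> exp n" using exp_ge_add_one_self[of n] by linarith
  then have exp_n: "exp (- n) \<le> 1 / n"
    using n by (simp add: exp_minus inverse_eq_divide frac_le)
  have exp_1: "exp (- 2 * n) \<le> 1" using n by simp
  have Q0: "Q x \<ge> 0" for x by (simp add: Q_def)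
  have bounds: "Q x \<le> S x \<and> ?W x * (u x)\<^sup>2 \<le> (1 / n\<^sup>2) * S x \<and>
      ?W x * (f' (norm x))\<^sup>2 \<le> (1 + d) * \<alpha>\<^sup>2 * Q x + (K / n\<^sup>2) * S x" for x
  proof (cases "norm x < exp (- 4 * n) \<or> norm x \<ge> exp (- n)")
    case True
    from out[OF this] show ?thesis using S0[of x] K by (simp add: Q_def u_def)
  next
    case False
    then have r: "exp (- 4 * n) \<le> norm x" "norm x < exp (- n)" by auto
    have p: "norm x > 0" using r(1) by (rule less_le_trans[OF exp_gt_zero])
    define e where "e = norm x powr (- 2 * \<alpha> - 2) * ?W x"
    have e: "0 \<le> e" "e \<le> S x" using E1[OF p] S_in[OF r] by (auto simp: e_def)
    have q: "Q x = e * (\<kappa> (norm x))\<^sup>2" unfolding e_def using QE[of x] p by simp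
    have "(\<kappa> (norm x))\<^sup>2 \<le> 1" using \<kappa>01[of "norm x"] by (simp add: power_le_one)
    then have "e * (\<kappa> (norm x))\<^sup>2 \<le> S x * 1" using e by (intro mult_mono) auto
    then have 1: "Q x \<le> S x" by (simp add: q)
    have "norm x \<le> 1 / n" using r(2) exp_n by linarith
    then have "(norm x)\<^sup>2 \<le> (1 / n)\<^sup>2" by (intro power_mono) auto
    then have n2: "(norm x)\<^sup>2 \<le> 1 / n\<^sup>2" by (simp add: power_divide)
    have "?W x * (u x)\<^sup>2 = (norm x)\<^sup>2 * Q x" using p by (simp add: Q_def)
    also have "\<dots> \<le> (1 / n\<^sup>2) * S x" using n2 1 Q0 by (intro mult_mono) auto
    finally have 2: "?W x * (u x)\<^sup>2 \<le> (1 / n\<^sup>2) * S x" .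
    have "?W x * (f' (norm x))\<^sup>2 \<le>
        ?W x * (norm x powr (- 2 * \<alpha> - 2) * ((1 + d) * \<alpha>\<^sup>2 * (\<kappa> (norm x))\<^sup>2 + (1 + 1 / d) * (2 * H)\<^sup>2 / n\<^sup>2))"
      by (rule mult_left_mono[OF f'[OF p d]]) simp
    also have "\<dots> = (1 + d) * \<alpha>\<^sup>2 * Q x + (K / n\<^sup>2) * e"
      unfolding q K_def e_def by (simp add: algebra_simps)
    also have "\<dots> \<le> (1 + d) * \<alpha>\<^sup>2 * Q x + (K / n\<^sup>2) * S x"
      using e K by (intro add_left_mono mult_left_mono) auto
    finally show ?thesis using 1 2 by blast
  qed
  note QS = bounds[THEN conjunct1] and WS = bounds[THEN conjunct2, THEN conjunct1]
    and GS = bounds[THEN conjunct2, THEN conjunct2]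
  \<comment> \<open>On the middle shell the cut-off is 1 and r \<le> 1, so the exponential factor is
    at least exp(-b), uniformly in n.\<close>
  have S1Q: "exp (- b) * S1 x \<le> Q x" for x
  proof (cases "exp (- 3 * n) \<le> norm x \<and> norm x < exp (- 2 * n)")
    case True
    have p: "norm x > 0" using True by (meson exp_gt_zero less_le_trans)
    have "norm x \<le> 1" using True exp_1 by linarith
    then have "norm x powr m \<le> 1" using m p by (intro powr_le1) auto
    then have "b * norm x powr m \<le> b" using b by (rule mult_left_le)
    then have "exp (- b) \<le> exp (- b * norm x powr m)" by simp
    moreover have "Q x = norm x powr ?N * exp (- b * norm x powr m)"
      using QE[of x] \<kappa>1[of "norm x"] True p E[OF p] by simp
    moreover have "S1 x = norm x powr ?N" using True by (simp add: S1_def shell_density_def shell_def)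
    ultimately show ?thesis
      using mult_right_mono[of "exp (- b)" "exp (- b * norm x powr m)" "norm x powr ?N"]
      by (simp only: mult.commute powr_ge_zero)
  next
    case False
    then have "S1 x = 0" by (auto simp: S1_def shell_density_def shell_def)
    then show ?thesis using Q0 by simp
  qed
  have um: "u \<in> borel_measurable lebesgue"
    using uH by (simp add: H1_def L2_weighted_measure)
  have nm: "(\<lambda>x::real^'n. norm x) \<in> borel_measurable lebesgue"
    by (intro measurable_completion) simp
  have qm: "(\<lambda>x. (u x)\<^sup>2 / (norm x)\<^sup>2) \<in> borel_measurable lebesgue"
    by (intro borel_measurable_divide borel_measurable_power um nm)
  have Qm: "Q \<in> borel_measurable lebesgue"
    unfolding Q_def[abs_def] by (intro borel_measurable_times radial_weight_measurable qm)
  have f'm: "(\<lambda>x::real^'n. (f' (norm x))\<^sup>2) \<in> borel_measurable lebesgue"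
  proof -
    have "continuous_on UNIV (\<lambda>x::real^'n. (f' (norm x))\<^sup>2)"
      by (intro continuous_on_power continuous_on_compose2[OF f(2)] continuous_on_norm_id) auto
    then show ?thesis by (intro measurable_completion) (simp add: borel_measurable_continuous_onI)
  qed
  have Qi: "integrable lebesgue Q"
    by (rule Bochner_Integration.integrable_bound[OF Si(1) Qm]) (use QS Q0 S0 in auto)
  have Gi: "integrable lebesgue (\<lambda>x. (1 + d) * \<alpha>\<^sup>2 * Q x + (K / n\<^sup>2) * S x)"
    using Qi Si by simp
  have Fi: "integrable lebesgue (\<lambda>x. ?W x * (f' (norm x))\<^sup>2)"
    by (rule Bochner_Integration.integrable_bound[OF Gi borel_measurable_times[OF radial_weight_measurable f'm]])
       (use GS in \<open>auto intro!: AE_I2 order_trans[OF _ abs_ge_self]\<close>)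
  have Ui: "integrable lebesgue (\<lambda>x. ?W x * (u x)\<^sup>2)"
    using uH by (simp add: H1_def L2_weighted_measure)
  have U0: "0 \<le> (\<integral>x. ?W x * (u x)\<^sup>2 \<partial>lebesgue)" by simp
  have U: "(\<integral>x. ?W x * (u x)\<^sup>2 \<partial>lebesgue) \<le> (1 / n\<^sup>2) * (3 * J)"
    using integral_mono[OF Ui _ WS] Si(1) SJ by simp
  have F: "(\<integral>x. ?W x * (f' (norm x))\<^sup>2 \<partial>lebesgue) \<le> (1 + d) * \<alpha>\<^sup>2 * integral\<^sup>L lebesgue Q + (K / n\<^sup>2) * (3 * J)"
    using integral_mono[OF Fi Gi GS] Qi Si(1) SJ by simp
  have QJ: "exp (- b) * J \<le> integral\<^sup>L lebesgue Q"
    using integral_mono[OF _ Qi S1Q] Si(2) by (simp add: J_def)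
  have "c * integral\<^sup>L lebesgue Q \<le> (\<integral>x. ?W x * (f' (norm x))\<^sup>2 \<partial>lebesgue) + C * (\<integral>x. ?W x * (u x)\<^sup>2 \<partial>lebesgue)"
    using ineq[OF uH] um unfolding uW integral_weighted_measure[OF qm]
    by (simp add: integral_weighted_measure Q_def[abs_def])
  also have "C * (\<integral>x. ?W x * (u x)\<^sup>2 \<partial>lebesgue) \<le> \<bar>C\<bar> * ((1 / n\<^sup>2) * (3 * J))"
    using U U0 by (intro mult_mono) auto
  finally have "(c - (1 + d) * \<alpha>\<^sup>2) * integral\<^sup>L lebesgue Q \<le> (3 * (K + \<bar>C\<bar>) / n\<^sup>2) * J"
    using F by (simp add: algebra_simps add_divide_distrib)
  moreover have "(c - (1 + d) * \<alpha>\<^sup>2) * (exp (- b) * J) \<le> (c - (1 + d) * \<alpha>\<^sup>2) * integral\<^sup>L lebesgue Q"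
    using QJ c by (intro mult_left_mono) auto
  ultimately have "((c - (1 + d) * \<alpha>\<^sup>2) * exp (- b)) * J \<le> (3 * (K + \<bar>C\<bar>) / n\<^sup>2) * J"
    by (simp add: mult.assoc)
  then have "(c - (1 + d) * \<alpha>\<^sup>2) * exp (- b) \<le> 3 * (K + \<bar>C\<bar>) / n\<^sup>2"
    using J by (rule mult_right_le_imp_le)
  then show ?thesis using n0 by (simp add: K_def pos_le_divide_eq)
qed

theorem hardy_constant_optimal:
  fixes \<beta> m b c C :: real
  assumes \<beta>: "\<beta> < real CARD('n::finite) - 2" and m: "m > 0" and b: "b \<ge> 0"
    and c: "c > ((real CARD('n) - \<beta> - 2) / 2)\<^sup>2"
  shows "\<not> (\<forall>u\<in>H1 (weighted_measure \<beta> b m :: (real^'n) measure).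
      c * (\<integral>x. (u x)\<^sup>2 / (norm x)\<^sup>2 \<partial>weighted_measure \<beta> b m)
        \<le> (\<integral>x. (norm (weak_gradient u x))\<^sup>2 \<partial>weighted_measure \<beta> b m)
          + C * (\<integral>x. (u x)\<^sup>2 \<partial>weighted_measure \<beta> b m))" (is "\<not> ?ineq")
proof
  assume *: ?ineq
  define \<alpha> where "\<alpha> = (real CARD('n) - \<beta> - 2) / 2"
  have \<alpha>: "\<alpha> > 0" "2 * \<alpha> = real CARD('n) - \<beta> - 2" using \<beta> by (auto simp: \<alpha>_def)
  obtain H where H: "H > 0" "\<And>t. step' t \<le> H" using step'_bounded by blast
  have ca: "c > \<alpha>\<^sup>2" using c by (simp add: \<alpha>_def)
  \<comment> \<open>This d places (1 + d) \<alpha>^2 halfway between \<alpha>^2 and c.\<close>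
  define d where "d = (c - \<alpha>\<^sup>2) / (2 * \<alpha>\<^sup>2)"
  have d: "d > 0" using \<alpha> ca by (simp add: d_def)
  have "d * \<alpha>\<^sup>2 = (c - \<alpha>\<^sup>2) / 2" using \<alpha>(1) by (simp add: d_def)
  then have cd: "c - (1 + d) * \<alpha>\<^sup>2 = (c - \<alpha>\<^sup>2) / 2" by (simp add: distrib_right)
  then have cd': "(1 + d) * \<alpha>\<^sup>2 \<le> c" using ca by simp
  define q where "q = (c - (1 + d) * \<alpha>\<^sup>2) * exp (- b)"
  have q: "q > 0" using cd ca by (simp add: q_def)
  define B where "B = 3 * ((1 + 1 / d) * (2 * H)\<^sup>2 + \<bar>C\<bar>)"
  have B: "q * n\<^sup>2 \<le> B" if "n \<ge> 1" for n
    unfolding q_def B_def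
    by (rule critical_test_functions[OF \<alpha>(2) b m H(2) that d cd']) (use * in blast)
  \<comment> \<open>Then q n = |B| + q exceeds B, while n \<ge> 1 gives q n \<le> q n^2 \<le>
    B.\<close>
  define n where "n = \<bar>B\<bar> / q + 1"
  have n: "n \<ge> 1" using q by (simp add: n_def)
  have "B < q * n" using q by (simp add: n_def distrib_left)
  also have "q * n \<le> q * n\<^sup>2" using q n by (simp add: power2_eq_square)
  finally show False using B[OF n] by simp
qed

theorem proposition5p2:
  fixes \<beta> m b :: real and \<mu> :: "(real^'n::finite) measure"
  assumes "CARD('n) \<ge> 3"
    and "\<beta> < real CARD('n) - 2"
    and "m > 0"
    and "b \<ge> 0"
    and "\<mu> = weighted_measure \<beta> b m"
  shows "(\<exists>C\<ge>0. \<forall>u\<in>H1 \<mu>.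
            integrable \<mu> (\<lambda>x. (u x)\<^sup>2 / (norm x)\<^sup>2) \<and>
            ((real CARD('n) - \<beta> - 2) / 2)\<^sup>2 * (\<integral>x. (u x)\<^sup>2 / (norm x)\<^sup>2 \<partial>\<mu>)
              \<le> (\<integral>x. (norm (weak_gradient u x))\<^sup>2 \<partial>\<mu>) + C * (\<integral>x. (u x)\<^sup>2 \<partial>\<mu>))
       \<and> (\<forall>c > ((real CARD('n) - \<beta> - 2) / 2)\<^sup>2. \<not> (\<exists>C::real. \<forall>u\<in>H1 \<mu>.
            c * (\<integral>x. (u x)\<^sup>2 / (norm x)\<^sup>2 \<partial>\<mu>)
              \<le> (\<integral>x. (norm (weak_gradient u x))\<^sup>2 \<partial>\<mu>) + C * (\<integral>x. (u x)\<^sup>2 \<partial>\<mu>)))"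
  unfolding \<open>\<mu> = weighted_measure \<beta> b m\<close>
proof (intro conjI allI impI notI hardy_inequality[OF assms(2-4)])
qed (use hardy_constant_optimal[OF assms(2-4)] in blast)

end
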